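(* Let $2<p\le 1+\frac{2^*}{2}$ (with $p<\infty$), and let $u_0\in H^1_{\Gamma_0}(\Omega)$ belong to one of the sets \[\mathcal B_1=\{w\in H^1_{\Gamma_0}(\Omega): J(w)<d \text{ and } K(w)<0\},\] \[\mathcal B_2=\Big\{w\in H^1_{\Gamma_0}(\Omega): J(w)<\frac{p-2}{2p(S_1+S_2)}\big(\|w\|_2^2+\|w\|_{2,\Gamma_1}^2\big)\Big\}.\] Then the maximal weak solution $u$ of problem (P) with initial datum $u_0$ blows up in finite time. Moreover, if $u_0\in\mathcal B_1$, then \[T_{max}\le \frac{4(p-1)}{p(p-2)^2}\cdot\frac{\|u_0\|_2^2+\|u_0\|_{2,\Gamma_1}^2}{d-J(u_0)};\] if $u_0\in\mathcal B_2$, then \[T_{max}\le \frac{4(p-1)}{p(p-2)^2}\cdot\frac{\|u_0\|_2^2+\|u_0\|_{2,\Gamma_1}^2}{\frac{p-2}{2p(S_1+S_2)}\big(\|u_0\|_2^2+\|u_0\|_{2,\Gamma_1}^2\big)-J(u_0)}.\]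
   Context: Setting. $\Omega\subset\mathbb R^n$ ($n\ge1$) is a bounded open set with $C^1$ boundary, $\nu$ is the unit outward normal, $\partial\Omega=\Gamma_0\cup\Gamma_1$ is a partition into measurable sets with $\overline{\Gamma_0}\cap\overline{\Gamma_1}=\emptyset$, $\sigma$ is the $(n-1)$-dimensional surface measure, and $\sigma(\Gamma_0)>0$. $2^*=\frac{2n}{n-2}$ if $n\ge3$, $2^*=\infty$ if $n=1,2$. Problem (P) is \[u_t-\Delta u=|u|^{p-2}u \text{ in }\Omega,\ t>0;\quad u=0 \text{ on }\Gamma_0,\ t>0;\quad \tfrac{\partial u}{\partial\nu}=-u_t \text{ on }\Gamma_1,\ t>0;\quad u(x,0)=u_0(x) \text{ in }\Omega.\] Notation. $\|\cdot\|_q$, $\|\cdot\|_{q,\Gamma_1}$ are the norms of $L^q(\Omega)$, $L^q(\Gamma_1)$; $(\cdot,\cdot)$, $(\cdot,\cdot)_{\Gamma_1}$ are the inner products of $L^2(\Omega)$, $L^2(\Gamma_1)$. $H^1_{\Gamma_0}(\Omega)=\{w\in H^1(\Omega): w|_{\Gamma_0}=0\}$ (trace sense), with norm $\|w\|_{H^1_{\Gamma_0}}=(\|w\|_2^2+\|\nabla w\|_2^2)^{1/2}$. Standing fact: since $\sigma(\Gamma_0)>0$, a Poincaré-type inequality holds, so $\|\nabla w\|_2$ is an equivalent norm on $H^1_{\Gamma_0}(\Omega)$, and the following constants are finite: \[S_1=\sup_{w\in H^1_{\Gamma_0}(\Omega),\,w\ne0}\frac{\|w\|_{2,\Gamma_1}^2}{\|\nabla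 w\|_2^2},\qquad S_2=\sup_{w\in H^1_{\Gamma_0}(\Omega),\,w\ne0}\frac{\|w\|_2^2}{\|\nabla w\|_2^2}.\] Functionals on $H^1_{\Gamma_0}(\Omega)$: $J(w)=\frac12\|\nabla w\|_2^2-\frac1p\|w\|_p^p$, $K(w)=\|\nabla w\|_2^2-\|w\|_p^p$. Potential well depth: $d=\inf_{w\in N}J(w)$, where $N=\{w\in H^1_{\Gamma_0}(\Omega): K(w)=0\}\setminus\{0\}$. Weak solution. For $u_0\in H^1_{\Gamma_0}(\Omega)$, $u$ is a weak solution of (P) in $[0,T]\times\Omega$ if: (a) $u\in L^\infty(0,T;H^1_{\Gamma_0}(\Omega))$ and $u_t\in L^2((0,T)\times\Omega)$; (b) the spatial trace of $u$ on $(0,T)\times\partial\Omega$ has a distributional time derivative, also denoted $u_t$, in $L^2((0,T)\times\partial\Omega)$; (c) for all $\phi\in H^1_{\Gamma_0}(\Omega)$ and a.e. $t\in[0,T]$, $(u_t(t),\phi)+(\nabla u(t),\nabla\phi)+(u_t(t),\phi)_{\Gamma_1}=\int_\Omega|u(t)|^{p-2}u(t)\phi\,dx$; (d) $u(0)=u_0$. Known local theory (may be assumed). For $2\le p\le1+\frac{2^*}{2}$ and every $u_0\in H^1_{\Gamma_0}(\Omega)$ there is a unique maximal weak solution $u$ in $[0,T_{max})\times\Omega$; $u\in C([0,T_{max});H^1_{\Gamma_0}(\Omega))$; $u_t\in L^2((0,T)\times\Gamma_1)\cap L^2((0,T)\times\Omega)$ for every $T\in(0,T_{max})$; for $0\le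 s\le t<T_{max}$, \[\tfrac12\|\nabla u\|_2^2\Big|_s^t+\int_s^t\big(\|u_t(\tau)\|_2^2+\|u_t(\tau)\|_{2,\Gamma_1}^2\big)d\tau=\int_s^t\int_\Omega|u|^{p-2}uu_t\,dx\,d\tau;\] and either $T_{max}=\infty$, or $T_{max}<\infty$ and $\lim_{t\to T_{max}^-}\|u(t)\|_{H^1_{\Gamma_0}}=+\infty$. "$u$ blows up in finite time" means that the second alternative holds. Moreover $t\mapsto\|u(t)\|_p^p$ is differentiable a.e. on $(0,T_{max})$ with $\frac{d}{dt}\|u(t)\|_p^p=p\int_\Omega|u|^{p-2}uu_t\,dx$, and $J(u(t))-J(u_0)=-\int_0^t(\|u_t\|_2^2+\|u_t\|_{2,\Gamma_1}^2)d\tau$. *)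

theory Defs
  imports "HOL-Analysis.Analysis"
begin

section \<open>Lebesgue spaces, smooth functions\<close>

text \<open>
  Elements of Lebesgue and Sobolev spaces are represented by functions; two functions that agree
  almost everywhere represent the same element. For integrable powers (the only case that
  occurs), \<open>Lq_norm q M f\<close> is the norm of \<open>f\<close> in \<open>L\<^sup>q(M)\<close>, \<open>0 < q < \<infinity>\<close>.
\<close>

definition Lq_norm :: "real \<Rightarrow> 'b measure \<Rightarrow> ('b \<Rightarrow> 'c::real_normed_vector) \<Rightarrow> real" where
  "Lq_norm q M f = (\<integral>x. norm (f x) powr q \<partial>M) powr (1 / q)"

definition L2_space :: "'b measure \<Rightarrow> ('b \<Rightarrow> 'c::euclidean_space) set" where
  "L2_space M = {f \<in> borel_measurable M. integrable M (\<lambda>x. (norm (f x))\<^sup>2)}"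

definition partial_deriv :: "'a::euclidean_space \<Rightarrow> ('a \<Rightarrow> real) \<Rightarrow> 'a \<Rightarrow> real" where
  "partial_deriv b f x = frechet_derivative f (at x) b"

primrec Ck :: "nat \<Rightarrow> ('a::euclidean_space \<Rightarrow> real) \<Rightarrow> bool" where
  "Ck 0 f \<longleftrightarrow> continuous_on UNIV f"
| "Ck (Suc k) f \<longleftrightarrow> (\<forall>x. f differentiable at x) \<and> (\<forall>b\<in>Basis. Ck k (partial_deriv b f))"

definition smooth :: "('a::euclidean_space \<Rightarrow> real) \<Rightarrow> bool" where
  "smooth f \<longleftrightarrow> (\<forall>k. Ck k f)"

definition test_fun :: "'a::euclidean_space set \<Rightarrow> ('a \<Rightarrow> real) set" where
  "test_fun U = {\<phi>. smooth \<phi> \<and> (\<exists>K. compact K \<and> K \<subseteq> U \<and> (\<forall>x. x \<notin> K \<longrightarrow> \<phi> x = 0))}"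


section \<open>Domains with \<open>C\<^sup>1\<close> boundary and surface measure\<close>

text \<open>
  Near each boundary point, \<open>\<Omega>\<close> is the region below the graph of a \<open>C\<^sup>1\<close> function over a
  hyperplane orthogonal to some unit vector \<open>e\<close>; the value of \<open>h\<close> is used only at the
  orthogonal projection of \<open>x\<close> to that hyperplane.
\<close>

definition C1_domain :: "'a::euclidean_space set \<Rightarrow> bool" where
  "C1_domain \<Omega> \<longleftrightarrow> open \<Omega> \<and> bounded \<Omega> \<and>
    (\<forall>z\<in>frontier \<Omega>. \<exists>r>0. \<exists>e h. norm e = 1 \<and> Ck 1 h \<and>
      (\<forall>x\<in>ball z r. x \<in> \<Omega> \<longleftrightarrow> x \<bullet> e < h (x - (x \<bullet> e) *\<^sub>R e)))"

text \<open>
  Hausdorff measure of integer dimension \<open>s\<close>, normalised so that it agrees with Lebesgue measure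
  on \<open>s\<close>-dimensional subspaces. For \<open>s = 0\<close> the convention \<open>0 ^ 0 = 1\<close> makes it the counting
  measure.
\<close>

definition hausdorff_size :: "nat \<Rightarrow> 'a::metric_space set \<Rightarrow> ennreal" where
  "hausdorff_size s C =
     (if C = {} then 0 else ennreal (unit_ball_vol (real s) * (diameter C / 2) ^ s))"

definition hausdorff_content :: "nat \<Rightarrow> real \<Rightarrow> 'a::metric_space set \<Rightarrow> ennreal" where
  "hausdorff_content s \<delta> A =
     (INF C \<in> {C :: nat \<Rightarrow> 'a set. A \<subseteq> (\<Union>i. C i) \<and> (\<forall>i. bounded (C i) \<and> diameter (C i) \<le> \<delta>)}.
        \<Sum>i. hausdorff_size s (C i))"

definition hausdorff_outer :: "nat \<Rightarrow> 'a::metric_space set \<Rightarrow> ennreal" where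
  "hausdorff_outer s A = (SUP \<delta>\<in>{0<..}. hausdorff_content s \<delta> A)"

definition hausdorff_measure :: "nat \<Rightarrow> 'a::metric_space measure" where
  "hausdorff_measure s = measure_of UNIV (sets borel) (hausdorff_outer s)"

definition surf :: "'a::euclidean_space set \<Rightarrow> 'a measure" where
  "surf \<Gamma> = restrict_space (hausdorff_measure (DIM('a) - 1)) \<Gamma>"

text \<open>
  The measurability of the two parts is recorded with Borel sets; since the closures are disjoint
  and the union is closed, both parts are in fact closed.
\<close>

definition boundary_partition :: "'a::euclidean_space set \<Rightarrow> 'a set \<Rightarrow> 'a set \<Rightarrow> bool" where
  "boundary_partition \<Omega> \<Gamma>0 \<Gamma>1 \<longleftrightarrow>
     \<Gamma>0 \<union> \<Gamma>1 = frontier \<Omega> \<and> \<Gamma>0 \<inter> \<Gamma>1 = {} \<and> \<Gamma>0 \<in> sets borel \<and> \<Gamma>1 \<in> sets borel \<and>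
     closure \<Gamma>0 \<inter> closure \<Gamma>1 = {}"


section \<open>Sobolev spaces and traces\<close>

definition weak_grad :: "'a::euclidean_space set \<Rightarrow> ('a \<Rightarrow> real) \<Rightarrow> ('a \<Rightarrow> 'a) \<Rightarrow> bool" where
  "weak_grad \<Omega> w G \<longleftrightarrow>
     (\<forall>\<phi>\<in>test_fun \<Omega>. \<forall>b\<in>Basis.
        (\<integral>x. w x * partial_deriv b \<phi> x \<partial>lebesgue_on \<Omega>) = - (\<integral>x. (G x \<bullet> b) * \<phi> x \<partial>lebesgue_on \<Omega>))"

definition H1 :: "'a::euclidean_space set \<Rightarrow> ('a \<Rightarrow> real) set" where
  "H1 \<Omega> = {w \<in> L2_space (lebesgue_on \<Omega>). \<exists>G \<in> L2_space (lebesgue_on \<Omega>). weak_grad \<Omega> w G}"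

text \<open>The choice is unique up to null sets.\<close>

definition grad :: "'a::euclidean_space set \<Rightarrow> ('a \<Rightarrow> real) \<Rightarrow> 'a \<Rightarrow> 'a" where
  "grad \<Omega> w = (SOME G. G \<in> L2_space (lebesgue_on \<Omega>) \<and> weak_grad \<Omega> w G)"

definition H1_norm :: "'a::euclidean_space set \<Rightarrow> ('a \<Rightarrow> real) \<Rightarrow> real" where
  "H1_norm \<Omega> w =
     sqrt ((Lq_norm 2 (lebesgue_on \<Omega>) w)\<^sup>2 + (Lq_norm 2 (lebesgue_on \<Omega>) (grad \<Omega> w))\<^sup>2)"

text \<open>
  The trace operator is the continuous extension to \<open>H\<^sup>1(\<Omega>)\<close> of the restriction to \<open>\<partial>\<Omega>\<close> of functions
  smooth up to the boundary. On a bounded \<open>C\<^sup>1\<close> domain, the trace in \<open>L\<^sup>2(\<partial>\<Omega>)\<close> exists and is unique up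
  to null sets; \<open>bd_trace\<close> chooses a representative.
\<close>

definition is_trace :: "'a::euclidean_space set \<Rightarrow> ('a \<Rightarrow> real) \<Rightarrow> ('a \<Rightarrow> real) \<Rightarrow> bool" where
  "is_trace \<Omega> w g \<longleftrightarrow> w \<in> H1 \<Omega> \<and> g \<in> L2_space (surf (frontier \<Omega>)) \<and>
     (\<exists>\<phi> :: nat \<Rightarrow> 'a \<Rightarrow> real. (\<forall>k. smooth (\<phi> k)) \<and>
        (\<lambda>k. H1_norm \<Omega> (\<lambda>x. \<phi> k x - w x)) \<longlonglongrightarrow> 0 \<and>
        (\<lambda>k. Lq_norm 2 (surf (frontier \<Omega>)) (\<lambda>x. \<phi> k x - g x)) \<longlonglongrightarrow> 0)"

definition bd_trace :: "'a::euclidean_space set \<Rightarrow> ('a \<Rightarrow> real) \<Rightarrow> 'a \<Rightarrow> real" where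
  "bd_trace \<Omega> w = (SOME g. is_trace \<Omega> w g)"

definition H1_0 :: "'a::euclidean_space set \<Rightarrow> 'a set \<Rightarrow> ('a \<Rightarrow> real) set" where
  "H1_0 \<Omega> \<Gamma>0 = {w \<in> H1 \<Omega>. \<exists>g. is_trace \<Omega> w g \<and> (AE x in surf \<Gamma>0. g x = 0)}"

definition ae_zero :: "'a::euclidean_space set \<Rightarrow> ('a \<Rightarrow> real) \<Rightarrow> bool" where
  "ae_zero \<Omega> w \<longleftrightarrow> (AE x in lebesgue_on \<Omega>. w x = 0)"

text \<open>
  \<open>norm_Om q\<close>, \<open>norm_grad\<close>, \<open>norm_Gam\<close> are \<open>\<parallel>w\<parallel>\<^sub>q\<close>, \<open>\<parallel>\<nabla>w\<parallel>\<^sub>2\<close> and \<open>\<parallel>w\<parallel>\<close> in \<open>L\<^sup>2(\<Gamma>)\<close>, the last one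
  through the trace.
\<close>

abbreviation norm_Om :: "real \<Rightarrow> 'a::euclidean_space set \<Rightarrow> ('a \<Rightarrow> real) \<Rightarrow> real" where
  "norm_Om q \<Omega> w \<equiv> Lq_norm q (lebesgue_on \<Omega>) w"

abbreviation norm_grad :: "'a::euclidean_space set \<Rightarrow> ('a \<Rightarrow> real) \<Rightarrow> real" where
  "norm_grad \<Omega> w \<equiv> Lq_norm 2 (lebesgue_on \<Omega>) (grad \<Omega> w)"

abbreviation norm_Gam :: "'a::euclidean_space set \<Rightarrow> 'a set \<Rightarrow> ('a \<Rightarrow> real) \<Rightarrow> real" where
  "norm_Gam \<Omega> \<Gamma> w \<equiv> Lq_norm 2 (surf \<Gamma>) (bd_trace \<Omega> w)"

definition two_star :: "nat \<Rightarrow> ereal" where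
  "two_star n = (if n \<ge> 3 then ereal (2 * real n / (real n - 2)) else \<infinity>)"

text \<open>
  The Poincare-type inequality together with the finiteness of the two suprema below. It does not
  follow from the other hypotheses, since \<open>\<Omega>\<close> may have a component whose boundary does not meet
  \<open>\<Gamma>0\<close>. The bound is required for every representative of the trace.
\<close>

definition poincare_trace_ineq :: "'a::euclidean_space set \<Rightarrow> 'a set \<Rightarrow> 'a set \<Rightarrow> bool" where
  "poincare_trace_ineq \<Omega> \<Gamma>0 \<Gamma>1 \<longleftrightarrow>
     (\<exists>C::real. \<forall>w\<in>H1_0 \<Omega> \<Gamma>0.
        (norm_Om 2 \<Omega> w)\<^sup>2 \<le> C * (norm_grad \<Omega> w)\<^sup>2 \<and>
        (\<forall>g. is_trace \<Omega> w g \<longrightarrow> (Lq_norm 2 (surf \<Gamma>1) g)\<^sup>2 \<le> C * (norm_grad \<Omega> w)\<^sup>2))"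

definition S1 :: "'a::euclidean_space set \<Rightarrow> 'a set \<Rightarrow> 'a set \<Rightarrow> real" where
  "S1 \<Omega> \<Gamma>0 \<Gamma>1 =
     (SUP w\<in>{w \<in> H1_0 \<Omega> \<Gamma>0. \<not> ae_zero \<Omega> w}. (norm_Gam \<Omega> \<Gamma>1 w)\<^sup>2 / (norm_grad \<Omega> w)\<^sup>2)"

definition S2 :: "'a::euclidean_space set \<Rightarrow> 'a set \<Rightarrow> real" where
  "S2 \<Omega> \<Gamma>0 =
     (SUP w\<in>{w \<in> H1_0 \<Omega> \<Gamma>0. \<not> ae_zero \<Omega> w}. (norm_Om 2 \<Omega> w)\<^sup>2 / (norm_grad \<Omega> w)\<^sup>2)"


section \<open>Potential well\<close>

definition J :: "'a::euclidean_space set \<Rightarrow> real \<Rightarrow> ('a \<Rightarrow> real) \<Rightarrow> real" where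
  "J \<Omega> p w = 1 / 2 * (norm_grad \<Omega> w)\<^sup>2 - 1 / p * norm_Om p \<Omega> w powr p"

definition K :: "'a::euclidean_space set \<Rightarrow> real \<Rightarrow> ('a \<Rightarrow> real) \<Rightarrow> real" where
  "K \<Omega> p w = (norm_grad \<Omega> w)\<^sup>2 - norm_Om p \<Omega> w powr p"

definition Nehari :: "'a::euclidean_space set \<Rightarrow> 'a set \<Rightarrow> real \<Rightarrow> ('a \<Rightarrow> real) set" where
  "Nehari \<Omega> \<Gamma>0 p = {w \<in> H1_0 \<Omega> \<Gamma>0. K \<Omega> p w = 0 \<and> \<not> ae_zero \<Omega> w}"

definition well_depth :: "'a::euclidean_space set \<Rightarrow> 'a set \<Rightarrow> real \<Rightarrow> real" where
  "well_depth \<Omega> \<Gamma>0 p = (INF w\<in>Nehari \<Omega> \<Gamma>0 p. J \<Omega> p w)"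

definition B1 :: "'a::euclidean_space set \<Rightarrow> 'a set \<Rightarrow> real \<Rightarrow> ('a \<Rightarrow> real) set" where
  "B1 \<Omega> \<Gamma>0 p = {w \<in> H1_0 \<Omega> \<Gamma>0. J \<Omega> p w < well_depth \<Omega> \<Gamma>0 p \<and> K \<Omega> p w < 0}"

definition B2 :: "'a::euclidean_space set \<Rightarrow> 'a set \<Rightarrow> 'a set \<Rightarrow> real \<Rightarrow> ('a \<Rightarrow> real) set" where
  "B2 \<Omega> \<Gamma>0 \<Gamma>1 p = {w \<in> H1_0 \<Omega> \<Gamma>0.
     J \<Omega> p w < (p - 2) / (2 * p * (S1 \<Omega> \<Gamma>0 \<Gamma>1 + S2 \<Omega> \<Gamma>0)) *
       ((norm_Om 2 \<Omega> w)\<^sup>2 + (norm_Gam \<Omega> \<Gamma>1 w)\<^sup>2)}"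


section \<open>Weak solutions\<close>

text \<open>Bochner measurability, with simple functions, and essential boundedness in the \<open>H\<^sup>1\<close> norm.\<close>

definition Linf_H1_0 ::
  "'a::euclidean_space set \<Rightarrow> 'a set \<Rightarrow> real \<Rightarrow> (real \<Rightarrow> 'a \<Rightarrow> real) \<Rightarrow> bool" where
  "Linf_H1_0 \<Omega> \<Gamma>0 T u \<longleftrightarrow>
     (\<exists>s :: nat \<Rightarrow> real \<Rightarrow> 'a \<Rightarrow> real.
        (\<forall>k. finite (s k ` {0<..<T}) \<and> s k ` {0<..<T} \<subseteq> H1_0 \<Omega> \<Gamma>0 \<and>
             (\<forall>w. {t \<in> {0<..<T}. s k t = w} \<in> sets lebesgue)) \<and>
        (AE t in lebesgue_on {0<..<T}. (\<lambda>k. H1_norm \<Omega> (\<lambda>x. u t x - s k t x)) \<longlonglongrightarrow> 0)) \<and>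
     (\<exists>C::real. AE t in lebesgue_on {0<..<T}. u t \<in> H1_0 \<Omega> \<Gamma>0 \<and> H1_norm \<Omega> (u t) \<le> C)"

text \<open>
  \<open>v\<close>, square integrable on \<open>(0,T) \<times> X\<close> for the product of Lebesgue measure and the measure \<open>M\<close> on
  \<open>X\<close>, is the distributional time derivative of \<open>u\<close>. It is used with \<open>X = U = \<Omega>\<close>, and with
  \<open>X = \<partial>\<Omega>\<close> and \<open>U\<close> the whole space, where the test functions are restrictions to
  \<open>(0,T) \<times> \<partial>\<Omega>\<close>. The vector \<open>(1,0)\<close> is the time direction.
\<close>

definition time_deriv ::
  "real \<Rightarrow> 'a::euclidean_space set \<Rightarrow> 'a measure \<Rightarrow> (real \<Rightarrow> 'a \<Rightarrow> real) \<Rightarrow> (real \<Rightarrow> 'a \<Rightarrow> real) \<Rightarrow> bool"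
  where
  "time_deriv T U M u v \<longleftrightarrow>
     (\<lambda>(t, x). v t x) \<in> L2_space (lebesgue_on {0<..<T} \<Otimes>\<^sub>M M) \<and>
     (\<forall>\<phi>\<in>test_fun ({0<..<T} \<times> U).
        (\<integral>t. (\<integral>x. u t x * partial_deriv (1, 0) \<phi> (t, x) \<partial>M) \<partial>lebesgue_on {0<..<T}) =
        - (\<integral>t. (\<integral>x. v t x * \<phi> (t, x) \<partial>M) \<partial>lebesgue_on {0<..<T}))"

text \<open>
  \<open>v\<close> and \<open>vb\<close> represent \<open>u\<^sub>t\<close> in \<open>(0,T) \<times> \<Omega>\<close> and on \<open>(0,T) \<times> \<partial>\<Omega>\<close>. Since \<open>u\<close> and \<open>u\<^sub>t\<close> are in
  \<open>L\<^sup>2((0,T) \<times> \<Omega>)\<close>, \<open>u\<close> has a representative in \<open>C([0,T]; L\<^sup>2(\<Omega>))\<close>; \<open>u\<close> denotes this one, which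
  gives its meaning to the initial condition.
\<close>

definition weak_solution ::
  "'a::euclidean_space set \<Rightarrow> 'a set \<Rightarrow> 'a set \<Rightarrow> real \<Rightarrow> ('a \<Rightarrow> real) \<Rightarrow> real \<Rightarrow>
   (real \<Rightarrow> 'a \<Rightarrow> real) \<Rightarrow> (real \<Rightarrow> 'a \<Rightarrow> real) \<Rightarrow> (real \<Rightarrow> 'a \<Rightarrow> real) \<Rightarrow> bool" where
  "weak_solution \<Omega> \<Gamma>0 \<Gamma>1 p u0 T u v vb \<longleftrightarrow>
     Linf_H1_0 \<Omega> \<Gamma>0 T u \<and>
     time_deriv T \<Omega> (lebesgue_on \<Omega>) u v \<and>
     time_deriv T UNIV (surf (frontier \<Omega>)) (\<lambda>t. bd_trace \<Omega> (u t)) vb \<and>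
     (\<forall>\<phi>\<in>H1_0 \<Omega> \<Gamma>0. AE t in lebesgue_on {0..T}.
        (\<integral>x. v t x * \<phi> x \<partial>lebesgue_on \<Omega>) +
        (\<integral>x. grad \<Omega> (u t) x \<bullet> grad \<Omega> \<phi> x \<partial>lebesgue_on \<Omega>) +
        (\<integral>x. vb t x * bd_trace \<Omega> \<phi> x \<partial>surf \<Gamma>1) =
        (\<integral>x. \<bar>u t x\<bar> powr (p - 2) * u t x * \<phi> x \<partial>lebesgue_on \<Omega>)) \<and>
     (\<forall>t\<in>{0..T}. u t \<in> L2_space (lebesgue_on \<Omega>) \<and>
        ((\<lambda>\<tau>. norm_Om 2 \<Omega> (\<lambda>x. u \<tau> x - u t x)) \<longlongrightarrow> 0) (at t within {0..T})) \<and>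
     (AE x in lebesgue_on \<Omega>. u 0 x = u0 x)"

definition weak_solution_upto ::
  "'a::euclidean_space set \<Rightarrow> 'a set \<Rightarrow> 'a set \<Rightarrow> real \<Rightarrow> ('a \<Rightarrow> real) \<Rightarrow> ereal \<Rightarrow>
   (real \<Rightarrow> 'a \<Rightarrow> real) \<Rightarrow> (real \<Rightarrow> 'a \<Rightarrow> real) \<Rightarrow> (real \<Rightarrow> 'a \<Rightarrow> real) \<Rightarrow> bool" where
  "weak_solution_upto \<Omega> \<Gamma>0 \<Gamma>1 p u0 Tmax u v vb \<longleftrightarrow>
     (\<forall>T>0. ereal T < Tmax \<longrightarrow> weak_solution \<Omega> \<Gamma>0 \<Gamma>1 p u0 T u v vb)"

definition maximal_weak_solution ::
  "'a::euclidean_space set \<Rightarrow> 'a set \<Rightarrow> 'a set \<Rightarrow> real \<Rightarrow> ('a \<Rightarrow> real) \<Rightarrow> ereal \<Rightarrow>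
   (real \<Rightarrow> 'a \<Rightarrow> real) \<Rightarrow> (real \<Rightarrow> 'a \<Rightarrow> real) \<Rightarrow> (real \<Rightarrow> 'a \<Rightarrow> real) \<Rightarrow> bool" where
  "maximal_weak_solution \<Omega> \<Gamma>0 \<Gamma>1 p u0 Tmax u v vb \<longleftrightarrow>
     0 < Tmax \<and> weak_solution_upto \<Omega> \<Gamma>0 \<Gamma>1 p u0 Tmax u v vb \<and>
     \<not> (\<exists>T' u' v' vb'. Tmax < T' \<and> weak_solution_upto \<Omega> \<Gamma>0 \<Gamma>1 p u0 T' u' v' vb' \<and>
          (\<forall>t\<ge>0. ereal t < Tmax \<longrightarrow> (AE x in lebesgue_on \<Omega>. u' t x = u t x)))"

definition blows_up :: "'a::euclidean_space set \<Rightarrow> ereal \<Rightarrow> (real \<Rightarrow> 'a \<Rightarrow> real) \<Rightarrow> bool" where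
  "blows_up \<Omega> Tmax u \<longleftrightarrow>
     Tmax < \<infinity> \<and> filterlim (\<lambda>t. H1_norm \<Omega> (u t)) at_top (at_left (real_of_ereal Tmax))"

text \<open>The regularity that the local theory provides for the maximal solution.\<close>

definition local_properties ::
  "'a::euclidean_space set \<Rightarrow> 'a set \<Rightarrow> 'a set \<Rightarrow> real \<Rightarrow> ('a \<Rightarrow> real) \<Rightarrow> ereal \<Rightarrow>
   (real \<Rightarrow> 'a \<Rightarrow> real) \<Rightarrow> (real \<Rightarrow> 'a \<Rightarrow> real) \<Rightarrow> (real \<Rightarrow> 'a \<Rightarrow> real) \<Rightarrow> bool" where
  "local_properties \<Omega> \<Gamma>0 \<Gamma>1 p u0 Tmax u v vb \<longleftrightarrow>
     (\<forall>t\<ge>0. ereal t < Tmax \<longrightarrow> u t \<in> H1_0 \<Omega> \<Gamma>0 \<and>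
        ((\<lambda>\<tau>. H1_norm \<Omega> (\<lambda>x. u \<tau> x - u t x)) \<longlongrightarrow> 0) (at t within {\<tau>. 0 \<le> \<tau> \<and> ereal \<tau> < Tmax})) \<and>
     (\<forall>T>0. ereal T < Tmax \<longrightarrow>
        (\<lambda>(t, x). v t x) \<in> L2_space (lebesgue_on {0<..<T} \<Otimes>\<^sub>M lebesgue_on \<Omega>) \<and>
        (\<lambda>(t, x). vb t x) \<in> L2_space (lebesgue_on {0<..<T} \<Otimes>\<^sub>M surf \<Gamma>1)) \<and>
     (\<forall>s t. 0 \<le> s \<and> s \<le> t \<and> ereal t < Tmax \<longrightarrow>
        1 / 2 * (norm_grad \<Omega> (u t))\<^sup>2 - 1 / 2 * (norm_grad \<Omega> (u s))\<^sup>2 +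
        (\<integral>\<tau>. (norm_Om 2 \<Omega> (v \<tau>))\<^sup>2 + (Lq_norm 2 (surf \<Gamma>1) (vb \<tau>))\<^sup>2 \<partial>lebesgue_on {s..t}) =
        (\<integral>\<tau>. (\<integral>x. \<bar>u \<tau> x\<bar> powr (p - 2) * u \<tau> x * v \<tau> x \<partial>lebesgue_on \<Omega>) \<partial>lebesgue_on {s..t})) \<and>
     (Tmax = \<infinity> \<or> blows_up \<Omega> Tmax u) \<and>
     (AE t in lebesgue_on {t. 0 < t \<and> ereal t < Tmax}.
        ((\<lambda>\<tau>. norm_Om p \<Omega> (u \<tau>) powr p) has_real_derivative
          p * (\<integral>x. \<bar>u t x\<bar> powr (p - 2) * u t x * v t x \<partial>lebesgue_on \<Omega>)) (at t)) \<and>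
     (\<forall>t\<ge>0. ereal t < Tmax \<longrightarrow>
        J \<Omega> p (u t) - J \<Omega> p u0 =
        - (\<integral>\<tau>. (norm_Om 2 \<Omega> (v \<tau>))\<^sup>2 + (Lq_norm 2 (surf \<Gamma>1) (vb \<tau>))\<^sup>2 \<partial>lebesgue_on {0..t}))"

text \<open>
  The known well-posedness theorem for the exponent \<open>p\<close>: existence, uniqueness and regularity of the
  maximal weak solution for every initial datum.
\<close>

definition local_theory ::
  "'a::euclidean_space set \<Rightarrow> 'a set \<Rightarrow> 'a set \<Rightarrow> real \<Rightarrow> bool" where
  "local_theory \<Omega> \<Gamma>0 \<Gamma>1 p \<longleftrightarrow>
     (\<forall>u0\<in>H1_0 \<Omega> \<Gamma>0.
        (\<exists>Tmax u v vb. maximal_weak_solution \<Omega> \<Gamma>0 \<Gamma>1 p u0 Tmax u v vb) \<and>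
        (\<forall>Tmax u v vb T' u' v' vb'.
           maximal_weak_solution \<Omega> \<Gamma>0 \<Gamma>1 p u0 Tmax u v vb \<and>
           maximal_weak_solution \<Omega> \<Gamma>0 \<Gamma>1 p u0 T' u' v' vb' \<longrightarrow>
           T' = Tmax \<and>
           (\<forall>t\<ge>0. ereal t < Tmax \<longrightarrow> (AE x in lebesgue_on \<Omega>. u' t x = u t x))) \<and>
        (\<forall>Tmax u v vb. maximal_weak_solution \<Omega> \<Gamma>0 \<Gamma>1 p u0 Tmax u v vb \<longrightarrow>
           local_properties \<Omega> \<Gamma>0 \<Gamma>1 p u0 Tmax u v vb))"

end

theory Submission
  imports Defs
begin

text \<open>
  Let \<open>Q(t) = \<parallel>u\<parallel>\<^sup>2 + \<parallel>u\<parallel>\<^sup>2\<close> (norms in \<open>L\<^sup>2(\<Omega>)\<close> and \<open>L\<^sup>2(\<Gamma>1)\<close>) and \<open>E(t) = J(u\<^sub>0) - J(u(t))\<close>, the time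
  integral of \<open>\<parallel>u\<^sub>t\<parallel>\<^sup>2\<close> in \<open>\<Omega>\<close> and on \<open>\<Gamma>1\<close>. Testing the equation with \<open>u\<close> gives \<open>Q' = - 2 K(u)\<close>, and
  both data sets are such that \<open>- 2 K(u) \<ge> 2 p (\<beta> + E)\<close> persists, where \<open>\<beta>\<close> is the denominator in the
  asserted bound; for \<open>B1\<close> this is the potential well argument, for \<open>B2\<close> a consequence of
  \<open>Q \<le> (S1 + S2) \<parallel>\<nabla>u\<parallel>\<^sup>2\<close>. By Cauchy-Schwarz \<open>(\<surd>Q(t) - \<surd>Q(s))\<^sup>2 \<le> (t - s) (E(t) - E(s))\<close>. Hence
  \<open>F(t) = \<integral>\<^sub>0\<^sup>t Q + (T - t) Q(0) + B (t + \<tau>0)\<^sup>2\<close> satisfies \<open>F F'' \<ge> (p/2) F'\<^sup>2\<close> for \<open>B = p \<beta> / (p - 1)\<close>, so that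
  \<open>F / F'\<close> decreases at rate at least \<open>(p - 2) / 2\<close>; as it stays positive, \<open>T\<close> is bounded, and the
  choice of \<open>\<tau>0\<close> optimises the bound.

  No Sobolev embedding is needed to test with \<open>u\<close>. Where \<open>K(u) < 0\<close> the function \<open>\<bar>u\<bar>\<^sup>p\<close> is integrable, its
  integral is continuous in time by the energy identity, and together with continuity in
  \<open>L\<^sup>2(\<Omega>)\<close> this gives continuity in \<open>L\<^sup>p(\<Omega>)\<close>.
\<close>

section \<open>Square integrable functions\<close>

text \<open>The weak form admits only test functions that do not depend on time, each with its own
  null set of times, whereas \<open>Q' = - 2 K(u)\<close> calls for the moving function
  \<open>u t\<close>. The symmetry of the form \<open>b\<close> bridges the gap:
  \<open>Q t2 - Q t1\<close> is exactly the sum of the increments from \<open>t1\<close> to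
  \<open>t2\<close> of \<open>b _ (u t2)\<close> and \<open>b _ (u t1)\<close>, each with a frozen
  test function. As both times approach \<open>s\<close>, the two integrands approach
  \<open>- K (u s)\<close>. Hence \<open>Q\<close> is differentiable at every time with
  \<open>K < 0\<close>, not merely at almost every one, and the concavity argument may use the
  classical mean value theorem.

  The distributional derivatives \<open>v\<close> and \<open>vb\<close> are tested only against
  smooth functions, so frozen test functions from the energy space have to be reached separately. In
  the interior this is done by identifying \<open>u t - u s\<close> with a time integral of
  \<open>v\<close>, on the boundary by smooth approximation of the trace.

  In the concavity argument \<open>F'' \<ge> 2 p (E + B)\<close> comes from the lower bound on
  \<open>Q'\<close>, and \<open>F'^2 \<le> 4 F (E + B)\<close> from the Cauchy-Schwarz bound; their
  quotient is the factor \<open>p/2\<close>.\<close>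

lemma Lq_norm_powr:
  assumes "q > 0"
  shows "Lq_norm q M f powr q = (\<integral>x. norm (f x) powr q \<partial>M)"
proof -
  have "0 \<le> (\<integral>x. norm (f x) powr q \<partial>M)" by simp
  then show ?thesis using assms by (simp add: Lq_norm_def powr_powr)
qed

lemma Lq_norm_nonneg: "0 \<le> Lq_norm q M f"
  by (simp add: Lq_norm_def)

lemma norm_powr_2: "norm x powr 2 = (norm x)\<^sup>2"
  by (cases "x = 0") (auto simp: powr_numeral)

lemma Lq_norm_2: "(Lq_norm 2 M f)\<^sup>2 = (\<integral>x. (norm (f x))\<^sup>2 \<partial>M)"
proof -
  have "(Lq_norm 2 M f)\<^sup>2 = Lq_norm 2 M f powr 2"
    using norm_powr_2[of "Lq_norm 2 M f"] Lq_norm_nonneg[of 2 M f] by simp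
  also have "\<dots> = (\<integral>x. norm (f x) powr 2 \<partial>M)"
    by (rule Lq_norm_powr) simp
  finally show ?thesis by (simp only: norm_powr_2)
qed

lemma Lq_norm_2_sqrt: "Lq_norm 2 M f = sqrt (\<integral>x. (norm (f x))\<^sup>2 \<partial>M)"
  using Lq_norm_2[of M f] Lq_norm_nonneg[of 2 M f] real_sqrt_unique by metis

lemma Lq_norm_cong_AE:
  assumes "AE x in M. f x = g x" "f \<in> borel_measurable M" "g \<in> borel_measurable M"
  shows "Lq_norm q M f = Lq_norm q M g"
proof -
  have "(\<integral>x. norm (f x) powr q \<partial>M) = (\<integral>x. norm (g x) powr q \<partial>M)"
    by (rule integral_cong_AE) (use assms in auto)
  then show ?thesis by (simp add: Lq_norm_def)
qed

lemma L2_spaceD: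
  assumes "f \<in> L2_space M"
  shows "f \<in> borel_measurable M" "integrable M (\<lambda>x. (norm (f x))\<^sup>2)"
  using assms by (auto simp: L2_space_def)

lemma L2_space_add:
  assumes "f \<in> L2_space M" "g \<in> L2_space M"
  shows "(\<lambda>x. f x + g x) \<in> L2_space M"
proof -
  note [measurable] = assms[THEN L2_spaceD(1)]
  have *: "(norm (a + b))\<^sup>2 \<le> 2 * (norm a)\<^sup>2 + 2 * (norm b)\<^sup>2" for a b :: 'b
  proof -
    have "(norm (a + b))\<^sup>2 \<le> (norm a + norm b)\<^sup>2"
      by (simp add: norm_triangle_ineq power_mono)
    also have "\<dots> \<le> 2 * (norm a)\<^sup>2 + 2 * (norm b)\<^sup>2"
      using sum_squares_bound[of "norm a" "norm b"] by (simp add: power2_sum)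
    finally show ?thesis .
  qed
  have "integrable M (\<lambda>x. (norm (f x + g x))\<^sup>2)"
    by (rule Bochner_Integration.integrable_bound[where f="\<lambda>x. 2 * (norm (f x))\<^sup>2 + 2 * (norm (g x))\<^sup>2"])
       (use assms[THEN L2_spaceD(2)] * in auto)
  then show ?thesis by (simp add: L2_space_def)
qed

lemma L2_space_scaleR:
  assumes "f \<in> L2_space M"
  shows "(\<lambda>x. c *\<^sub>R f x) \<in> L2_space M"
  using assms by (auto simp: L2_space_def power_mult_distrib)

lemma L2_space_diff:
  assumes "f \<in> L2_space M" "g \<in> L2_space M"
  shows "(\<lambda>x. f x - g x) \<in> L2_space M"
  using L2_space_add[OF assms(1) L2_space_scaleR[OF assms(2), of "-1"]] by simp

lemma L2_inner_integrable:
  assumes "f \<in> L2_space M" "g \<in> L2_space M"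
  shows "integrable M (\<lambda>x. f x \<bullet> g x)"
proof -
  note [measurable] = assms[THEN L2_spaceD(1)]
  have *: "\<bar>a \<bullet> b\<bar> \<le> (norm a)\<^sup>2 + (norm b)\<^sup>2" for a b :: 'b
  proof -
    have "\<bar>a \<bullet> b\<bar> \<le> norm a * norm b" by (rule Cauchy_Schwarz_ineq2)
    also have "\<dots> \<le> (norm a)\<^sup>2 + (norm b)\<^sup>2"
      using sum_squares_bound[of "norm a" "norm b"] mult_nonneg_nonneg[OF norm_ge_zero norm_ge_zero, of a b]
      by linarith
    finally show ?thesis .
  qed
  show ?thesis
    by (rule Bochner_Integration.integrable_bound[where f="\<lambda>x. (norm (f x))\<^sup>2 + (norm (g x))\<^sup>2"])
       (use assms[THEN L2_spaceD(2)] * in auto)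
qed

lemma L2_mult_integrable:
  fixes f g :: "'b \<Rightarrow> real"
  assumes "f \<in> L2_space M" "g \<in> L2_space M"
  shows "integrable M (\<lambda>x. f x * g x)"
  using L2_inner_integrable[OF assms] by simp

text \<open>The free scalar \<open>c\<close> lets one identity serve three purposes:
  \<open>c = -1\<close> and \<open>c = 1\<close> give the norms of differences and sums, and as a
  nonnegative polynomial in \<open>c\<close> it yields the Cauchy-Schwarz inequality.\<close>

lemma L2_norm_combination:
  assumes f: "f \<in> L2_space M" and g: "g \<in> L2_space M"
  shows "(Lq_norm 2 M (\<lambda>x. f x + c *\<^sub>R g x))\<^sup>2 =
     (Lq_norm 2 M f)\<^sup>2 + 2 * c * (\<integral>x. f x \<bullet> g x \<partial>M) + c\<^sup>2 * (Lq_norm 2 M g)\<^sup>2"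
proof -
  have "(\<integral>x. (norm (f x + c *\<^sub>R g x))\<^sup>2 \<partial>M) =
      (\<integral>x. (norm (f x))\<^sup>2 + (2 * c * (f x \<bullet> g x) + c\<^sup>2 * (norm (g x))\<^sup>2) \<partial>M)"
    by (rule Bochner_Integration.integral_cong[OF refl], simp only: power2_norm_eq_inner inner_add_left
        inner_add_right inner_scaleR_left inner_scaleR_right)
      (simp add: algebra_simps inner_commute power2_eq_square)
  also have "\<dots> = (\<integral>x. (norm (f x))\<^sup>2 \<partial>M) + (2 * c * (\<integral>x. f x \<bullet> g x \<partial>M) + c\<^sup>2 * (\<integral>x. (norm (g x))\<^sup>2 \<partial>M))"
    using L2_spaceD(2)[OF f] L2_spaceD(2)[OF g] L2_inner_integrable[OF f g] by simp
  finally show ?thesis by (simp add: Lq_norm_2)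
qed

lemma L2_norm_diff:
  assumes f: "f \<in> L2_space M" and g: "g \<in> L2_space M"
  shows "(Lq_norm 2 M (\<lambda>x. f x - g x))\<^sup>2 =
     (Lq_norm 2 M f)\<^sup>2 - 2 * (\<integral>x. f x \<bullet> g x \<partial>M) + (Lq_norm 2 M g)\<^sup>2"
  using L2_norm_combination[OF f g, of "-1"] by simp

text \<open>A quadratic polynomial that is nonnegative for every \<open>c\<close> is evaluated at
  its vertex \<open>- X / B\<close>. If \<open>B = 0\<close> it is affine, and unless
  \<open>X = 0\<close> some \<open>c\<close> gives it the value -1.\<close>

lemma L2_Cauchy_Schwarz:
  assumes f: "f \<in> L2_space M" and g: "g \<in> L2_space M"
  shows "\<bar>\<integral>x. f x \<bullet> g x \<partial>M\<bar> \<le> Lq_norm 2 M f * Lq_norm 2 M g"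
proof -
  define A B X where "A = (Lq_norm 2 M f)\<^sup>2" and "B = (Lq_norm 2 M g)\<^sup>2"
    and "X = (\<integral>x. f x \<bullet> g x \<partial>M)"
  have quad: "0 \<le> A + 2 * c * X + c\<^sup>2 * B" for c
    using L2_norm_combination[OF f g, of c] zero_le_power2[of "Lq_norm 2 M (\<lambda>x. f x + c *\<^sub>R g x)"]
    unfolding A_def B_def X_def by linarith
  have "X\<^sup>2 \<le> A * B"
  proof (cases "B = 0")
    case True
    have "X = 0"
    proof (rule ccontr)
      assume "X \<noteq> 0"
      then have "A + 2 * (- (A + 1) / (2 * X)) * X = -1" by (simp add: field_simps)
      then show False using quad[of "- (A + 1) / (2 * X)"] True by simp
    qed
    then show ?thesis using True by simp
  next
    case False
    then have B: "B > 0" by (simp add: B_def)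
    have "A + 2 * (- X / B) * X + (- X / B)\<^sup>2 * B = A - X\<^sup>2 / B"
      using B by (simp add: field_simps power2_eq_square)
    then have "X\<^sup>2 / B \<le> A" using quad[of "- X / B"] by simp
    then show ?thesis using B by (simp add: field_simps)
  qed
  then have "\<bar>X\<bar>\<^sup>2 \<le> (Lq_norm 2 M f * Lq_norm 2 M g)\<^sup>2"
    by (simp add: A_def B_def power_mult_distrib)
  then show ?thesis
    unfolding X_def[symmetric] by (rule power2_le_imp_le) (simp add: Lq_norm_nonneg)
qed

lemma L2_norm_triangle:
  assumes f: "f \<in> L2_space M" and g: "g \<in> L2_space M"
  shows "Lq_norm 2 M (\<lambda>x. f x + g x) \<le> Lq_norm 2 M f + Lq_norm 2 M g"
proof -
  have "(Lq_norm 2 M (\<lambda>x. f x + g x))\<^sup>2 \<le> (Lq_norm 2 M f + Lq_norm 2 M g)\<^sup>2"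
    using L2_norm_combination[OF f g, of 1] L2_Cauchy_Schwarz[OF f g] by (simp add: power2_sum)
  then show ?thesis by (rule power2_le_imp_le) (simp add: Lq_norm_nonneg)
qed

lemma L2_norm_scaleR: "Lq_norm 2 M (\<lambda>x. c *\<^sub>R f x) = \<bar>c\<bar> * Lq_norm 2 M f"
  by (simp add: Lq_norm_2_sqrt power_mult_distrib real_sqrt_mult)

lemma L2_norm_minus_commute: "Lq_norm 2 M (\<lambda>x. f x - g x) = Lq_norm 2 M (\<lambda>x. g x - f x)"
  by (simp add: Lq_norm_2_sqrt norm_minus_commute)

lemma L2_norm_eq_0_iff:
  assumes f: "f \<in> L2_space M"
  shows "Lq_norm 2 M f = 0 \<longleftrightarrow> (AE x in M. f x = 0)"
proof -
  have "Lq_norm 2 M f = 0 \<longleftrightarrow> (\<integral>x. (norm (f x))\<^sup>2 \<partial>M) = 0" by (simp add: Lq_norm_2_sqrt)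
  also have "\<dots> \<longleftrightarrow> (AE x in M. (norm (f x))\<^sup>2 = 0)"
    by (rule integral_nonneg_eq_0_iff_AE) (use L2_spaceD[OF f] in auto)
  finally show ?thesis by simp
qed

text \<open>The difference of the products splits into \<open>(f - f0) (g - g0)\<close>,
  \<open>(f - f0) g0\<close> and \<open>f0 (g - g0)\<close>, each handled by Cauchy-Schwarz. A
  general filter covers both limits in time within the interval of existence and limits of
  sequences.\<close>

lemma L2_tendsto_inner:
  assumes f: "\<And>i. i \<in> I \<Longrightarrow> f i \<in> L2_space M" and f0: "f0 \<in> L2_space M"
    and g: "\<And>i. i \<in> I \<Longrightarrow> g i \<in> L2_space M" and g0: "g0 \<in> L2_space M"
    and ev: "\<forall>\<^sub>F i in F. i \<in> I"
    and lf: "((\<lambda>i. Lq_norm 2 M (\<lambda>x. f i x - f0 x)) \<longlongrightarrow> 0) F"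
    and lg: "((\<lambda>i. Lq_norm 2 M (\<lambda>x. g i x - g0 x)) \<longlongrightarrow> 0) F"
  shows "((\<lambda>i. \<integral>x. f i x \<bullet> g i x \<partial>M) \<longlongrightarrow> (\<integral>x. f0 x \<bullet> g0 x \<partial>M)) F"
proof -
  let ?a = "\<lambda>i. Lq_norm 2 M (\<lambda>x. f i x - f0 x)" and ?b = "\<lambda>i. Lq_norm 2 M (\<lambda>x. g i x - g0 x)"
  have bound: "\<bar>(\<integral>x. f i x \<bullet> g i x \<partial>M) - (\<integral>x. f0 x \<bullet> g0 x \<partial>M)\<bar>
     \<le> ?a i * ?b i + ?a i * Lq_norm 2 M g0 + Lq_norm 2 M f0 * ?b i" if i: "i \<in> I" for i
  proof -
    note df = L2_space_diff[OF f[OF i] f0] and dg = L2_space_diff[OF g[OF i] g0]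
    have "(\<integral>x. f i x \<bullet> g i x \<partial>M) - (\<integral>x. f0 x \<bullet> g0 x \<partial>M) = (\<integral>x. f i x \<bullet> g i x - f0 x \<bullet> g0 x \<partial>M)"
      using L2_inner_integrable[OF f[OF i] g[OF i]] L2_inner_integrable[OF f0 g0] by simp
    also have "\<dots> = (\<integral>x. (f i x - f0 x) \<bullet> (g i x - g0 x) + (f i x - f0 x) \<bullet> g0 x + f0 x \<bullet> (g i x - g0 x) \<partial>M)"
      by (rule Bochner_Integration.integral_cong) (auto simp: algebra_simps)
    also have "\<dots> = (\<integral>x. (f i x - f0 x) \<bullet> (g i x - g0 x) \<partial>M) + (\<integral>x. (f i x - f0 x) \<bullet> g0 x \<partial>M) + (\<integral>x. f0 x \<bullet> (g i x - g0 x) \<partial>M)"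
      using L2_inner_integrable[OF df dg] L2_inner_integrable[OF df g0] L2_inner_integrable[OF f0 dg]
      by simp
    finally show ?thesis
      using L2_Cauchy_Schwarz[OF df dg] L2_Cauchy_Schwarz[OF df g0] L2_Cauchy_Schwarz[OF f0 dg]
      by linarith
  qed
  have "((\<lambda>i. ?a i * ?b i + ?a i * Lq_norm 2 M g0 + Lq_norm 2 M f0 * ?b i) \<longlongrightarrow>
      0 * 0 + 0 * Lq_norm 2 M g0 + Lq_norm 2 M f0 * 0) F"
    by (intro tendsto_intros lf lg)
  then have lim: "((\<lambda>i. ?a i * ?b i + ?a i * Lq_norm 2 M g0 + Lq_norm 2 M f0 * ?b i) \<longlongrightarrow> 0) F"
    by simp
  have "((\<lambda>i. (\<integral>x. f i x \<bullet> g i x \<partial>M) - (\<integral>x. f0 x \<bullet> g0 x \<partial>M)) \<longlongrightarrow> 0) F"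
    by (rule Lim_null_comparison[OF _ lim]) (use ev bound in \<open>auto elim: eventually_mono\<close>)
  then show ?thesis by (simp add: LIM_zero_iff)
qed

lemma L2_space_finite_measure_integrable:
  assumes "finite_measure M" "f \<in> L2_space M"
  shows "integrable M f"
proof -
  interpret finite_measure M by fact
  note [measurable] = L2_spaceD(1)[OF assms(2)]
  have *: "norm a \<le> 1 + (norm a)\<^sup>2" for a :: 'b
    using sum_squares_bound[of "norm a" 1] norm_ge_zero[of a] by (simp del: norm_ge_zero)
  have i: "integrable M (\<lambda>x. 1 + (norm (f x))\<^sup>2)"
    using L2_spaceD(2)[OF assms(2)] by simp
  show ?thesis
    by (rule Bochner_Integration.integrable_bound[OF i]) (use * in auto)
qed

lemma L2_space_bounded:
  assumes "finite_measure M" "f \<in> borel_measurable M" "AE x in M. norm (f x) \<le> C"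
  shows "f \<in> L2_space M"
proof -
  interpret finite_measure M by fact
  have "integrable M (\<lambda>x. (norm (f x))\<^sup>2)"
    by (rule integrable_const_bound[where B="C\<^sup>2"])
      (use assms in \<open>auto elim!: eventually_mono intro!: power_mono\<close>)
  then show ?thesis using assms by (simp add: L2_space_def)
qed

section \<open>Smooth functions\<close>

lemma partial_deriv_eq: "(f has_derivative f') (at x) \<Longrightarrow> partial_deriv b f x = f' b"
  unfolding partial_deriv_def using frechet_derivative_at by metis

lemma Ck_SucD: "Ck (Suc k) f \<Longrightarrow> f differentiable at x" "Ck (Suc k) f \<Longrightarrow> b \<in> Basis \<Longrightarrow> Ck k (partial_deriv b f)"
  by auto

lemma Ck_SucD_less: "Ck (Suc k) f \<Longrightarrow> Ck k f"
proof (induction k arbitrary: f)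
  case 0
  then show ?case
    using differentiable_imp_continuous_within by (auto simp: continuous_on_eq_continuous_within)
next
  case (Suc k)
  then show ?case by (metis Ck.simps(2))
qed

lemma Ck_has_derivative: "Ck (Suc k) f \<Longrightarrow> (f has_derivative frechet_derivative f (at x)) (at x)"
  using frechet_derivative_works by auto

lemma Ck_continuous_on: "Ck k f \<Longrightarrow> continuous_on UNIV f"
proof (induction k)
  case (Suc k)
  then show ?case using Ck_SucD_less by blast
qed simp

lemma partial_deriv_const [simp]: "partial_deriv b (\<lambda>x. c) = (\<lambda>x. 0)"
  using partial_deriv_eq[OF has_derivative_const] by blast

lemma Ck_const [simp]: "Ck k (\<lambda>x. c)"
  by (induction k arbitrary: c) auto

lemma partial_deriv_add:
  assumes "f differentiable at x" "g differentiable at x"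
  shows "partial_deriv b (\<lambda>x. f x + g x) x = partial_deriv b f x + partial_deriv b g x"
  using partial_deriv_eq[OF has_derivative_add[OF assms[unfolded frechet_derivative_works]], of b]
  by (simp add: partial_deriv_def)

lemma Ck_add: "Ck k f \<Longrightarrow> Ck k g \<Longrightarrow> Ck k (\<lambda>x. f x + g x)"
proof (induction k arbitrary: f g)
  case (Suc k)
  have "partial_deriv b (\<lambda>x. f x + g x) = (\<lambda>x. partial_deriv b f x + partial_deriv b g x)" for b
    using Suc.prems by (intro ext partial_deriv_add) auto
  then show ?case using Suc by (auto intro: differentiable_add)
qed (auto intro: continuous_on_add)

lemma partial_deriv_mult:
  fixes f g :: "'a::euclidean_space \<Rightarrow> real"
  assumes "f differentiable at x" "g differentiable at x"
  shows "partial_deriv b (\<lambda>x. f x * g x) x = f x * partial_deriv b g x + partial_deriv b f x * g x"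
  using partial_deriv_eq[OF has_derivative_mult[OF assms[unfolded frechet_derivative_works]], of b]
  by (simp add: partial_deriv_def)

lemma Ck_mult: "Ck k f \<Longrightarrow> Ck k g \<Longrightarrow> Ck k (\<lambda>x. f x * g x)"
proof (induction k arbitrary: f g)
  case (Suc k)
  have *: "partial_deriv b (\<lambda>x. f x * g x) = (\<lambda>x. f x * partial_deriv b g x + partial_deriv b f x * g x)" for b
    using Suc.prems by (intro ext partial_deriv_mult) auto
  have "Ck k f" "Ck k g" using Suc.prems Ck_SucD_less by auto
  then show ?case using Suc by (auto simp: * intro!: Ck_add differentiable_mult)
qed (auto intro: continuous_on_mult)

lemma Ck_sum: "finite A \<Longrightarrow> (\<And>i. i \<in> A \<Longrightarrow> Ck k (f i)) \<Longrightarrow> Ck k (\<lambda>x. \<Sum>i\<in>A. f i x)"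
  by (induction A rule: finite_induct) (auto intro: Ck_add)

lemma Ck_prod: "finite A \<Longrightarrow> (\<And>i. i \<in> A \<Longrightarrow> Ck k (f i)) \<Longrightarrow> Ck k (\<lambda>x. \<Prod>i\<in>A. f i x)"
  by (induction A rule: finite_induct) (auto intro: Ck_mult)

lemma partial_deriv_compose_linear:
  fixes f :: "'b::euclidean_space \<Rightarrow> real" and L :: "'a::euclidean_space \<Rightarrow> 'b"
  assumes L: "bounded_linear L" and f: "f differentiable at (L x)"
  shows "partial_deriv b (\<lambda>x. f (L x)) x = (\<Sum>c\<in>Basis. (L b \<bullet> c) * partial_deriv c f (L x))"
proof -
  note d = f[unfolded frechet_derivative_works]
  interpret l: bounded_linear "frechet_derivative f (at (L x))"
    using d by (rule has_derivative_bounded_linear)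
  have "((\<lambda>x. f (L x)) has_derivative (\<lambda>y. frechet_derivative f (at (L x)) (L y))) (at x)"
    by (rule has_derivative_compose[OF bounded_linear_imp_has_derivative[OF L] d])
  then have "partial_deriv b (\<lambda>x. f (L x)) x = frechet_derivative f (at (L x)) (\<Sum>c\<in>Basis. (L b \<bullet> c) *\<^sub>R c)"
    by (simp add: partial_deriv_eq euclidean_representation)
  also have "\<dots> = (\<Sum>c\<in>Basis. (L b \<bullet> c) * partial_deriv c f (L x))"
    by (simp only: l.sum l.scaleR partial_deriv_def real_scaleR_def)
  finally show ?thesis .
qed

lemma Ck_compose_linear:
  fixes f :: "'b::euclidean_space \<Rightarrow> real" and L :: "'a::euclidean_space \<Rightarrow> 'b"
  assumes L: "bounded_linear L"
  shows "Ck k f \<Longrightarrow> Ck k (\<lambda>x. f (L x))"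
proof (induction k arbitrary: f)
  case 0
  then show ?case
    using continuous_on_compose2[of UNIV f UNIV L] linear_continuous_on[OF L] by auto
next
  case (Suc k)
  have *: "partial_deriv b (\<lambda>x. f (L x)) = (\<lambda>x. \<Sum>c\<in>Basis. (L b \<bullet> c) * partial_deriv c f (L x))" for b
    using Suc.prems by (intro ext partial_deriv_compose_linear[OF L]) auto
  have "(\<lambda>x. f (L x)) differentiable at x" for x
    using differentiable_chain_at[of L x f] Suc.prems linear_imp_differentiable[of L] L
    by (auto simp: o_def bounded_linear.linear)
  then show ?case
    unfolding Ck.simps * using Suc by (auto intro!: Ck_sum Ck_mult)
qed

lemma partial_deriv_compose_real:
  fixes f :: "real \<Rightarrow> real" and g :: "'a::euclidean_space \<Rightarrow> real"
  assumes "f differentiable at (g x)" and "g differentiable at x"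
  shows "partial_deriv b (\<lambda>x. f (g x)) x = partial_deriv b g x * partial_deriv 1 f (g x)"
proof -
  note f = assms(1)[unfolded frechet_derivative_works] and g = assms(2)[unfolded frechet_derivative_works]
  interpret l: bounded_linear "frechet_derivative f (at (g x))"
    using f by (rule has_derivative_bounded_linear)
  have "((\<lambda>x. f (g x)) has_derivative (\<lambda>y. frechet_derivative f (at (g x)) (frechet_derivative g (at x) y))) (at x)"
    by (rule has_derivative_compose[OF g f])
  then have "partial_deriv b (\<lambda>x. f (g x)) x = frechet_derivative f (at (g x)) (partial_deriv b g x *\<^sub>R 1)"
    by (simp add: partial_deriv_eq) (simp add: partial_deriv_def)
  also have "\<dots> = partial_deriv b g x * partial_deriv 1 f (g x)"
    by (simp only: l.scaleR) (simp add: partial_deriv_def)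
  finally show ?thesis .
qed

lemma Ck_compose_real:
  fixes f :: "real \<Rightarrow> real" and g :: "'a::euclidean_space \<Rightarrow> real"
  shows "Ck k f \<Longrightarrow> Ck k g \<Longrightarrow> Ck k (\<lambda>x. f (g x))"
proof (induction k arbitrary: f)
  case 0
  then show ?case using continuous_on_compose2[of UNIV f UNIV g] by auto
next
  case (Suc k)
  have *: "partial_deriv b (\<lambda>x. f (g x)) = (\<lambda>x. partial_deriv b g x * partial_deriv 1 f (g x))" for b
    using Suc.prems by (intro ext partial_deriv_compose_real) auto
  have "(\<lambda>x. f (g x)) differentiable at x" for x
    using differentiable_chain_at[of g x f] Suc.prems by (auto simp: o_def)
  then show ?case
    unfolding Ck.simps * using Suc Ck_SucD_less[OF Suc.prems(2)] by (auto intro!: Ck_mult)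
qed

lemma partial_deriv_real:
  "(f has_real_derivative D) (at x) \<Longrightarrow> partial_deriv 1 f x = D"
  by (simp add: has_field_derivative_def partial_deriv_eq)

text \<open>The induction on \<open>k\<close> runs over the whole family at once, which avoids
  explicit formulas for higher derivatives.\<close>

lemma Ck_closed_family:
  fixes f :: "real \<Rightarrow> real"
  assumes "\<And>f. f \<in> A \<Longrightarrow> \<exists>f'\<in>A. \<forall>x. (f has_real_derivative f' x) (at x)"
  shows "f \<in> A \<Longrightarrow> Ck k f"
proof (induction k arbitrary: f)
  case 0
  then obtain f' where "\<forall>x. (f has_real_derivative f' x) (at x)" using assms by blast
  then show ?case by (auto intro!: DERIV_continuous_on[where D=f'])
next
  case (Suc k)
  then obtain f' where f': "f' \<in> A" "\<forall>x. (f has_real_derivative f' x) (at x)" using assms by blast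
  then have "partial_deriv 1 f = f'" using partial_deriv_real by blast
  then show ?case using Suc f' by (auto simp: real_differentiable_def)
qed

lemma Ck_inverse:
  fixes g :: "'a::euclidean_space \<Rightarrow> real"
  assumes nz: "\<And>x. g x \<noteq> 0"
  shows "Ck k g \<Longrightarrow> Ck k (\<lambda>x. inverse (g x))"
proof (induction k)
  case 0
  then show ?case using nz by (auto intro: continuous_on_inverse)
next
  case (Suc k)
  have d: "((\<lambda>x. inverse (g x)) has_derivative
      (\<lambda>y. - (inverse (g x) * frechet_derivative g (at x) y * inverse (g x)))) (at x)" for x
    using nz Ck_has_derivative[OF Suc.prems] by (auto intro: has_derivative_inverse)
  have *: "partial_deriv b (\<lambda>x. inverse (g x)) = (\<lambda>x. (-1) * (inverse (g x) * partial_deriv b g x * inverse (g x)))" for b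
    using partial_deriv_eq[OF d] by (auto simp: partial_deriv_def fun_eq_iff)
  have "(\<lambda>x. inverse (g x)) differentiable at x" for x
    using d differentiable_def by blast
  then show ?case
    unfolding Ck.simps *
    by (intro conjI allI ballI Ck_mult Ck_const Suc.IH Ck_SucD_less[OF Suc.prems] Ck_SucD(2)[OF Suc.prems])
qed

lemma smooth_const [simp]: "smooth (\<lambda>x. c)" by (simp add: smooth_def)
lemma smooth_add: "smooth f \<Longrightarrow> smooth g \<Longrightarrow> smooth (\<lambda>x. f x + g x)" by (simp add: smooth_def Ck_add)
lemma smooth_mult: "smooth f \<Longrightarrow> smooth g \<Longrightarrow> smooth (\<lambda>x. f x * g x)" by (simp add: smooth_def Ck_mult)
lemma smooth_diff: "smooth f \<Longrightarrow> smooth g \<Longrightarrow> smooth (\<lambda>x. f x - g x)"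
  using smooth_add[of f "\<lambda>x. (-1) * g x"] smooth_mult[of "\<lambda>x. -1" g] by simp
lemma smooth_compose_linear: "bounded_linear L \<Longrightarrow> smooth f \<Longrightarrow> smooth (\<lambda>x. f (L x))"
  by (simp add: smooth_def Ck_compose_linear)
lemma smooth_compose_real: "smooth f \<Longrightarrow> smooth g \<Longrightarrow> smooth (\<lambda>x. f (g x :: real))"
  by (simp add: smooth_def Ck_compose_real)
lemma smooth_inner: "smooth (\<lambda>x. x \<bullet> b)"
proof -
  have "Ck k (\<lambda>x::'a. x \<bullet> b)" for k
  proof (cases k)
    case 0
    then show ?thesis by (auto intro: continuous_intros)
  next
    case (Suc n)
    have d: "((\<lambda>x. x \<bullet> b) has_derivative (\<lambda>y. y \<bullet> b)) (at x)" for x :: 'a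
      by (auto intro!: derivative_eq_intros)
    then have "partial_deriv c (\<lambda>x. x \<bullet> b) = (\<lambda>x. c \<bullet> b)" for c
      using partial_deriv_eq by blast
    then show ?thesis using Suc d by (auto simp: differentiable_def)
  qed
  then show ?thesis by (simp add: smooth_def)
qed

lemma smooth_affine: "smooth (\<lambda>x. c * (x::real) + d)"
  using smooth_add[OF smooth_mult[OF smooth_const[of c] smooth_inner[of "1::real"]] smooth_const[of d]]
  by simp

lemma smooth_partial_deriv: "smooth f \<Longrightarrow> b \<in> Basis \<Longrightarrow> smooth (partial_deriv b f)"
  unfolding smooth_def by (metis Ck_SucD(2))

lemma smooth_differentiable: "smooth f \<Longrightarrow> f differentiable at x"
  unfolding smooth_def by (metis Ck_SucD(1))

lemma smooth_continuous_on: "smooth f \<Longrightarrow> continuous_on S f"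
  unfolding smooth_def by (metis Ck_continuous_on continuous_on_subset subset_UNIV)

text \<open>The polynomial factor \<open>P\<close> makes the family closed under differentiation.\<close>

definition flat :: "real poly \<Rightarrow> real \<Rightarrow> real" where
  "flat P x = (if x > 0 then poly P (1 / x) * exp (- (1 / x)) else 0)"

lemma poly_times_exp_tendsto_0: "((\<lambda>y. poly P y * exp (- y)) \<longlongrightarrow> (0::real)) at_top"
proof -
  have "((\<lambda>y. \<Sum>i\<le>degree P. coeff P i * (y ^ i / exp y)) \<longlongrightarrow> (\<Sum>i\<le>degree P. coeff P i * 0)) at_top"
    by (intro tendsto_intros tendsto_power_div_exp_0)
  moreover have "(\<Sum>i\<le>degree P. coeff P i * (y ^ i / exp y)) = poly P y * exp (- y)" for y :: real
    by (simp add: poly_altdef sum_distrib_right exp_minus divide_inverse mult.assoc)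
  ultimately show ?thesis by simp
qed

text \<open>With \<open>y = 1 / x\<close> the chain rule gives
  \<open>y^2 * (P y - P' y) * exp (- y)\<close>; this is the origin of the factor
  \<open>[:0, 0, 1:]\<close>.\<close>

lemma flat_has_derivative: "(flat P has_real_derivative flat ([:0, 0, 1:] * (P - pderiv P)) x) (at x)"
proof -
  consider "x > 0" | "x < 0" | "x = 0" by linarith
  then show ?thesis
  proof cases
    case 1
    have "((\<lambda>x. poly P (1 / x) * exp (- (1 / x))) has_real_derivative
        (poly (pderiv P) (1 / x) * (- 1 / x\<^sup>2)) * exp (- (1 / x)) + (exp (- (1 / x)) * (1 / x\<^sup>2)) * poly P (1 / x)) (at x)"
      using 1 by (auto intro!: derivative_eq_intros DERIV_chain2[OF poly_DERIV] simp: power2_eq_square)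
    also have "(poly (pderiv P) (1 / x) * (- 1 / x\<^sup>2)) * exp (- (1 / x)) + (exp (- (1 / x)) * (1 / x\<^sup>2)) * poly P (1 / x)
       = flat ([:0, 0, 1:] * (P - pderiv P)) x"
      using 1 by (simp add: flat_def algebra_simps power2_eq_square)
    finally show ?thesis
      by (rule has_field_derivative_transform_within_open[of _ _ _ "{0<..}"]) (use 1 in \<open>auto simp: flat_def\<close>)
  next
    case 2
    have "((\<lambda>x. 0) has_real_derivative flat ([:0, 0, 1:] * (P - pderiv P)) x) (at x)"
      using 2 by (simp add: flat_def)
    then show ?thesis
      by (rule has_field_derivative_transform_within_open[of _ _ _ "{..<0}"]) (use 2 in \<open>auto simp: flat_def\<close>)
  next
    case 3
    have "((\<lambda>h. flat P h / h) \<longlongrightarrow> 0) (at_right 0)"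
    proof -
      \<comment> \<open>With \<open>y = 1 / h\<close> the quotient \<open>flat P h / h\<close>
        becomes \<open>y * P y * exp (- y)\<close>, hence the polynomial
        \<open>[:0, 1:] * P\<close>.\<close>
      have lim: "((\<lambda>y. poly ([:0, 1:] * P) y * exp (- y)) \<longlongrightarrow> 0) at_top"
        by (rule poly_times_exp_tendsto_0)
      have "((\<lambda>h. poly ([:0, 1:] * P) (inverse h) * exp (- inverse h)) \<longlongrightarrow> 0) (at_right 0)"
        using filterlim_compose[OF lim filterlim_inverse_at_top_right] .
      then show ?thesis
        by (rule Lim_transform_eventually)
          (auto simp: flat_def eventually_at_filter divide_inverse mult_ac)
    qed
    moreover have "((\<lambda>h. flat P h / h) \<longlongrightarrow> 0) (at_left 0)"
      by (rule Lim_transform_eventually[OF tendsto_const])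
        (auto simp: flat_def eventually_at_filter)
    ultimately have "((\<lambda>h. flat P h / h) \<longlongrightarrow> 0) (at 0)"
      by (rule filterlim_split_at_real[rotated])
    moreover have "flat P 0 = 0" "flat Q 0 = 0" for Q by (simp_all add: flat_def)
    ultimately show ?thesis using 3 by (simp add: has_field_derivative_iff)
  qed
qed

lemma smooth_flat: "smooth (flat P)"
proof -
  have "Ck k (flat P)" for k
    by (rule Ck_closed_family[of "range flat"]) (use flat_has_derivative in auto)
  then show ?thesis by (simp add: smooth_def)
qed

text \<open>The standard smooth transition from 0 on \<open>x \<le> 0\<close> to 1 on
  \<open>x \<ge> 1\<close>. The denominator is positive because \<open>x\<close> or
  \<open>1 - x\<close> is.\<close>

definition smooth_step :: "real \<Rightarrow> real" where
  "smooth_step x = flat 1 x * inverse (flat 1 x + flat 1 (1 - x))"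

lemma flat_one: "flat 1 x \<ge> 0" "flat 1 x > 0 \<longleftrightarrow> x > 0" "flat 1 x = 0 \<longleftrightarrow> x \<le> 0"
  by (auto simp: flat_def)

lemma flat_one_sum_pos: "flat 1 x + flat 1 (1 - x) > 0"
  using flat_one[of x] flat_one[of "1 - x"] by (cases "x > 0") (auto intro: add_pos_nonneg add_nonneg_pos)

lemma smooth_smooth_step: "smooth smooth_step"
proof -
  have "smooth (\<lambda>x. flat 1 (1 - x))"
    using smooth_compose_real[OF smooth_flat smooth_affine[of "-1" 1]] by simp
  then have "smooth (\<lambda>x. flat 1 x + flat 1 (1 - x))"
    by (rule smooth_add[OF smooth_flat])
  then have "smooth (\<lambda>x. inverse (flat 1 x + flat 1 (1 - x)))"
    using flat_one_sum_pos by (simp add: smooth_def Ck_inverse less_imp_neq[THEN not_sym])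
  then have "smooth (\<lambda>x. flat 1 x * inverse (flat 1 x + flat 1 (1 - x)))"
    by (rule smooth_mult[OF smooth_flat])
  then show ?thesis by (simp add: smooth_step_def[abs_def])
qed

lemma smooth_step_bounds: "0 \<le> smooth_step x" "smooth_step x \<le> 1"
  using flat_one_sum_pos[of x] flat_one(1)[of x] flat_one(1)[of "1 - x"]
  by (auto simp: smooth_step_def field_simps)

lemma smooth_step_eq_0: "x \<le> 0 \<Longrightarrow> smooth_step x = 0"
  by (simp add: smooth_step_def flat_def)

lemma smooth_step_eq_1: "1 \<le> x \<Longrightarrow> smooth_step x = 1"
  by (simp add: smooth_step_def flat_def)

text \<open>Positive exactly on the open box. Its height is left unnormalised: only positivity
  matters, since large multiples of it are passed through \<open>smooth_step\<close>.\<close>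

definition box_bump :: "'a::euclidean_space \<Rightarrow> 'a \<Rightarrow> 'a \<Rightarrow> real" where
  "box_bump a b x = (\<Prod>i\<in>Basis. flat 1 (x \<bullet> i - a \<bullet> i) * flat 1 (b \<bullet> i - x \<bullet> i))"

lemma smooth_box_bump: "smooth (box_bump a b)"
proof -
  have "smooth (\<lambda>x. flat 1 (x \<bullet> i - a \<bullet> i) * flat 1 (b \<bullet> i - x \<bullet> i))" for i
    by (intro smooth_mult smooth_compose_real[OF smooth_flat] smooth_diff smooth_inner smooth_const)
  then show ?thesis unfolding smooth_def box_bump_def[abs_def] by (auto intro: Ck_prod)
qed

lemma box_bump_nonneg: "0 \<le> box_bump a b x"
  unfolding box_bump_def by (intro prod_nonneg mult_nonneg_nonneg ballI flat_one)

lemma box_bump_pos_iff: "0 < box_bump a b x \<longleftrightarrow> x \<in> box a b"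
proof
  assume "x \<in> box a b"
  then have "0 < flat 1 (x \<bullet> i - a \<bullet> i) * flat 1 (b \<bullet> i - x \<bullet> i)" if "i \<in> Basis" for i
    using that by (intro mult_pos_pos) (simp_all only: flat_one(2) mem_box diff_gt_0_iff_gt)
  then show "0 < box_bump a b x"
    unfolding box_bump_def using prod_pos[of Basis "\<lambda>i. flat 1 (x \<bullet> i - a \<bullet> i) * flat 1 (b \<bullet> i - x \<bullet> i)"]
    by blast
next
  assume pos: "0 < box_bump a b x"
  show "x \<in> box a b"
    unfolding mem_box
  proof
    fix i :: 'a assume i: "i \<in> Basis"
    have "flat 1 (x \<bullet> i - a \<bullet> i) * flat 1 (b \<bullet> i - x \<bullet> i) \<noteq> 0"
    proof
      assume "flat 1 (x \<bullet> i - a \<bullet> i) * flat 1 (b \<bullet> i - x \<bullet> i) = 0"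
      then have "box_bump a b x = 0"
        unfolding box_bump_def by (intro prod_zero[OF finite_Basis] bexI[OF _ i])
      then show False using pos by simp
    qed
    then show "a \<bullet> i < x \<bullet> i \<and> x \<bullet> i < b \<bullet> i" by (auto simp: flat_one(3))
  qed
qed

lemma box_bump_eq_0: "x \<notin> box a b \<Longrightarrow> box_bump a b x = 0"
  using box_bump_pos_iff[of a b x] box_bump_nonneg[of a b x] by linarith

section \<open>Test functions and smooth cutoffs\<close>

lemma test_funI:
  assumes "smooth \<phi>" "compact C" "C \<subseteq> U" "\<And>x. x \<notin> C \<Longrightarrow> \<phi> x = 0"
  shows "\<phi> \<in> test_fun U"
  using assms unfolding test_fun_def by blast

lemma test_fun_smooth: "\<phi> \<in> test_fun U \<Longrightarrow> smooth \<phi>"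
  by (simp add: test_fun_def)

lemma bounded_compact_support:
  fixes f :: "'a::euclidean_space \<Rightarrow> real"
  assumes "continuous_on UNIV f" "compact C" "\<And>x. x \<notin> C \<Longrightarrow> f x = 0"
  shows "\<exists>c\<ge>0. \<forall>x. \<bar>f x\<bar> \<le> c"
proof -
  have "bounded (f ` C)"
    by (intro compact_imp_bounded compact_continuous_image continuous_on_subset[OF assms(1)] assms(2)) simp
  then obtain c where "\<And>x. x \<in> C \<Longrightarrow> \<bar>f x\<bar> \<le> c" by (auto simp: bounded_iff)
  then have "\<bar>f x\<bar> \<le> max c 0" for x using assms(3)[of x] by (cases "x \<in> C") (auto simp: le_max_iff_disj)
  then show ?thesis by (intro exI[of _ "max c 0"]) auto
qed

lemma test_fun_bounded:
  assumes "\<phi> \<in> test_fun U"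
  shows "\<exists>c\<ge>0. \<forall>x. \<bar>\<phi> x\<bar> \<le> c"
  using assms bounded_compact_support[of \<phi>] smooth_continuous_on[of \<phi> UNIV]
  by (auto simp: test_fun_def)

lemma partial_deriv_eq_0_off:
  assumes "compact C" "\<And>x. x \<notin> C \<Longrightarrow> f x = 0" "x \<notin> C"
  shows "partial_deriv b f x = 0"
proof -
  have "((\<lambda>x. 0) has_derivative (\<lambda>y. 0)) (at x)" by simp
  then have "(f has_derivative (\<lambda>y. 0)) (at x)"
    by (rule has_derivative_transform_within_open[of _ _ _ _ "- C"])
      (use assms in \<open>auto simp: open_Compl compact_imp_closed\<close>)
  then show ?thesis by (rule partial_deriv_eq)
qed

lemma test_fun_partial_deriv:
  assumes "\<phi> \<in> test_fun U" "b \<in> Basis"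
  shows "partial_deriv b \<phi> \<in> test_fun U"
proof -
  obtain C where "compact C" "C \<subseteq> U" "\<forall>x. x \<notin> C \<longrightarrow> \<phi> x = 0"
    using assms by (auto simp: test_fun_def)
  then show ?thesis
    using assms partial_deriv_eq_0_off[of C \<phi>]
    by (intro test_funI[of _ C]) (auto intro: smooth_partial_deriv test_fun_smooth)
qed

text \<open>Compactness covers \<open>A\<close> by finitely many boxes that miss \<open>B\<close>.
  The sum of their bumps is positive on \<open>A\<close> and zero on \<open>B\<close>, and
  \<open>smooth_step\<close> flattens a large multiple of it to exactly 1 on \<open>A\<close>. This
  will separate the two parts of the boundary.\<close>

lemma smooth_cutoff:
  fixes A B :: "'a::euclidean_space set"
  assumes A: "compact A" and B: "closed B" and AB: "A \<inter> B = {}"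
  obtains \<theta> where "\<theta> \<in> test_fun (UNIV :: 'a set)" "\<And>x. 0 \<le> \<theta> x" "\<And>x. \<theta> x \<le> 1"
    "\<And>x. x \<in> A \<Longrightarrow> \<theta> x = 1" "\<And>x. x \<in> B \<Longrightarrow> \<theta> x = 0"
proof -
  have "\<exists>a b. x \<in> box a b \<and> box a b \<inter> B = {}" if "x \<in> A" for x
  proof -
    have "open (- B)" "x \<in> - B" using B AB that by auto
    then obtain a b where "x \<in> box a b" "box a b \<subseteq> - B" by (rule open_contains_box)
    then show ?thesis by blast
  qed
  then obtain a b where ab: "\<And>x. x \<in> A \<Longrightarrow> x \<in> box (a x) (b x) \<and> box (a x) (b x) \<inter> B = {}"
    by metis
  have "A \<subseteq> (\<Union>x\<in>A. box (a x) (b x))" using ab by blast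
  then obtain F where F: "F \<subseteq> A" "finite F" "A \<subseteq> (\<Union>x\<in>F. box (a x) (b x))"
    using compactE_image[OF A, of A "\<lambda>x. box (a x) (b x)"] open_box by metis
  define h where "h x = (\<Sum>y\<in>F. box_bump (a y) (b y) x)" for x
  have h: "smooth h"
    using smooth_box_bump F(2) unfolding smooth_def h_def[abs_def] by (intro allI Ck_sum) auto
  have hpos: "h x > 0" if xA: "x \<in> A" for x
  proof -
    obtain y where y: "y \<in> F" "x \<in> box (a y) (b y)" using F(3) xA by blast
    then show ?thesis
      unfolding h_def by (intro sum_pos2[OF F(2) y(1)]) (auto simp: box_bump_pos_iff box_bump_nonneg)
  qed
  have h0: "h x = 0" if "x \<notin> (\<Union>y\<in>F. box (a y) (b y))" for x
    unfolding h_def using that by (intro sum.neutral) (auto simp: box_bump_eq_0)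
  \<comment> \<open>The factor is the reciprocal of the minimum of \<open>h\<close> on the compact
    set \<open>A\<close>.\<close>
  obtain m where m: "m > 0" "\<And>x. x \<in> A \<Longrightarrow> m * h x \<ge> 1"
  proof (cases "A = {}")
    case False
    obtain z where z: "z \<in> A" "\<And>x. x \<in> A \<Longrightarrow> h z \<le> h x"
      using continuous_attains_inf[OF A False smooth_continuous_on[OF h]] by blast
    show ?thesis
      by (rule that[of "1 / h z"]) (use z hpos in \<open>auto simp: field_simps\<close>)
  qed (use that[of 1] in auto)
  have s: "smooth (\<lambda>x. smooth_step (m * h x))"
    by (intro smooth_compose_real[OF smooth_smooth_step] smooth_mult smooth_const h)
  have C: "compact (\<Union>y\<in>F. cbox (a y) (b y))" using F(2) by auto
  have "(\<lambda>x. smooth_step (m * h x)) \<in> test_fun UNIV"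
    by (rule test_funI[OF s C]) (use h0 box_subset_cbox in \<open>fastforce simp: smooth_step_eq_0\<close>)+
  moreover have "h x = 0" if "x \<in> B" for x using h0 ab F(1) that by blast
  ultimately show ?thesis
    using that[of "\<lambda>x. smooth_step (m * h x)"] m smooth_step_bounds
    by (auto simp: smooth_step_eq_0 smooth_step_eq_1)
qed

lemma box_indicator_limit:
  assumes "box_bump a b = h"
  shows "(\<lambda>m. smooth_step (real m * h x)) \<longlonglongrightarrow> indicator (box a b) x"
proof (cases "x \<in> box a b")
  case True
  then have h: "h x > 0" using assms box_bump_pos_iff by auto
  have "\<forall>\<^sub>F m in sequentially. real m * h x \<ge> 1"
  proof -
    obtain N :: nat where N: "1 / h x \<le> real N" using real_arch_simple by blast
    have "1 \<le> real m * h x" if "m \<ge> N" for m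
    proof -
      have "1 / h x \<le> real m" using N that by linarith
      then show ?thesis using h by (simp add: field_simps)
    qed
    then show ?thesis by (auto simp: eventually_sequentially)
  qed
  then have "\<forall>\<^sub>F m in sequentially. 1 = smooth_step (real m * h x)"
    by (auto elim: eventually_mono simp: smooth_step_eq_1)
  then show ?thesis using True by (auto intro: Lim_transform_eventually[OF tendsto_const])
next
  case False
  then show ?thesis using assms box_bump_eq_0[OF False] by (auto simp: smooth_step_eq_0)
qed

text \<open>The positive and the negative part define two measures that agree on boxes.\<close>

lemma AE_zero_if_box_integrals_zero:
  fixes f :: "'a::euclidean_space \<Rightarrow> real"
  assumes f: "integrable lborel f" and z: "\<And>a b. (\<integral>x. indicator (box a b) x * f x \<partial>lborel) = 0"
  shows "AE x in lborel. f x = 0"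
proof -
  note [measurable] = borel_measurable_integrable[OF f]
  define M N where "M = density lborel (\<lambda>x. ennreal (f x))" and "N = density lborel (\<lambda>x. ennreal (- f x))"
  have eq: "emeasure M (box a b) = emeasure N (box a b)" for a b
  proof -
    have i: "integrable lborel (\<lambda>x. indicator (box a b) x * f x)"
      by (rule Bochner_Integration.integrable_bound[OF f]) (auto simp: indicator_def)
    have ip: "integrable lborel (\<lambda>x. max 0 (indicator (box a b) x * f x))" "integrable lborel (\<lambda>x. max 0 (- (indicator (box a b) x * f x)))"
      using i by auto
    have "(\<integral>x. max 0 (indicator (box a b) x * f x) \<partial>lborel) - (\<integral>x. max 0 (- (indicator (box a b) x * f x)) \<partial>lborel)
      = (\<integral>x. indicator (box a b) x * f x \<partial>lborel)"
      unfolding Bochner_Integration.integral_diff[OF ip, symmetric]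
      by (rule Bochner_Integration.integral_cong) (auto simp: max_def)
    then have *: "(\<integral>x. max 0 (indicator (box a b) x * f x) \<partial>lborel) = (\<integral>x. max 0 (- (indicator (box a b) x * f x)) \<partial>lborel)"
      using z by simp
    have "emeasure M (box a b) = (\<integral>\<^sup>+x. ennreal (max 0 (indicator (box a b) x * f x)) \<partial>lborel)"
      unfolding M_def by (subst emeasure_density)
        (auto intro!: nn_integral_cong simp: indicator_def ennreal_neg max_def)
    also have "\<dots> = (\<integral>\<^sup>+x. ennreal (max 0 (- (indicator (box a b) x * f x))) \<partial>lborel)"
      by (simp add: nn_integral_eq_integral[OF ip(1)] nn_integral_eq_integral[OF ip(2)] *)
    also have "\<dots> = emeasure N (box a b)"
      unfolding N_def by (subst emeasure_density)
        (auto intro!: nn_integral_cong simp: indicator_def ennreal_neg max_def)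
    finally show ?thesis .
  qed
  have fin: "(\<integral>\<^sup>+x. ennreal (f x) \<partial>lborel) < \<infinity>"
  proof -
    have "(\<integral>\<^sup>+x. ennreal (f x) \<partial>lborel) \<le> (\<integral>\<^sup>+x. ennreal (norm (f x)) \<partial>lborel)"
      by (intro nn_integral_mono ennreal_leI) auto
    also have "\<dots> < \<infinity>" using f by (simp add: integrable_iff_bounded)
    finally show ?thesis .
  qed
  have "M = N"
  proof (rule measure_eqI_generator_eq)
    let ?E = "range (\<lambda>(a, b::'a). box a b)" let ?A = "\<lambda>n::nat. box (- (real n *\<^sub>R One)) (real n *\<^sub>R One) :: 'a set"
    show "Int_stable ?E" by (auto simp: Int_stable_def box_Int_box)
    show "?E \<subseteq> Pow UNIV" "sets M = sigma_sets UNIV ?E" "sets N = sigma_sets UNIV ?E"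
      by (auto simp: M_def N_def borel_eq_box)
    show "range ?A \<subseteq> ?E" by auto
    show "(\<Union>i. ?A i) = UNIV" by (rule UN_box_eq_UNIV)
    show "emeasure M (?A i) \<noteq> \<infinity>" for i
    proof -
      have "emeasure M (?A i) \<le> emeasure M UNIV" by (rule emeasure_mono) (auto simp: M_def)
      also have "\<dots> = (\<integral>\<^sup>+x. ennreal (f x) \<partial>lborel)" by (simp add: M_def emeasure_density)
      finally show ?thesis using fin by (auto simp: top_unique)
    qed
    show "emeasure M X = emeasure N X" if "X \<in> ?E" for X using that eq by auto
  qed
  \<comment> \<open>Since \<open>ennreal\<close> truncates negative numbers to 0, one of the two
    sides is always 0, and equality forces \<open>f x = 0\<close>.\<close>
  then have "AE x in lborel. ennreal (f x) = ennreal (- f x)"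
    unfolding M_def N_def by (intro sigma_finite_measure.density_unique[OF sigma_finite_lborel]) auto
  then show ?thesis
  proof eventually_elim
    case (elim x)
    then show ?case
      by (metis ennreal_eq_0_iff ennreal_neg linorder_not_le neg_le_0_iff_le less_le_not_le nle_le)
  qed
qed

section \<open>Weak gradients\<close>

lemma smooth_partial_has_derivative:
  fixes F :: "'a::euclidean_space \<Rightarrow> real"
  assumes "Ck (Suc 0) F"
  shows "((\<lambda>s. F (x + s *\<^sub>R b)) has_real_derivative partial_deriv b F (x + s *\<^sub>R b)) (at s)"
proof -
  have 1: "((\<lambda>s. x + s *\<^sub>R b) has_derivative (\<lambda>h. h *\<^sub>R b)) (at s)"
    by (auto intro!: derivative_eq_intros)
  have 2: "(F has_derivative frechet_derivative F (at (x + s *\<^sub>R b))) (at (x + s *\<^sub>R b))"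
    using Ck_has_derivative[OF assms] .
  interpret l: bounded_linear "frechet_derivative F (at (x + s *\<^sub>R b))"
    using 2 by (rule has_derivative_bounded_linear)
  have "((\<lambda>s. F (x + s *\<^sub>R b)) has_derivative (\<lambda>h. frechet_derivative F (at (x + s *\<^sub>R b)) (h *\<^sub>R b))) (at s)"
    by (rule has_derivative_compose[OF 1 2])
  then show ?thesis
    by (simp add: has_field_derivative_def l.scaleR partial_deriv_def mult_commute_abs)
qed

text \<open>Translation invariance of Lebesgue measure makes all difference quotients integrate to zero.\<close>

lemma integral_partial_deriv_eq_0:
  fixes F :: "'a::euclidean_space \<Rightarrow> real"
  assumes F: "Ck (Suc 0) F" and C: "compact C" "\<And>x. x \<notin> C \<Longrightarrow> F x = 0" and b: "b \<in> Basis"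
  shows "(\<integral>x. partial_deriv b F x \<partial>lborel) = 0"
proof -
  have cF: "continuous_on UNIV F" using F by (rule Ck_continuous_on)
  have cD: "continuous_on UNIV (partial_deriv b F)" using F b by auto
  have D0: "partial_deriv b F x = 0" if "x \<notin> C" for x
    using partial_deriv_eq_0_off[of C F] C that by blast
  obtain B where B: "B \<ge> 0" "\<And>x. \<bar>partial_deriv b F x\<bar> \<le> B"
    using bounded_compact_support[OF cD C(1) D0] by blast
  obtain R where R: "\<And>x. x \<in> C \<Longrightarrow> norm x \<le> R"
    using compact_imp_bounded[OF C(1)] by (auto simp: bounded_iff)
  have [measurable]: "F \<in> borel_measurable borel" "partial_deriv b F \<in> borel_measurable borel"
    using cF cD by (auto intro: borel_measurable_continuous_onI)
  \<comment> \<open>Steps of length at most 1 keep all difference quotients supported in the ball of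
    radius \<open>R + 1\<close>; there the mean value theorem bounds them by
    \<open>B\<close>.\<close>
  define h :: "nat \<Rightarrow> real" where "h n = 1 / (real n + 1)" for n
  have h: "0 < h n" "h n \<le> 1" for n by (auto simp: h_def field_simps)
  define d where "d n x = (F (x + h n *\<^sub>R b) - F x) / h n" for n x
  have intF: "integrable lborel F"
  proof -
    have "integrable lborel (\<lambda>x. indicator C x *\<^sub>R F x)"
      using borel_integrable_compact[OF C(1) continuous_on_subset[OF cF]] by simp
    moreover have "(\<lambda>x. indicator C x *\<^sub>R F x) = F" using C(2) by (auto simp: fun_eq_iff indicator_def)
    ultimately show ?thesis by simp
  qed
  have "(\<lambda>n. \<integral>x. d n x \<partial>lborel) \<longlonglongrightarrow> (\<integral>x. partial_deriv b F x \<partial>lborel)"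
  proof (rule integral_dominated_convergence[where w="\<lambda>x. B * indicator (cball 0 (R + 1)) x"])
    show "integrable lborel (\<lambda>x::'a. B * indicator (cball 0 (R + 1)) x)"
      using emeasure_lborel_cball_finite[of "0::'a" "R + 1"]
      by (intro integrable_mult_right integrable_real_indicator) auto
    show "d n \<in> borel_measurable lborel" for n unfolding d_def[abs_def] by measurable
    show "AE x in lborel. (\<lambda>n. d n x) \<longlonglongrightarrow> partial_deriv b F x"
    proof (intro AE_I2)
      fix x
      have "((\<lambda>s. (F (x + s *\<^sub>R b) - F x) / s) \<longlongrightarrow> partial_deriv b F x) (at 0)"
        using smooth_partial_has_derivative[OF F, of x b 0] by (simp add: has_field_derivative_iff)
      moreover have "filterlim h (at 0) sequentially"
        unfolding filterlim_at using h(1) LIMSEQ_inverse_real_of_nat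
        by (auto simp: h_def[abs_def] less_imp_neq[THEN not_sym] inverse_eq_divide add.commute)
      ultimately show "(\<lambda>n. d n x) \<longlonglongrightarrow> partial_deriv b F x"
        unfolding d_def using filterlim_compose by fast
    qed
    show "AE x in lborel. norm (d n x) \<le> B * indicator (cball 0 (R + 1)) x" for n
    proof (intro AE_I2)
      fix x
      show "norm (d n x) \<le> B * indicator (cball 0 (R + 1)) x"
      proof (cases "x \<in> cball 0 (R + 1)")
        case True
        obtain z where "0 < z" "z < h n" "F (x + h n *\<^sub>R b) - F (x + 0 *\<^sub>R b) = (h n - 0) * partial_deriv b F (x + z *\<^sub>R b)"
          using MVT2[OF h(1)[of n], of "\<lambda>s. F (x + s *\<^sub>R b)" "\<lambda>s. partial_deriv b F (x + s *\<^sub>R b)"]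
            smooth_partial_has_derivative[OF F] by blast
        then have "d n x = partial_deriv b F (x + z *\<^sub>R b)" using h(1)[of n] by (simp add: d_def)
        then show ?thesis using True B by simp
      next
        case False
        have "x \<notin> C" using R[of x] False by auto
        moreover have "x + h n *\<^sub>R b \<notin> C"
        proof
          assume "x + h n *\<^sub>R b \<in> C"
          then have "norm (x + h n *\<^sub>R b) \<le> R" by (rule R)
          moreover have "norm (h n *\<^sub>R b) \<le> 1" using b h(1)[of n] h(2)[of n] by simp
          moreover have "norm x \<le> norm (x + h n *\<^sub>R b) + norm (h n *\<^sub>R b)"
            using norm_triangle_ineq4[of "x + h n *\<^sub>R b" "h n *\<^sub>R b"] by simp
          ultimately show False using False by simp
        qed
        ultimately show ?thesis using C(2) False by (simp add: d_def)
      qed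
    qed
  qed measurable
  moreover have "(\<integral>x. d n x \<partial>lborel) = 0" for n
  proof -
    have "integrable lborel (\<lambda>x. F (h n *\<^sub>R b + x))"
      by (rule integrable_distr[of "(+) (h n *\<^sub>R b)" lborel borel F]) (use intF in \<open>simp_all add: lborel_distr_plus\<close>)
    moreover have "(\<integral>x. F (h n *\<^sub>R b + x) \<partial>lborel) = (\<integral>x. F x \<partial>lborel)"
      using integral_distr[of "(+) (h n *\<^sub>R b)" lborel borel F] by (simp add: lborel_distr_plus)
    ultimately show ?thesis using intF by (simp add: d_def add.commute)
  qed
  ultimately show ?thesis using LIMSEQ_unique[of "\<lambda>n. 0::real" 0] by simp
qed

section \<open>Integration, weak gradients and the H1 norm on a bounded open set\<close>

locale bounded_open_set =
  fixes \<Omega> :: "'a::euclidean_space set"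
  assumes open_Om: "open \<Omega>" and bounded_Om: "bounded \<Omega>"
begin

abbreviation "LO \<equiv> lebesgue_on \<Omega>"

lemma Om_lmeasurable: "\<Omega> \<in> lmeasurable"
  using open_Om bounded_Om by (simp add: lmeasurable_open)

lemma Om_sets [measurable, simp]: "\<Omega> \<in> sets lebesgue"
  using Om_lmeasurable by (simp add: fmeasurableD)

lemma finite_LO: "finite_measure LO"
  using Om_lmeasurable by (rule finite_measure_lebesgue_on)

lemma measurable_LO_continuous:
  assumes "continuous_on UNIV f"
  shows "f \<in> borel_measurable LO"
proof -
  have "f \<in> borel_measurable lebesgue"
    using borel_measurable_continuous_onI[OF assms] by (simp add: measurable_completion)
  then show ?thesis by (rule measurable_restrict_space1)
qed

lemma integral_LO:
  fixes f :: "'a \<Rightarrow> real"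
  shows "(\<integral>x. f x \<partial>LO) = (\<integral>x. indicator \<Omega> x *\<^sub>R f x \<partial>lebesgue)"
  using integral_restrict_space[of \<Omega> lebesgue f] by simp

lemma integral_LO_test:
  assumes c: "continuous_on UNIV f" and z: "\<And>x. x \<notin> \<Omega> \<Longrightarrow> f x = (0::real)"
  shows "(\<integral>x. f x \<partial>LO) = (\<integral>x. f x \<partial>lborel)"
proof -
  have "(\<integral>x. f x \<partial>LO) = (\<integral>x. f x \<partial>lebesgue)"
    unfolding integral_LO by (rule Bochner_Integration.integral_cong) (use z in \<open>auto simp: indicator_def\<close>)
  also have "\<dots> = (\<integral>x. f x \<partial>lborel)"
    using borel_measurable_continuous_onI[OF c] by (subst integral_completion) auto
  finally show ?thesis .
qed

lemma L2_smooth: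
  assumes "continuous_on UNIV f"
  shows "f \<in> L2_space LO"
proof -
  have "compact (closure \<Omega>)" using bounded_Om by simp
  then have "bounded (f ` closure \<Omega>)"
    using assms compact_continuous_image compact_imp_bounded continuous_on_subset subset_UNIV by metis
  then obtain c where c: "\<And>x. x \<in> closure \<Omega> \<Longrightarrow> norm (f x) \<le> c" by (auto simp: bounded_iff)
  show ?thesis
  proof (rule L2_space_bounded[OF finite_LO measurable_LO_continuous[OF assms]])
    show "AE x in LO. norm (f x) \<le> c"
      using c closure_subset by (intro AE_I2) (auto simp: space_restrict_space)
  qed
qed

lemma integrable_mult_bounded_LO:
  fixes f g :: "'a \<Rightarrow> real"
  assumes f: "integrable LO f" and g: "continuous_on UNIV g" "\<And>x. \<bar>g x\<bar> \<le> c"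
  shows "integrable LO (\<lambda>x. f x * g x)"
proof (rule Bochner_Integration.integrable_bound[where f="\<lambda>x. c * f x"])
  show "integrable LO (\<lambda>x. c * f x)" using f by simp
  show "(\<lambda>x. f x * g x) \<in> borel_measurable LO"
    using f measurable_LO_continuous[OF g(1)] by measurable
  show "AE x in LO. norm (f x * g x) \<le> norm (c * f x)"
  proof (intro AE_I2)
    fix x
    have "\<bar>g x\<bar> \<le> \<bar>c\<bar>" using g(2)[of x] by linarith
    then have "\<bar>f x\<bar> * \<bar>g x\<bar> \<le> \<bar>f x\<bar> * \<bar>c\<bar>" by (intro mult_left_mono) auto
    then show "norm (f x * g x) \<le> norm (c * f x)" by (simp add: abs_mult mult.commute)
  qed
qed

lemma integrable_mult_test_fun:
  assumes "integrable LO f" "\<phi> \<in> test_fun U"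
  shows "integrable LO (\<lambda>x. f x * \<phi> x)"
  using test_fun_bounded[OF assms(2)] integrable_mult_bounded_LO[OF assms(1)] 
    smooth_continuous_on[OF test_fun_smooth[OF assms(2)]] by blast

lemma L2_LO_integrable: "f \<in> L2_space LO \<Longrightarrow> integrable LO f"
  by (rule L2_space_finite_measure_integrable[OF finite_LO])

text \<open>Smooth steps of multiples of a bump function approximate the indicator of a box.\<close>

lemma AE_zero_if_test_integrals_zero:
  assumes f: "integrable LO f" and z: "\<And>\<phi>. \<phi> \<in> test_fun \<Omega> \<Longrightarrow> (\<integral>x. f x * \<phi> x \<partial>LO) = (0::real)"
  shows "AE x in LO. f x = 0"
proof -
  have gi: "integrable lebesgue (\<lambda>x. indicator \<Omega> x *\<^sub>R f x)"
    using f by (subst (asm) integrable_restrict_space) auto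
  then have "(\<lambda>x. indicator \<Omega> x *\<^sub>R f x) \<in> borel_measurable lebesgue" by simp
  \<comment> \<open>A Borel representative of the extension by zero, so that the uniqueness result
    for box integrals over \<open>lborel\<close> applies.\<close>
  then obtain g where g: "g \<in> borel_measurable lborel" "AE x in lborel. indicator \<Omega> x *\<^sub>R f x = g x"
    using completion_ex_borel_measurable_real by blast
  have gl: "g \<in> borel_measurable lebesgue" using g(1) by (simp add: measurable_completion)
  have gae: "AE x in lebesgue. indicator \<Omega> x *\<^sub>R f x = g x"
    using g(2) by (rule AE_completion)
  have "integrable lebesgue g"
    using gi gl gae by (subst integrable_cong_AE[of g lebesgue "\<lambda>x. indicator \<Omega> x *\<^sub>R f x"]) auto
  then have ig: "integrable lborel g" using g(1) by (subst (asm) integrable_completion) auto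
  have boxint: "(\<integral>x. indicator (box a b) x * g x \<partial>lborel) = 0" if ab: "cbox a b \<subseteq> \<Omega>" for a b
  proof -
    define \<phi> where "\<phi> m x = smooth_step (real m * box_bump a b x)" for m x
    have sm: "smooth (\<phi> m)" for m
      unfolding \<phi>_def by (intro smooth_compose_real[OF smooth_smooth_step] smooth_mult smooth_const smooth_box_bump)
    have out: "\<phi> m x = 0" if "x \<notin> cbox a b" for m x
    proof -
      have "x \<notin> box a b" using that box_subset_cbox by blast
      then show ?thesis by (simp add: \<phi>_def smooth_step_eq_0 box_bump_eq_0)
    qed
    have test: "\<phi> m \<in> test_fun \<Omega>" for m
      by (rule test_funI[OF sm compact_cbox ab out])
    have mb [measurable]: "\<phi> m \<in> borel_measurable borel" for m
      by (rule borel_measurable_continuous_onI[OF smooth_continuous_on[OF sm]])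
    have int0: "(\<integral>x. \<phi> m x * g x \<partial>lborel) = 0" for m
    proof -
      have "(\<integral>x. \<phi> m x * g x \<partial>lborel) = (\<integral>x. \<phi> m x * g x \<partial>lebesgue)"
        using g(1) by (subst integral_completion) auto
      also have "\<dots> = (\<integral>x. indicator \<Omega> x *\<^sub>R (f x * \<phi> m x) \<partial>lebesgue)"
      proof (rule integral_cong_AE)
        have "\<phi> m \<in> borel_measurable lebesgue" using mb by (simp add: measurable_completion)
        then show "(\<lambda>x. \<phi> m x * g x) \<in> borel_measurable lebesgue" using gl by measurable
        have "(\<lambda>x. (indicator \<Omega> x *\<^sub>R f x) * \<phi> m x) \<in> borel_measurable lebesgue"
          using gi \<open>\<phi> m \<in> borel_measurable lebesgue\<close> by measurable
        then show "(\<lambda>x. indicator \<Omega> x *\<^sub>R (f x * \<phi> m x)) \<in> borel_measurable lebesgue"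
          by (simp add: mult.assoc)
        show "AE x in lebesgue. \<phi> m x * g x = indicator \<Omega> x *\<^sub>R (f x * \<phi> m x)"
          using gae by eventually_elim (metis mult.commute mult_scaleR_left)
      qed
      also have "\<dots> = 0" using z[OF test] by (simp add: integral_LO)
      finally show ?thesis .
    qed
    have "(\<lambda>m. \<integral>x. \<phi> m x * g x \<partial>lborel) \<longlonglongrightarrow> (\<integral>x. indicator (box a b) x * g x \<partial>lborel)"
    proof (rule integral_dominated_convergence[where w="\<lambda>x. norm (g x)"])
      show "AE x in lborel. (\<lambda>m. \<phi> m x * g x) \<longlonglongrightarrow> indicator (box a b) x * g x"
        unfolding \<phi>_def by (intro AE_I2 tendsto_intros box_indicator_limit refl)
      show "AE x in lborel. norm (\<phi> m x * g x) \<le> norm (g x)" for m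
        using smooth_step_bounds by (intro AE_I2) (auto simp: \<phi>_def abs_mult intro!: mult_left_le_one_le)
    qed (use ig g(1) in auto)
    then show ?thesis using int0 LIMSEQ_unique[of "\<lambda>n. 0::real" 0] by simp
  qed
  have loc: "AE x in lborel. x \<in> box a b \<longrightarrow> g x = 0" if ab: "cbox a b \<subseteq> \<Omega>" for a b
  proof -
    have "AE x in lborel. indicator (box a b) x * g x = 0"
    proof (rule AE_zero_if_box_integrals_zero)
      show "integrable lborel (\<lambda>x. indicator (box a b) x * g x)"
        by (rule Bochner_Integration.integrable_bound[OF ig]) (use g(1) in \<open>auto simp: indicator_def\<close>)
      fix c d :: 'a
      obtain e e' where e: "box c d \<inter> box a b = box e e'" using box_Int_box[of c d a b] by blast
      have *: "(\<integral>x. indicator (box c d) x * (indicator (box a b) x * g x) \<partial>lborel)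
         = (\<integral>x. indicator (box e e') x * g x \<partial>lborel)"
        by (simp only: e[symmetric] indicator_inter_arith mult.assoc)
      \<comment> \<open>The intersection of the two boxes is again a box. Its closed version lies in
        \<open>\<Omega>\<close> if it is nonempty, as the closure of a subset of
        \<open>cbox a b\<close>. An empty open box is treated apart, since its \<open>cbox\<close>
        may be a degenerate set outside \<open>\<Omega>\<close>.\<close>
      show "(\<integral>x. indicator (box c d) x * (indicator (box a b) x * g x) \<partial>lborel) = 0"
      proof (cases "box e e' = {}")
        case True
        then show ?thesis unfolding * by simp
      next
        case False
        have "box e e' \<subseteq> cbox a b" using e box_subset_cbox[of a b] by blast
        then have "closure (box e e') \<subseteq> cbox a b" by (rule closure_minimal[OF _ closed_cbox])
        then have "cbox e e' \<subseteq> \<Omega>" using closure_box[OF False] ab by simp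
        then show ?thesis unfolding * by (rule boxint)
      qed
    qed
    then show ?thesis by eventually_elim (auto simp: indicator_def split: if_splits)
  qed
  \<comment> \<open>Countably many closed boxes exhaust \<open>\<Omega>\<close>; each differs from
    its interior by a null set, so the local statements add up.\<close>
  obtain D where D: "countable D" "\<And>X. X \<in> D \<Longrightarrow> X \<subseteq> \<Omega>" "\<And>X. X \<in> D \<Longrightarrow> \<exists>a b. X = cbox a b" "\<Union>D = \<Omega>"
    by (rule open_countable_Union_open_cbox[OF open_Om]) blast
  have "AE x in lebesgue. \<forall>X\<in>D. x \<in> X \<longrightarrow> g x = 0"
  proof (subst AE_ball_countable[OF D(1)], intro ballI)
    fix X assume X: "X \<in> D"
    then obtain a b where ab: "X = cbox a b" using D(3) by blast
    have "negligible (cbox a b - box a b)" by (rule negligible_frontier_interval)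
    then have "AE x in lebesgue. x \<notin> cbox a b - box a b"
      by (intro AE_not_in) (simp only: negligible_iff_null_sets)
    moreover have "AE x in lebesgue. x \<in> box a b \<longrightarrow> g x = 0"
      by (rule AE_completion[OF loc]) (use D(2)[OF X] ab in auto)
    ultimately show "AE x in lebesgue. x \<in> X \<longrightarrow> g x = 0"
      by eventually_elim (use ab in auto)
  qed
  with gae have "AE x in lebesgue. x \<in> \<Omega> \<longrightarrow> f x = 0"
  proof eventually_elim
    case (elim x)
    show ?case
    proof
      assume x: "x \<in> \<Omega>"
      then obtain X where "X \<in> D" "x \<in> X" using D(4) by blast
      then show "f x = 0" using elim x by simp
    qed
  qed
  then show ?thesis by (subst AE_restrict_space_iff) auto
qed

lemma weak_grad_unique:
  assumes "G \<in> L2_space LO" "G' \<in> L2_space LO" "weak_grad \<Omega> w G" "weak_grad \<Omega> w G'"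
  shows "AE x in LO. G x = G' x"
proof -
  have "AE x in LO. (G x - G' x) \<bullet> b = 0" if b: "b \<in> Basis" for b
  proof (rule AE_zero_if_test_integrals_zero)
    have i: "integrable LO (\<lambda>x. G x \<bullet> b)" "integrable LO (\<lambda>x. G' x \<bullet> b)"
      using L2_LO_integrable assms(1,2) by auto
    then show "integrable LO (\<lambda>x. (G x - G' x) \<bullet> b)" by (simp add: inner_diff_left)
    fix \<phi> assume \<phi>: "\<phi> \<in> test_fun \<Omega>"
    have "(\<integral>x. (G x \<bullet> b) * \<phi> x \<partial>LO) = (\<integral>x. (G' x \<bullet> b) * \<phi> x \<partial>LO)"
      using assms(3,4) b \<phi> unfolding weak_grad_def by force
    then show "(\<integral>x. (G x - G' x) \<bullet> b * \<phi> x \<partial>LO) = 0"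
      using integrable_mult_test_fun[OF i(1) \<phi>] integrable_mult_test_fun[OF i(2) \<phi>]
      by (simp add: inner_diff_left left_diff_distrib)
  qed
  then have "AE x in LO. \<forall>b\<in>Basis. (G x - G' x) \<bullet> b = 0"
    by (subst AE_ball_countable) (auto intro: countable_finite)
  then show ?thesis
    by eventually_elim (metis euclidean_all_zero_iff right_minus_eq)
qed

lemma grad_weak:
  assumes "w \<in> H1 \<Omega>"
  shows "grad \<Omega> w \<in> L2_space LO" "weak_grad \<Omega> w (grad \<Omega> w)"
  using someI_ex[of "\<lambda>G. G \<in> L2_space LO \<and> weak_grad \<Omega> w G"] assms
  by (auto simp: H1_def grad_def)

lemma H1_L2: "w \<in> H1 \<Omega> \<Longrightarrow> w \<in> L2_space LO"
  by (simp add: H1_def)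

lemma weak_grad_combination:
  assumes "w \<in> L2_space LO" "w' \<in> L2_space LO" "G \<in> L2_space LO" "G' \<in> L2_space LO"
    "weak_grad \<Omega> w G" "weak_grad \<Omega> w' G'"
  shows "weak_grad \<Omega> (\<lambda>x. c * w x + d * w' x) (\<lambda>x. c *\<^sub>R G x + d *\<^sub>R G' x)"
  unfolding weak_grad_def
proof (intro ballI)
  fix \<phi> b assume \<phi>: "\<phi> \<in> test_fun \<Omega>" and b: "b \<in> (Basis :: 'a set)"
  note p = test_fun_partial_deriv[OF \<phi> b]
  have i: "integrable LO w" "integrable LO w'" "integrable LO (\<lambda>x. G x \<bullet> b)" "integrable LO (\<lambda>x. G' x \<bullet> b)"
    using L2_LO_integrable assms(1-4) by auto
  have "(\<integral>x. (c * w x + d * w' x) * partial_deriv b \<phi> x \<partial>LO)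
    = (\<integral>x. c * (w x * partial_deriv b \<phi> x) + d * (w' x * partial_deriv b \<phi> x) \<partial>LO)"
    by (simp add: algebra_simps)
  also have "\<dots> = c * (\<integral>x. w x * partial_deriv b \<phi> x \<partial>LO) + d * (\<integral>x. w' x * partial_deriv b \<phi> x \<partial>LO)"
    using integrable_mult_test_fun[OF i(1) p] integrable_mult_test_fun[OF i(2) p] by simp
  also have "\<dots> = - (c * (\<integral>x. (G x \<bullet> b) * \<phi> x \<partial>LO) + d * (\<integral>x. (G' x \<bullet> b) * \<phi> x \<partial>LO))"
    using assms(5,6) \<phi> b by (simp add: weak_grad_def)
  also have "c * (\<integral>x. (G x \<bullet> b) * \<phi> x \<partial>LO) + d * (\<integral>x. (G' x \<bullet> b) * \<phi> x \<partial>LO)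
     = (\<integral>x. c * ((G x \<bullet> b) * \<phi> x) + d * ((G' x \<bullet> b) * \<phi> x) \<partial>LO)"
    using integrable_mult_test_fun[OF i(3) \<phi>] integrable_mult_test_fun[OF i(4) \<phi>] by simp
  also have "\<dots> = (\<integral>x. ((c *\<^sub>R G x + d *\<^sub>R G' x) \<bullet> b) * \<phi> x \<partial>LO)"
    by (simp add: algebra_simps)
  finally show "(\<integral>x. (c * w x + d * w' x) * partial_deriv b \<phi> x \<partial>LO)
     = - (\<integral>x. ((c *\<^sub>R G x + d *\<^sub>R G' x) \<bullet> b) * \<phi> x \<partial>LO)" .
qed

text \<open>\<open>grad\<close> is a choice, so it is linear only almost everywhere. That is enough
  for every norm of a gradient.\<close>

lemma H1_combination:
  assumes w: "w \<in> H1 \<Omega>" "w' \<in> H1 \<Omega>"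
  shows "(\<lambda>x. c * w x + d * w' x) \<in> H1 \<Omega>"
    and "AE x in LO. grad \<Omega> (\<lambda>x. c * w x + d * w' x) x = c *\<^sub>R grad \<Omega> w x + d *\<^sub>R grad \<Omega> w' x"
proof -
  let ?G = "\<lambda>x. c *\<^sub>R grad \<Omega> w x + d *\<^sub>R grad \<Omega> w' x"
  have wg: "weak_grad \<Omega> (\<lambda>x. c * w x + d * w' x) ?G"
    by (intro weak_grad_combination H1_L2 grad_weak w)
  have G: "?G \<in> L2_space LO" by (intro L2_space_add L2_space_scaleR grad_weak w)
  have "(\<lambda>x. c * w x + d * w' x) \<in> L2_space LO"
    using L2_space_add[OF L2_space_scaleR[OF H1_L2[OF w(1)]] L2_space_scaleR[OF H1_L2[OF w(2)]]] by simp
  then show H: "(\<lambda>x. c * w x + d * w' x) \<in> H1 \<Omega>" using wg G by (auto simp: H1_def)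
  show "AE x in LO. grad \<Omega> (\<lambda>x. c * w x + d * w' x) x = ?G x"
    by (rule weak_grad_unique[OF grad_weak(1)[OF H] G grad_weak(2)[OF H] wg])
qed

lemma norm_grad_combination:
  assumes w: "w \<in> H1 \<Omega>" "w' \<in> H1 \<Omega>"
  shows "norm_grad \<Omega> (\<lambda>x. c * w x + d * w' x) = Lq_norm 2 LO (\<lambda>x. c *\<^sub>R grad \<Omega> w x + d *\<^sub>R grad \<Omega> w' x)"
  by (rule Lq_norm_cong_AE[OF H1_combination(2)[OF w]])
    (intro L2_spaceD(1) L2_space_add L2_space_scaleR grad_weak H1_combination(1) w)+

lemma H1_diff: "w \<in> H1 \<Omega> \<Longrightarrow> w' \<in> H1 \<Omega> \<Longrightarrow> (\<lambda>x. w x - w' x) \<in> H1 \<Omega>"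
  using H1_combination(1)[of w w' 1 "-1"] by simp

lemma norm_grad_diff:
  "w \<in> H1 \<Omega> \<Longrightarrow> w' \<in> H1 \<Omega> \<Longrightarrow> norm_grad \<Omega> (\<lambda>x. w x - w' x) = Lq_norm 2 LO (\<lambda>x. grad \<Omega> w x - grad \<Omega> w' x)"
  using norm_grad_combination[of w w' 1 "-1"] by simp

lemma norm_grad_scale:
  assumes "w \<in> H1 \<Omega>"
  shows "norm_grad \<Omega> (\<lambda>x. c * w x) = \<bar>c\<bar> * norm_grad \<Omega> w"
  using norm_grad_combination[OF assms assms, of c 0] by (simp add: L2_norm_scaleR)

lemma norm_grad_le_H1_norm: "norm_grad \<Omega> w \<le> H1_norm \<Omega> w"
  unfolding H1_norm_def by (rule real_le_rsqrt) simp

lemma norm_Om_le_H1_norm: "norm_Om 2 \<Omega> w \<le> H1_norm \<Omega> w"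
  unfolding H1_norm_def by (rule real_le_rsqrt) simp

lemma H1_norm_le: "H1_norm \<Omega> w \<le> norm_Om 2 \<Omega> w + norm_grad \<Omega> w"
  unfolding H1_norm_def by (rule sqrt_sum_squares_le_sum) (simp_all add: Lq_norm_nonneg)

lemma H1_norm_nonneg: "0 \<le> H1_norm \<Omega> w"
  by (simp add: H1_norm_def)

text \<open>The factor 2 stems from bounding the H1 norm by the sum of its two parts and each part
  by the H1 norm again. The estimate only serves to show that norms tend to 0.\<close>

lemma H1_norm_combination_le:
  assumes w: "w \<in> H1 \<Omega>" "w' \<in> H1 \<Omega>"
  shows "H1_norm \<Omega> (\<lambda>x. c * w x + d * w' x) \<le> 2 * \<bar>c\<bar> * H1_norm \<Omega> w + 2 * \<bar>d\<bar> * H1_norm \<Omega> w'"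
proof -
  have "norm_Om 2 \<Omega> (\<lambda>x. c * w x + d * w' x) \<le> \<bar>c\<bar> * norm_Om 2 \<Omega> w + \<bar>d\<bar> * norm_Om 2 \<Omega> w'"
    using L2_norm_triangle[OF L2_space_scaleR[OF H1_L2[OF w(1)]] L2_space_scaleR[OF H1_L2[OF w(2)]]]
      L2_norm_scaleR[of LO _ w] L2_norm_scaleR[of LO _ w'] by simp
  moreover have "norm_grad \<Omega> (\<lambda>x. c * w x + d * w' x) \<le> \<bar>c\<bar> * norm_grad \<Omega> w + \<bar>d\<bar> * norm_grad \<Omega> w'"
    unfolding norm_grad_combination[OF w]
    using L2_norm_triangle[OF L2_space_scaleR[OF grad_weak(1)[OF w(1)]] L2_space_scaleR[OF grad_weak(1)[OF w(2)]]]
    by (simp add: L2_norm_scaleR)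
  moreover have "\<bar>c\<bar> * norm_Om 2 \<Omega> w \<le> \<bar>c\<bar> * H1_norm \<Omega> w" "\<bar>d\<bar> * norm_Om 2 \<Omega> w' \<le> \<bar>d\<bar> * H1_norm \<Omega> w'"
    "\<bar>c\<bar> * norm_grad \<Omega> w \<le> \<bar>c\<bar> * H1_norm \<Omega> w" "\<bar>d\<bar> * norm_grad \<Omega> w' \<le> \<bar>d\<bar> * H1_norm \<Omega> w'"
    by (intro mult_left_mono norm_Om_le_H1_norm norm_grad_le_H1_norm abs_ge_zero)+
  ultimately show ?thesis using H1_norm_le[of "\<lambda>x. c * w x + d * w' x"] by linarith
qed

text \<open>By the product rule, integration by parts against \<open>\<psi>\<close> says that a
  partial derivative of \<open>\<phi> * \<psi>\<close> integrates to 0, which holds because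
  \<open>\<psi>\<close> has compact support in \<open>\<Omega>\<close>.\<close>

lemma smooth_H1:
  assumes \<phi>: "smooth \<phi>"
  shows "\<phi> \<in> H1 \<Omega>"
proof -
  define G where "G x = (\<Sum>b\<in>Basis. partial_deriv b \<phi> x *\<^sub>R b)" for x :: 'a
  have Gb: "G x \<bullet> b = partial_deriv b \<phi> x" if "b \<in> Basis" for x b
    using that by (simp add: G_def inner_sum_left inner_Basis if_distrib cong: if_cong)
  have "continuous_on UNIV G"
    unfolding G_def[abs_def]
    by (intro continuous_on_sum continuous_on_scaleR continuous_on_const smooth_continuous_on smooth_partial_deriv \<phi>)
  then have G: "G \<in> L2_space LO" by (rule L2_smooth)
  have "weak_grad \<Omega> \<phi> G"
    unfolding weak_grad_def
  proof (intro ballI)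
    fix \<psi> b assume \<psi>: "\<psi> \<in> test_fun \<Omega>" and b: "b \<in> (Basis :: 'a set)"
    obtain C where C: "compact C" "C \<subseteq> \<Omega>" "\<And>x. x \<notin> C \<Longrightarrow> \<psi> x = 0" and s: "smooth \<psi>"
      using \<psi> by (auto simp: test_fun_def)
    have dp: "partial_deriv b \<psi> x = 0" if "x \<notin> C" for x
      using partial_deriv_eq_0_off[of C \<psi>] C that by blast
    note c = smooth_continuous_on[OF \<phi>, of UNIV] smooth_continuous_on[OF s, of UNIV]
      smooth_continuous_on[OF smooth_partial_deriv[OF \<phi> b], of UNIV]
      smooth_continuous_on[OF smooth_partial_deriv[OF s b], of UNIV]
    have pd: "partial_deriv b (\<lambda>x. \<phi> x * \<psi> x) x = \<phi> x * partial_deriv b \<psi> x + partial_deriv b \<phi> x * \<psi> x" for x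
      by (intro partial_deriv_mult smooth_differentiable \<phi> s)
    have i: "integrable lborel f" if "continuous_on UNIV f" "\<And>x. x \<notin> C \<Longrightarrow> f x = (0::real)" for f
    proof -
      have "integrable lborel (\<lambda>x. indicator C x *\<^sub>R f x)"
        using borel_integrable_compact[OF C(1) continuous_on_subset[OF that(1)]] by simp
      moreover have "(\<lambda>x. indicator C x *\<^sub>R f x) = f" using that(2) by (auto simp: fun_eq_iff indicator_def)
      ultimately show ?thesis by simp
    qed
    have "(\<integral>x. \<phi> x * partial_deriv b \<psi> x \<partial>LO) + (\<integral>x. partial_deriv b \<phi> x * \<psi> x \<partial>LO)
      = (\<integral>x. \<phi> x * partial_deriv b \<psi> x \<partial>lborel) + (\<integral>x. partial_deriv b \<phi> x * \<psi> x \<partial>lborel)"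
      using C dp c by (subst (1 2) integral_LO_test) (auto intro!: continuous_on_mult)
    also have "\<dots> = (\<integral>x. partial_deriv b (\<lambda>x. \<phi> x * \<psi> x) x \<partial>lborel)"
      unfolding pd using C dp c
      by (subst Bochner_Integration.integral_add) (auto intro!: i continuous_on_mult)
    also have "\<dots> = 0"
      by (rule integral_partial_deriv_eq_0[OF _ C(1) _ b])
        (use smooth_mult[OF \<phi> s] C(3) in \<open>auto simp: smooth_def simp del: Ck.simps\<close>)
    finally show "(\<integral>x. \<phi> x * partial_deriv b \<psi> x \<partial>LO) = - (\<integral>x. (G x \<bullet> b) * \<psi> x \<partial>LO)"
      using b by (simp add: Gb)
  qed
  then show ?thesis using G L2_smooth[OF smooth_continuous_on[OF \<phi>]] by (auto simp: H1_def)
qed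

text \<open>The gradients agree as functions, not only almost everywhere: \<open>weak_grad\<close>
  sees \<open>w\<close> through integrals only, so both choices are made from the same set.\<close>

lemma H1_cong_AE:
  assumes w: "w \<in> H1 \<Omega>" and w': "w' \<in> H1 \<Omega>" and ae: "AE x in LO. w x = w' x"
  shows "grad \<Omega> w = grad \<Omega> w'"
proof -
  have "(\<integral>x. w x * partial_deriv b \<phi> x \<partial>LO) = (\<integral>x. w' x * partial_deriv b \<phi> x \<partial>LO)"
    if "\<phi> \<in> test_fun \<Omega>" "b \<in> Basis" for \<phi> b
  proof (rule integral_cong_AE)
    note p = test_fun_partial_deriv[OF that]
    show "(\<lambda>x. w x * partial_deriv b \<phi> x) \<in> borel_measurable LO" "(\<lambda>x. w' x * partial_deriv b \<phi> x) \<in> borel_measurable LO"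
      using integrable_mult_test_fun[OF L2_LO_integrable[OF H1_L2[OF w]] p]
        integrable_mult_test_fun[OF L2_LO_integrable[OF H1_L2[OF w']] p] by auto
    show "AE x in LO. w x * partial_deriv b \<phi> x = w' x * partial_deriv b \<phi> x"
      using ae by eventually_elim simp
  qed
  then have "weak_grad \<Omega> w = weak_grad \<Omega> w'" by (auto simp: weak_grad_def fun_eq_iff)
  then show ?thesis by (simp add: grad_def)
qed

end

section \<open>Traces\<close>

lemma sets_hausdorff [simp]: "sets (hausdorff_measure s) = sets borel"
  by (simp add: hausdorff_measure_def sigma_algebra.sets_measure_of_eq[OF sets.sigma_algebra_axioms, of borel, simplified])

lemma space_hausdorff [simp]: "space (hausdorff_measure s) = UNIV"
  using sets_eq_imp_space_eq[OF sets_hausdorff] by simp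

lemma L2_space_restrict:
  assumes f: "f \<in> L2_space M" and A: "A \<in> sets M"
  shows "f \<in> L2_space (restrict_space M A)"
    and "Lq_norm 2 (restrict_space M A) f \<le> Lq_norm 2 M f"
proof -
  have A': "A \<inter> space M \<in> sets M" using A by simp
  have i: "integrable M (\<lambda>x. indicator A x *\<^sub>R (norm (f x))\<^sup>2)"
    by (rule integrable_mult_indicator[OF A L2_spaceD(2)[OF f]])
  then have "integrable (restrict_space M A) (\<lambda>x. (norm (f x))\<^sup>2)"
    by (simp only: integrable_restrict_space[OF A'])
  then show "f \<in> L2_space (restrict_space M A)"
    using measurable_restrict_space1[OF L2_spaceD(1)[OF f]] by (simp add: L2_space_def)
  have "(\<integral>x. (norm (f x))\<^sup>2 \<partial>restrict_space M A) = (\<integral>x. indicator A x *\<^sub>R (norm (f x))\<^sup>2 \<partial>M)"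
    by (rule integral_restrict_space[OF A'])
  also have "\<dots> \<le> (\<integral>x. (norm (f x))\<^sup>2 \<partial>M)"
    by (rule integral_mono[OF i L2_spaceD(2)[OF f]]) (auto simp: indicator_def)
  finally show "Lq_norm 2 (restrict_space M A) f \<le> Lq_norm 2 M f"
    by (simp add: Lq_norm_2_sqrt)
qed

section \<open>The two boundary parts, traces and the Poincare inequality\<close>

locale trace_setting = bounded_open_set \<Omega> for \<Omega> :: "'a::euclidean_space set" +
  fixes \<Gamma>0 \<Gamma>1 :: "'a set"
  assumes partition: "boundary_partition \<Omega> \<Gamma>0 \<Gamma>1"
    and poincare: "poincare_trace_ineq \<Omega> \<Gamma>0 \<Gamma>1"
begin

abbreviation "MF \<equiv> surf (frontier \<Omega>)"
abbreviation "MG \<equiv> surf \<Gamma>1"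
abbreviation "tr \<equiv> bd_trace \<Omega>"
abbreviation "X0 \<equiv> H1_0 \<Omega> \<Gamma>0"

lemma boundary_parts:
  "\<Gamma>0 \<union> \<Gamma>1 = frontier \<Omega>" "\<Gamma>0 \<inter> \<Gamma>1 = {}" "\<Gamma>0 \<in> sets borel" "\<Gamma>1 \<in> sets borel"
  "closure \<Gamma>0 \<inter> closure \<Gamma>1 = {}" "\<Gamma>1 \<subseteq> frontier \<Omega>"
  using partition by (auto simp: boundary_partition_def)

text \<open>The closure of each part stays in the closed frontier and cannot meet the other part, so
  it adds nothing. Closedness is what permits a smooth cutoff between the parts.\<close>

lemma compact_Gam1: "compact \<Gamma>1" and closed_Gam0: "closed \<Gamma>0"
proof -
  have "closed (\<Gamma>0 \<union> \<Gamma>1)" using boundary_parts(1) frontier_closed by metis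
  then have sub: "closure \<Gamma>0 \<subseteq> \<Gamma>0 \<union> \<Gamma>1" "closure \<Gamma>1 \<subseteq> \<Gamma>0 \<union> \<Gamma>1"
    by (simp_all add: closure_minimal)
  have "closure \<Gamma>1 \<subseteq> \<Gamma>1" "closure \<Gamma>0 \<subseteq> \<Gamma>0"
    using sub boundary_parts(5) closure_subset[of \<Gamma>0] closure_subset[of \<Gamma>1] by blast+
  then have c: "closed \<Gamma>1" "closed \<Gamma>0" by (simp_all add: closure_subset_eq)
  then show "closed \<Gamma>0" by simp
  have "bounded \<Gamma>1"
    using boundary_parts(6) compact_imp_bounded[OF compact_frontier_bounded[OF bounded_Om]] bounded_subset by blast
  then show "compact \<Gamma>1" using c by (simp add: compact_eq_bounded_closed)
qed

lemma Gam1_measurable: "\<Gamma>1 \<in> sets MF"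
  using boundary_parts(4,6) by (auto simp: surf_def sets_restrict_space)

lemma MG_restrict: "MG = restrict_space MF \<Gamma>1"
proof -
  have "frontier \<Omega> \<inter> \<Gamma>1 = \<Gamma>1" using boundary_parts(6) by blast
  then show ?thesis
    unfolding surf_def using boundary_parts(4) by (subst restrict_restrict_space) auto
qed

lemma L2_MG: "g \<in> L2_space MF \<Longrightarrow> g \<in> L2_space MG"
  unfolding MG_restrict by (rule L2_space_restrict(1)[OF _ Gam1_measurable])

lemma norm_MG_le: "g \<in> L2_space MF \<Longrightarrow> Lq_norm 2 MG g \<le> Lq_norm 2 MF g"
  unfolding MG_restrict by (rule L2_space_restrict(2)[OF _ Gam1_measurable])

lemma integral_MG:
  fixes f :: "'a \<Rightarrow> real"
  shows "(\<integral>x. f x \<partial>MG) = (\<integral>x. indicator \<Gamma>1 x * f x \<partial>MF)"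
  unfolding MG_restrict
  using integral_restrict_space[of \<Gamma>1 MF f] Gam1_measurable by simp

lemma measurable_MF_continuous: "continuous_on UNIV f \<Longrightarrow> f \<in> borel_measurable MF"
  unfolding surf_def
  by (rule measurable_restrict_space1) (use borel_measurable_continuous_onI in \<open>auto cong: measurable_cong_sets\<close>)

lemma is_traceD:
  assumes "is_trace \<Omega> w g"
  shows "w \<in> H1 \<Omega>" "g \<in> L2_space MF"
  using assms by (auto simp: is_trace_def)

lemma H1_0_H1: "w \<in> X0 \<Longrightarrow> w \<in> H1 \<Omega>"
  by (simp add: H1_0_def)

lemma bd_trace_is_trace:
  assumes "w \<in> X0"
  shows "is_trace \<Omega> w (tr w)"
proof -
  have "\<exists>g. is_trace \<Omega> w g" using assms by (auto simp: H1_0_def)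
  then show ?thesis unfolding bd_trace_def by (rule someI_ex)
qed

lemma tr_L2: "w \<in> X0 \<Longrightarrow> tr w \<in> L2_space MG"
  using bd_trace_is_trace is_traceD(2) L2_MG by blast

lemma smooth_L2_MF:
  assumes fin: "finite_measure MF" and \<phi>: "smooth \<phi>"
  shows "\<phi> \<in> L2_space MF"
proof -
  have "compact (frontier \<Omega>)" using bounded_Om by (rule compact_frontier_bounded)
  then have "bounded (\<phi> ` frontier \<Omega>)"
    using smooth_continuous_on[OF \<phi>] compact_continuous_image compact_imp_bounded by metis
  then obtain c where c: "\<And>x. x \<in> frontier \<Omega> \<Longrightarrow> norm (\<phi> x) \<le> c" by (auto simp: bounded_iff)
  show ?thesis
    by (rule L2_space_bounded[OF fin measurable_MF_continuous[OF smooth_continuous_on[OF \<phi>]]])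
      (use c in \<open>auto simp: surf_def space_restrict_space intro!: AE_I2\<close>)
qed

lemma is_trace_scale:
  assumes "is_trace \<Omega> w g"
  shows "is_trace \<Omega> (\<lambda>x. c * w x) (\<lambda>x. c * g x)"
proof -
  obtain \<phi> where \<phi>: "\<And>k. smooth (\<phi> k)" "(\<lambda>k. H1_norm \<Omega> (\<lambda>x. \<phi> k x - w x)) \<longlonglongrightarrow> 0"
    "(\<lambda>k. Lq_norm 2 MF (\<lambda>x. \<phi> k x - g x)) \<longlonglongrightarrow> 0"
    using assms by (auto simp: is_trace_def)
  note w = is_traceD(1)[OF assms] and g = is_traceD(2)[OF assms]
  have d: "(\<lambda>x. \<phi> k x - w x) \<in> H1 \<Omega>" for k by (intro H1_diff smooth_H1 \<phi> w)
  have "(\<lambda>x. c * w x) \<in> H1 \<Omega>" using H1_combination(1)[OF w w, of c 0] by simp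
  moreover have "(\<lambda>x. c * g x) \<in> L2_space MF" using L2_space_scaleR[OF g, of c] by simp
  moreover have "smooth (\<lambda>x. c * \<phi> k x)" for k by (intro smooth_mult smooth_const \<phi>)
  moreover have "(\<lambda>k. H1_norm \<Omega> (\<lambda>x. c * \<phi> k x - c * w x)) \<longlonglongrightarrow> 0"
  proof (rule Lim_null_comparison)
    show "\<forall>\<^sub>F k in sequentially. norm (H1_norm \<Omega> (\<lambda>x. c * \<phi> k x - c * w x)) \<le> 2 * \<bar>c\<bar> * H1_norm \<Omega> (\<lambda>x. \<phi> k x - w x)"
      using H1_norm_combination_le[OF d d, of c _ 0] by (simp add: H1_norm_nonneg right_diff_distrib)
    show "(\<lambda>k. 2 * \<bar>c\<bar> * H1_norm \<Omega> (\<lambda>x. \<phi> k x - w x)) \<longlonglongrightarrow> 0"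
      using tendsto_mult_right_zero[OF \<phi>(2), of "2 * \<bar>c\<bar>"] by simp
  qed
  moreover have "(\<lambda>k. Lq_norm 2 MF (\<lambda>x. c * \<phi> k x - c * g x)) \<longlonglongrightarrow> 0"
  proof -
    have "Lq_norm 2 MF (\<lambda>x. c * \<phi> k x - c * g x) = \<bar>c\<bar> * Lq_norm 2 MF (\<lambda>x. \<phi> k x - g x)" for k
      using L2_norm_scaleR[of MF c "\<lambda>x. \<phi> k x - g x"] by (simp add: right_diff_distrib)
    then show ?thesis using tendsto_mult_right_zero[OF \<phi>(3)] by simp
  qed
  ultimately show ?thesis unfolding is_trace_def by (intro conjI exI[of _ "\<lambda>k x. c * \<phi> k x"]) auto
qed

lemma H1_0_scale:
  assumes w: "w \<in> X0"
  shows "(\<lambda>x. c * w x) \<in> X0"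
proof -
  obtain g where g: "is_trace \<Omega> w g" "AE x in surf \<Gamma>0. g x = 0" using w by (auto simp: H1_0_def)
  have "AE x in surf \<Gamma>0. c * g x = 0" using g(2) by eventually_elim simp
  then show ?thesis
    using is_trace_scale[OF g(1), of c] is_traceD(1) by (fastforce simp: H1_0_def)
qed

text \<open>The triangle inequality on the boundary requires the smooth approximants to be square
  integrable there; \<open>fin\<close> secures this.\<close>

lemma is_trace_diff:
  assumes fin: "finite_measure MF" and w: "is_trace \<Omega> w g" and w': "is_trace \<Omega> w' g'"
  shows "is_trace \<Omega> (\<lambda>x. w x - w' x) (\<lambda>x. g x - g' x)"
proof -
  obtain \<phi> where \<phi>: "\<And>k. smooth (\<phi> k)" "(\<lambda>k. H1_norm \<Omega> (\<lambda>x. \<phi> k x - w x)) \<longlonglongrightarrow> 0"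
    "(\<lambda>k. Lq_norm 2 MF (\<lambda>x. \<phi> k x - g x)) \<longlonglongrightarrow> 0"
    using w by (auto simp: is_trace_def)
  obtain \<psi> where \<psi>: "\<And>k. smooth (\<psi> k)" "(\<lambda>k. H1_norm \<Omega> (\<lambda>x. \<psi> k x - w' x)) \<longlonglongrightarrow> 0"
    "(\<lambda>k. Lq_norm 2 MF (\<lambda>x. \<psi> k x - g' x)) \<longlonglongrightarrow> 0"
    using w' by (auto simp: is_trace_def)
  note d = is_traceD[OF w] is_traceD[OF w']
  have "(\<lambda>x. w x - w' x) \<in> H1 \<Omega>" "(\<lambda>x. g x - g' x) \<in> L2_space MF"
    by (intro H1_diff L2_space_diff d)+
  moreover have "smooth (\<lambda>x. \<phi> k x - \<psi> k x)" for k by (intro smooth_diff \<phi> \<psi>)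
  moreover have "(\<lambda>k. H1_norm \<Omega> (\<lambda>x. (\<phi> k x - \<psi> k x) - (w x - w' x))) \<longlonglongrightarrow> 0"
  proof (rule Lim_null_comparison)
    show "\<forall>\<^sub>F k in sequentially. norm (H1_norm \<Omega> (\<lambda>x. (\<phi> k x - \<psi> k x) - (w x - w' x)))
        \<le> 2 * H1_norm \<Omega> (\<lambda>x. \<phi> k x - w x) + 2 * H1_norm \<Omega> (\<lambda>x. \<psi> k x - w' x)"
    proof (intro always_eventually allI)
      fix k
      have "H1_norm \<Omega> (\<lambda>x. 1 * (\<phi> k x - w x) + (-1) * (\<psi> k x - w' x))
        \<le> 2 * \<bar>1\<bar> * H1_norm \<Omega> (\<lambda>x. \<phi> k x - w x) + 2 * \<bar>-1\<bar> * H1_norm \<Omega> (\<lambda>x. \<psi> k x - w' x)"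
        by (intro H1_norm_combination_le H1_diff smooth_H1 \<phi> \<psi> d)
      then show "norm (H1_norm \<Omega> (\<lambda>x. (\<phi> k x - \<psi> k x) - (w x - w' x)))
        \<le> 2 * H1_norm \<Omega> (\<lambda>x. \<phi> k x - w x) + 2 * H1_norm \<Omega> (\<lambda>x. \<psi> k x - w' x)"
        by (simp add: H1_norm_nonneg algebra_simps)
    qed
    show "(\<lambda>k. 2 * H1_norm \<Omega> (\<lambda>x. \<phi> k x - w x) + 2 * H1_norm \<Omega> (\<lambda>x. \<psi> k x - w' x)) \<longlonglongrightarrow> 0"
      using tendsto_add[OF tendsto_mult_right_zero[OF \<phi>(2), of 2] tendsto_mult_right_zero[OF \<psi>(2), of 2]] by simp
  qed
  moreover have "(\<lambda>k. Lq_norm 2 MF (\<lambda>x. (\<phi> k x - \<psi> k x) - (g x - g' x))) \<longlonglongrightarrow> 0"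
  proof (rule Lim_null_comparison)
    show "\<forall>\<^sub>F k in sequentially. norm (Lq_norm 2 MF (\<lambda>x. (\<phi> k x - \<psi> k x) - (g x - g' x)))
        \<le> Lq_norm 2 MF (\<lambda>x. \<phi> k x - g x) + Lq_norm 2 MF (\<lambda>x. g' x - \<psi> k x)"
    proof (intro always_eventually allI)
      fix k
      have "Lq_norm 2 MF (\<lambda>x. (\<phi> k x - g x) + (g' x - \<psi> k x))
        \<le> Lq_norm 2 MF (\<lambda>x. \<phi> k x - g x) + Lq_norm 2 MF (\<lambda>x. g' x - \<psi> k x)"
        by (intro L2_norm_triangle L2_space_diff smooth_L2_MF fin \<phi> \<psi> d)
      then show "norm (Lq_norm 2 MF (\<lambda>x. (\<phi> k x - \<psi> k x) - (g x - g' x)))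
        \<le> Lq_norm 2 MF (\<lambda>x. \<phi> k x - g x) + Lq_norm 2 MF (\<lambda>x. g' x - \<psi> k x)"
        by (simp add: Lq_norm_nonneg algebra_simps)
    qed
    show "(\<lambda>k. Lq_norm 2 MF (\<lambda>x. \<phi> k x - g x) + Lq_norm 2 MF (\<lambda>x. g' x - \<psi> k x)) \<longlonglongrightarrow> 0"
      using tendsto_add[OF \<phi>(3) \<psi>(3)] by (simp add: L2_norm_minus_commute[of MF g'])
  qed
  ultimately show ?thesis unfolding is_trace_def by (intro conjI exI[of _ "\<lambda>k x. \<phi> k x - \<psi> k x"]) auto
qed

lemma H1_0_diff:
  assumes fin: "finite_measure MF" and w: "w \<in> X0" "w' \<in> X0"
  shows "(\<lambda>x. w x - w' x) \<in> X0"
proof -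
  obtain g g' where "is_trace \<Omega> w g" "AE x in surf \<Gamma>0. g x = 0" "is_trace \<Omega> w' g'" "AE x in surf \<Gamma>0. g' x = 0"
    using w by (auto simp: H1_0_def)
  moreover from this have "AE x in surf \<Gamma>0. g x - g' x = 0" by auto
  ultimately show ?thesis
    using is_trace_diff[OF fin] H1_diff w by (force simp: H1_0_def)
qed

lemma H1_norm_const: "H1_norm \<Omega> (\<lambda>x. c) = \<bar>c\<bar> * H1_norm \<Omega> (\<lambda>x. 1)"
proof -
  have "norm_grad \<Omega> (\<lambda>x. c) = \<bar>c\<bar> * norm_grad \<Omega> (\<lambda>x. 1)"
    using norm_grad_scale[OF smooth_H1[OF smooth_const[of 1]], of c] by simp
  moreover have "norm_Om 2 \<Omega> (\<lambda>x. c) = \<bar>c\<bar> * norm_Om 2 \<Omega> (\<lambda>x. 1::real)"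
    using L2_norm_scaleR[of LO c "\<lambda>x. 1::real"] by simp
  ultimately show ?thesis
    unfolding H1_norm_def
    by (simp add: power_mult_distrib flip: distrib_left) (simp add: real_sqrt_mult)
qed

lemma zero_H1_0: "(\<lambda>x. 0) \<in> X0" and norm_grad_zero: "norm_grad \<Omega> (\<lambda>x. 0) = 0"
proof -
  have "is_trace \<Omega> (\<lambda>x. 0) (\<lambda>x. 0)"
    unfolding is_trace_def
    using smooth_H1[OF smooth_const[of 0]] H1_norm_const[of 0]
    by (intro conjI exI[of _ "\<lambda>k x. 0"]) (auto simp: L2_space_def Lq_norm_def)
  then show "(\<lambda>x. 0) \<in> X0" using smooth_H1[OF smooth_const[of 0]] by (auto simp: H1_0_def)
  show "norm_grad \<Omega> (\<lambda>x. 0) = 0"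
    using norm_grad_scale[OF smooth_H1[OF smooth_const[of 1]], of 0] by simp
qed

text \<open>One constant for both inequalities. Nonnegativity is built in, because the constant in
  the hypothesis could be negative if all gradients vanished.\<close>

definition CP :: real where
  "CP = (SOME C. 0 \<le> C \<and> (\<forall>w\<in>X0. (norm_Om 2 \<Omega> w)\<^sup>2 \<le> C * (norm_grad \<Omega> w)\<^sup>2 \<and>
        (\<forall>g. is_trace \<Omega> w g \<longrightarrow> (Lq_norm 2 MG g)\<^sup>2 \<le> C * (norm_grad \<Omega> w)\<^sup>2)))"

lemma CP: "0 \<le> CP" "w \<in> X0 \<Longrightarrow> (norm_Om 2 \<Omega> w)\<^sup>2 \<le> CP * (norm_grad \<Omega> w)\<^sup>2"
  "w \<in> X0 \<Longrightarrow> is_trace \<Omega> w g \<Longrightarrow> (Lq_norm 2 MG g)\<^sup>2 \<le> CP * (norm_grad \<Omega> w)\<^sup>2"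
proof -
  obtain C where C: "\<forall>w\<in>X0. (norm_Om 2 \<Omega> w)\<^sup>2 \<le> C * (norm_grad \<Omega> w)\<^sup>2 \<and>
        (\<forall>g. is_trace \<Omega> w g \<longrightarrow> (Lq_norm 2 MG g)\<^sup>2 \<le> C * (norm_grad \<Omega> w)\<^sup>2)"
    using poincare unfolding poincare_trace_ineq_def by blast
  have "C * (norm_grad \<Omega> w)\<^sup>2 \<le> \<bar>C\<bar> * (norm_grad \<Omega> w)\<^sup>2" for w by (intro mult_right_mono) auto
  then have "0 \<le> \<bar>C\<bar> \<and> (\<forall>w\<in>X0. (norm_Om 2 \<Omega> w)\<^sup>2 \<le> \<bar>C\<bar> * (norm_grad \<Omega> w)\<^sup>2 \<and>
        (\<forall>g. is_trace \<Omega> w g \<longrightarrow> (Lq_norm 2 MG g)\<^sup>2 \<le> \<bar>C\<bar> * (norm_grad \<Omega> w)\<^sup>2))"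
    using C by (meson abs_ge_zero order_trans)
  then have "0 \<le> CP \<and> (\<forall>w\<in>X0. (norm_Om 2 \<Omega> w)\<^sup>2 \<le> CP * (norm_grad \<Omega> w)\<^sup>2 \<and>
        (\<forall>g. is_trace \<Omega> w g \<longrightarrow> (Lq_norm 2 MG g)\<^sup>2 \<le> CP * (norm_grad \<Omega> w)\<^sup>2))"
    unfolding CP_def by (rule someI)
  then show "0 \<le> CP" "w \<in> X0 \<Longrightarrow> (norm_Om 2 \<Omega> w)\<^sup>2 \<le> CP * (norm_grad \<Omega> w)\<^sup>2"
    "w \<in> X0 \<Longrightarrow> is_trace \<Omega> w g \<Longrightarrow> (Lq_norm 2 MG g)\<^sup>2 \<le> CP * (norm_grad \<Omega> w)\<^sup>2" by auto
qed

text \<open>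
  If the boundary has infinite measure, then constants are not square integrable on it and their
  distance to \<open>g\<close> is the junk value \<open>0\<close>; hence every \<open>g\<close> is a trace of \<open>0\<close> and the trace inequality
  forces it to vanish on \<open>\<Gamma>1\<close>. This spares us a proof that the boundary has finite measure.
\<close>

lemma infinite_boundary:
  fixes g :: "'a \<Rightarrow> real"
  assumes inf: "\<not> finite_measure MF" and g: "g \<in> L2_space MF"
  shows "Lq_norm 2 MG g = 0"
proof -
  have nint: "\<not> integrable MF (\<lambda>x. (norm (c - g x))\<^sup>2)" if c: "c \<noteq> 0" for c :: real
  proof
    assume i: "integrable MF (\<lambda>x. (norm (c - g x))\<^sup>2)"
    have "integrable MF (\<lambda>x. c\<^sup>2)"
    proof (rule Bochner_Integration.integrable_bound)
      show "integrable MF (\<lambda>x. 2 * (norm (c - g x))\<^sup>2 + 2 * (norm (g x))\<^sup>2)"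
        using i L2_spaceD(2)[OF g] by simp
      have "c\<^sup>2 \<le> 2 * (c - a)\<^sup>2 + 2 * a\<^sup>2" for a
        using zero_le_power2[of "c - 2 * a"] by (simp add: power2_eq_square algebra_simps)
      then show "AE x in MF. norm (c\<^sup>2) \<le> norm (2 * (norm (c - g x))\<^sup>2 + 2 * (norm (g x))\<^sup>2)"
        by simp
    qed simp
    then have "emeasure MF (space MF) < \<infinity>" using c by (auto simp: integrable_iff_bounded ennreal_mult_less_top)
    then show False using inf finite_measureI[of MF] by auto
  qed
  have "is_trace \<Omega> (\<lambda>x. 0) g"
    unfolding is_trace_def
  \<comment> \<open>Constants that tend to 0 in the H1 norm but are never 0: each of them is too
    large to be square integrable on a boundary of infinite measure.\<close>
  proof (intro conjI exI[of _ "\<lambda>k x. 1 / real (Suc k)"] allI)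
    show "(\<lambda>x. 0) \<in> H1 \<Omega>" "g \<in> L2_space MF" using g smooth_H1 by auto
    have "(\<lambda>k. \<bar>1 / real (Suc k)\<bar> * H1_norm \<Omega> (\<lambda>x. 1)) \<longlonglongrightarrow> 0"
      by (rule tendsto_mult_left_zero) (use LIMSEQ_inverse_real_of_nat in \<open>simp add: inverse_eq_divide\<close>)
    then show "(\<lambda>k. H1_norm \<Omega> (\<lambda>x. 1 / real (Suc k) - 0)) \<longlonglongrightarrow> 0"
      using H1_norm_const[of "1 / real (Suc _)"] by simp
    have "Lq_norm 2 MF (\<lambda>x. 1 / real (Suc k) - g x) = 0" for k
      using nint[of "1 / real (Suc k)"] by (simp add: Lq_norm_2_sqrt not_integrable_integral_eq)
    then show "(\<lambda>k. Lq_norm 2 MF (\<lambda>x. 1 / real (Suc k) - g x)) \<longlonglongrightarrow> 0" by simp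
  qed auto
  then have "(Lq_norm 2 MG g)\<^sup>2 \<le> CP * (norm_grad \<Omega> (\<lambda>x. 0))\<^sup>2"
    by (rule CP(3)[OF zero_H1_0])
  then show ?thesis by (simp add: norm_grad_zero)
qed

text \<open>\<open>tr w - tr w'\<close> need not be the trace chosen for \<open>w - w'\<close>. The
  bound still applies, because the trace inequality covers every representative of the
  trace.\<close>

lemma trace_diff_bound:
  assumes w: "w \<in> X0" "w' \<in> X0"
  shows "(Lq_norm 2 MG (\<lambda>x. tr w x - tr w' x))\<^sup>2 \<le> CP * (norm_grad \<Omega> (\<lambda>x. w x - w' x))\<^sup>2"
proof (cases "finite_measure MF")
  case True
  show ?thesis
    by (rule CP(3)[OF H1_0_diff[OF True w] is_trace_diff[OF True bd_trace_is_trace[OF w(1)] bd_trace_is_trace[OF w(2)]]])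
next
  case False
  have "(\<lambda>x. tr w x - tr w' x) \<in> L2_space MF"
    by (intro L2_space_diff is_traceD(2)[OF bd_trace_is_trace] w)
  then show ?thesis using infinite_boundary[OF False] CP(1) by simp
qed

lemma norm_grad_eq_0_ae_zero:
  assumes "w \<in> X0" "norm_grad \<Omega> w = 0"
  shows "ae_zero \<Omega> w"
  using CP(2)[OF assms(1)] assms(2) L2_norm_eq_0_iff[OF H1_L2[OF H1_0_H1[OF assms(1)]]]
  by (simp add: ae_zero_def)

text \<open>As for \<open>grad\<close>, the two choices coincide literally: the predicates
  \<open>is_trace \<Omega> w\<close> and \<open>is_trace \<Omega> w'\<close> are equal.\<close>

lemma trace_cong_AE:
  assumes w: "w \<in> H1 \<Omega>" "w' \<in> H1 \<Omega>" and ae: "AE x in LO. w x = w' x"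
  shows "tr w = tr w'"
proof -
  have "H1_norm \<Omega> (\<lambda>x. \<phi> x - w x) = H1_norm \<Omega> (\<lambda>x. \<phi> x - w' x)" if "smooth \<phi>" for \<phi>
  proof -
    have h: "(\<lambda>x. \<phi> x - w x) \<in> H1 \<Omega>" "(\<lambda>x. \<phi> x - w' x) \<in> H1 \<Omega>"
      by (intro H1_diff smooth_H1 that w)+
    have e: "AE x in LO. \<phi> x - w x = \<phi> x - w' x" using ae by eventually_elim simp
    show ?thesis
      unfolding H1_norm_def H1_cong_AE[OF h e]
      using Lq_norm_cong_AE[OF e L2_spaceD(1)[OF H1_L2[OF h(1)]] L2_spaceD(1)[OF H1_L2[OF h(2)]], of 2] by simp
  qed
  then have "is_trace \<Omega> w = is_trace \<Omega> w'" using w by (auto simp: is_trace_def fun_eq_iff)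
  then show ?thesis by (simp add: bd_trace_def)
qed

end

section \<open>Weak derivatives in time\<close>

lemma lebesgue_on_subset_integral:
  fixes f :: "'a::euclidean_space \<Rightarrow> real"
  assumes "S \<in> sets lebesgue" "T \<in> sets lebesgue" "S \<subseteq> T" "\<And>x. x \<in> T \<Longrightarrow> x \<notin> S \<Longrightarrow> f x = 0"
  shows "(\<integral>x. f x \<partial>lebesgue_on T) = (\<integral>x. f x \<partial>lebesgue_on S)"
  using assms
  by (simp add: integral_restrict_space) (rule Bochner_Integration.integral_cong, auto simp: indicator_def)

lemma smooth_scaled_step: "smooth (\<lambda>\<tau>. smooth_step (c * (\<tau> - s)))"
  using smooth_compose_real[OF smooth_smooth_step smooth_affine[of c "- c * s"]] by (simp add: algebra_simps)

definition step_deriv :: "real \<Rightarrow> real" where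
  "step_deriv = partial_deriv 1 smooth_step"

lemma DERIV_smooth:
  assumes "smooth (f :: real \<Rightarrow> real)"
  shows "(f has_real_derivative partial_deriv 1 f x) (at x)"
proof -
  obtain D where "(f has_real_derivative D) (at x)"
    using smooth_differentiable[OF assms, of x] by (auto simp: real_differentiable_def)
  then show ?thesis using partial_deriv_real by metis
qed

lemma DERIV_scaled_step:
  "((\<lambda>\<tau>. smooth_step (c * (\<tau> - s))) has_real_derivative c * step_deriv (c * (\<tau> - s))) (at \<tau>)"
proof -
  have "((\<lambda>\<tau>. smooth_step (c * (\<tau> - s))) has_real_derivative step_deriv (c * (\<tau> - s)) * c) (at \<tau>)"
    using DERIV_smooth[OF smooth_smooth_step] unfolding step_deriv_def
    by (rule DERIV_chain2) (auto intro!: derivative_eq_intros)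
  then show ?thesis by (simp add: mult.commute)
qed

lemma step_deriv_zero:
  assumes "x \<notin> {0..1}"
  shows "step_deriv x = 0"
proof -
  have "\<exists>c. ((\<lambda>x. smooth_step x - c) has_real_derivative 0) (at x)"
  proof (cases "x < 0")
    case True
    have "((\<lambda>x. 0) has_real_derivative 0) (at x)" by simp
    then have "((\<lambda>x. smooth_step x - 0) has_real_derivative 0) (at x)"
      by (rule has_field_derivative_transform_within_open[of _ _ _ "{..<0}"]) (use True in \<open>auto simp: smooth_step_eq_0\<close>)
    then show ?thesis by blast
  next
    case False
    have "((\<lambda>x. 0) has_real_derivative 0) (at x)" by simp
    then have "((\<lambda>x. smooth_step x - 1) has_real_derivative 0) (at x)"
      by (rule has_field_derivative_transform_within_open[of _ _ _ "{1<..}"])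
        (use assms False in \<open>auto simp: smooth_step_eq_1\<close>)
    then show ?thesis by blast
  qed
  then obtain c where c: "((\<lambda>x. smooth_step x - c) has_real_derivative 0) (at x)" by blast
  have "((\<lambda>x. (smooth_step x - c) + c) has_real_derivative 0 + 0) (at x)"
    by (intro DERIV_add c DERIV_const)
  then show ?thesis unfolding step_deriv_def by (intro partial_deriv_real) simp
qed

lemma continuous_step_deriv: "continuous_on S step_deriv"
  unfolding step_deriv_def by (intro smooth_continuous_on smooth_partial_deriv smooth_smooth_step) simp

lemma step_deriv_bounded: "\<exists>B>0. \<forall>x. \<bar>step_deriv x\<bar> \<le> B"
proof -
  obtain c where "c \<ge> 0" "\<forall>x. \<bar>step_deriv x\<bar> \<le> c"
    using bounded_compact_support[of step_deriv "{0..1}"] continuous_step_deriv step_deriv_zero by auto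
  then show ?thesis by (intro exI[of _ "c + 1"]) (auto intro: add_increasing2 order_trans)
qed

text \<open>The scaled derivative of the step is a mollifier kernel living to the right of
  \<open>s\<close>; its mass is the total rise of the step.\<close>

lemma has_integral_step_deriv:
  assumes n: "n > 0"
  shows "((\<lambda>\<tau>. n * step_deriv (n * (\<tau> - s))) has_integral 1) {s..s + 1 / n}"
proof -
  have "((\<lambda>\<tau>. n * step_deriv (n * (\<tau> - s))) has_integral
      (smooth_step (n * (s + 1 / n - s)) - smooth_step (n * (s - s)))) {s..s + 1 / n}"
  proof (rule fundamental_theorem_of_calculus)
    fix x assume "x \<in> {s..s + 1 / n}"
    show "((\<lambda>\<tau>. smooth_step (n * (\<tau> - s))) has_vector_derivative n * step_deriv (n * (x - s))) (at x within {s..s + 1 / n})"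
      using DERIV_scaled_step[of n s x]
      by (simp add: has_real_derivative_iff_has_vector_derivative has_vector_derivative_at_within)
  qed (use n in simp)
  then show ?thesis using n by (simp add: smooth_step_eq_0 smooth_step_eq_1)
qed

lemma mollifier_limit:
  assumes g: "continuous_on {0<..<T} g" and s: "0 < s" "s < T"
  shows "(\<lambda>n. \<integral>\<tau>. g \<tau> * (real (Suc n) * step_deriv (real (Suc n) * (\<tau> - s))) \<partial>lebesgue_on {0<..<T}) \<longlonglongrightarrow> (g s :: real)"
proof (rule LIMSEQ_I)
  fix e :: real assume e: "0 < e"
  obtain B where B: "B > 0" "\<And>x. \<bar>step_deriv x\<bar> \<le> B" using step_deriv_bounded by blast
  have "isCont g s" using g s by (auto simp: continuous_on_eq_continuous_at)
  \<comment> \<open>The kernel is at most \<open>m * B\<close> in modulus on an interval of length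
    \<open>1 / m\<close>, so a deviation of \<open>e / (2 * B)\<close> contributes at most
    \<open>e / 2\<close>.\<close>
  then obtain d where d: "d > 0" "\<And>x. \<bar>x - s\<bar> < d \<Longrightarrow> \<bar>g x - g s\<bar> < e / (2 * B)"
    using e B(1) unfolding continuous_at_real_range
    by (force dest: spec[of _ "e / (2 * B)"])
  obtain N where N: "1 / real (Suc N) < min d (T - s)"
    using reals_Archimedean[of "min d (T - s)"] d s by (auto simp: inverse_eq_divide)
  show "\<exists>no. \<forall>n\<ge>no. norm ((\<integral>\<tau>. g \<tau> * (real (Suc n) * step_deriv (real (Suc n) * (\<tau> - s))) \<partial>lebesgue_on {0<..<T}) - g s) < e"
  proof (intro exI[of _ N] allI impI)
    fix n assume n: "n \<ge> N"
    define m where "m = real (Suc n)"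
    have m: "m > 0" by (simp add: m_def)
    have "1 / m \<le> 1 / real (Suc N)" using n by (simp add: m_def field_simps)
    then have mm: "1 / m < d" "s + 1 / m < T" using N by linarith+
    let ?\<rho> = "\<lambda>\<tau>. m * step_deriv (m * (\<tau> - s))" and ?I = "{s..s + 1 / m}"
    have off: "?\<rho> \<tau> = 0" if "\<tau> \<notin> ?I" for \<tau>
    proof -
      have "m * (\<tau> - s) \<notin> {0..1}"
        using that m by (auto simp: field_simps zero_le_mult_iff)
      then show ?thesis using step_deriv_zero by simp
    qed
    have cg: "continuous_on ?I g" using g mm s by (elim continuous_on_subset) auto
    have c\<rho>: "continuous_on ?I ?\<rho>"
      by (intro continuous_intros continuous_on_compose2[OF continuous_step_deriv[of UNIV]]) auto
    have "(\<integral>\<tau>. g \<tau> * ?\<rho> \<tau> \<partial>lebesgue_on {0<..<T}) = (\<integral>\<tau>. g \<tau> * ?\<rho> \<tau> \<partial>lebesgue_on ?I)"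
      by (rule lebesgue_on_subset_integral) (use mm s off in auto)
    also have "\<dots> = integral ?I (\<lambda>\<tau>. g \<tau> * ?\<rho> \<tau>)"
      by (intro lebesgue_integral_eq_integral continuous_imp_integrable_real continuous_on_mult cg c\<rho>) auto
    finally have 1: "(\<integral>\<tau>. g \<tau> * ?\<rho> \<tau> \<partial>lebesgue_on {0<..<T}) = integral ?I (\<lambda>\<tau>. g \<tau> * ?\<rho> \<tau>)" .
    have "((\<lambda>\<tau>. g \<tau> * ?\<rho> \<tau> - g s * ?\<rho> \<tau>) has_integral (integral ?I (\<lambda>\<tau>. g \<tau> * ?\<rho> \<tau>) - g s * 1)) ?I"
      by (intro has_integral_diff integrable_integral integrable_continuous_real continuous_on_mult cg c\<rho>
          has_integral_mult_right has_integral_step_deriv m)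
    moreover have "norm (g \<tau> * ?\<rho> \<tau> - g s * ?\<rho> \<tau>) \<le> (e / (2 * B)) * (m * B)" if "\<tau> \<in> ?I" for \<tau>
    proof -
      have "\<bar>g \<tau> - g s\<bar> \<le> e / (2 * B)" using d(2)[of \<tau>] that mm(1) by (intro less_imp_le) auto
      moreover have "\<bar>?\<rho> \<tau>\<bar> \<le> m * B" using B m by (auto simp: abs_mult)
      ultimately have "\<bar>g \<tau> - g s\<bar> * \<bar>?\<rho> \<tau>\<bar> \<le> (e / (2 * B)) * (m * B)"
        by (intro mult_mono) (use e B in auto)
      then show ?thesis by (simp add: abs_mult flip: left_diff_distrib)
    qed
    ultimately have "norm (integral ?I (\<lambda>\<tau>. g \<tau> * ?\<rho> \<tau>) - g s * 1) \<le> (e / (2 * B)) * (m * B) * measure lborel (cbox s (s + 1 / m))"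
      by (intro has_integral_bound[where f="\<lambda>\<tau>. g \<tau> * ?\<rho> \<tau> - g s * ?\<rho> \<tau>"]) (use e B m in auto)
    also have "\<dots> = e / 2" using m B by simp
    finally show "norm ((\<integral>\<tau>. g \<tau> * (real (Suc n) * step_deriv (real (Suc n) * (\<tau> - s))) \<partial>lebesgue_on {0<..<T}) - g s) < e"
      using e unfolding 1[unfolded m_def, symmetric] m_def by simp
  qed
qed

text \<open>The interval is half-open because the step at \<open>r\<close> still vanishes at
  \<open>\<tau> = r\<close>. The missing endpoint \<open>s\<close> is a null set, which
  \<open>integral_half_open\<close> takes into account.\<close>

lemma step_difference_limit:
  assumes "s \<le> t"
  shows "(\<lambda>n. smooth_step (real (Suc n) * (\<tau> - s)) - smooth_step (real (Suc n) * (\<tau> - t))) \<longlonglongrightarrow> indicator {s<..t} \<tau>"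
proof -
  have *: "(\<lambda>n. smooth_step (real (Suc n) * (\<tau> - r))) \<longlonglongrightarrow> (if \<tau> \<le> r then 0 else 1)" for r
  proof (cases "\<tau> \<le> r")
    case True
    have "smooth_step (real (Suc n) * (\<tau> - r)) = 0" for n
      by (rule smooth_step_eq_0) (use True in \<open>simp add: mult_nonneg_nonpos\<close>)
    then show ?thesis using True by simp
  next
    case False
    obtain N where N: "inverse (real (Suc N)) < \<tau> - r" using reals_Archimedean[of "\<tau> - r"] False by auto
    have "1 \<le> real (Suc n) * (\<tau> - r)" if "n \<ge> N" for n
    proof -
      have "inverse (real (Suc n)) \<le> inverse (real (Suc N))" using that by simp
      then have "inverse (real (Suc n)) \<le> \<tau> - r" using N by linarith
      then have "real (Suc n) * inverse (real (Suc n)) \<le> real (Suc n) * (\<tau> - r)"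
        by (intro mult_left_mono) auto
      then show ?thesis by simp
    qed
    then have "\<forall>\<^sub>F n in sequentially. 1 = smooth_step (real (Suc n) * (\<tau> - r))"
      unfolding eventually_sequentially using smooth_step_eq_1 by metis
    then show ?thesis using False by (auto intro: Lim_transform_eventually[OF tendsto_const])
  qed
  have "(\<lambda>n. smooth_step (real (Suc n) * (\<tau> - s)) - smooth_step (real (Suc n) * (\<tau> - t)))
     \<longlonglongrightarrow> (if \<tau> \<le> s then 0 else 1) - (if \<tau> \<le> t then 0 else 1)"
    by (intro tendsto_diff *)
  moreover have "(if \<tau> \<le> s then 0 else 1) - (if \<tau> \<le> t then 0 else 1) = (indicator {s<..t} \<tau> :: real)"
    using assms by auto
  ultimately show ?thesis by simp
qed

lemma integral_half_open:
  fixes k :: "real \<Rightarrow> real"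
  assumes "0 < s" "s \<le> t" "t < T" and k: "k \<in> borel_measurable (lebesgue_on {0<..<T})"
  shows "(\<integral>\<tau>. indicator {s<..t} \<tau> * k \<tau> \<partial>lebesgue_on {0<..<T}) = (\<integral>\<tau>. k \<tau> \<partial>lebesgue_on {s..t})"
proof -
  have k: "k \<in> borel_measurable (lebesgue_on {s..t})"
    by (rule measurable_restrict_mono[OF k]) (use assms in auto)
  have "(\<integral>\<tau>. indicator {s<..t} \<tau> * k \<tau> \<partial>lebesgue_on {0<..<T}) = (\<integral>\<tau>. indicator {s<..t} \<tau> * k \<tau> \<partial>lebesgue_on {s..t})"
    by (rule lebesgue_on_subset_integral) (use assms in auto)
  also have "\<dots> = (\<integral>\<tau>. k \<tau> \<partial>lebesgue_on {s..t})"
  proof (rule integral_cong_AE)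
    have "(indicator {s<..t} :: real \<Rightarrow> real) \<in> borel_measurable (lebesgue_on {s..t})"
      by (rule measurable_restrict_space1) (simp add: measurable_completion)
    then show "(\<lambda>\<tau>. indicator {s<..t} \<tau> * k \<tau>) \<in> borel_measurable (lebesgue_on {s..t})"
      using k by measurable
    show "AE \<tau> in lebesgue_on {s..t}. indicator {s<..t} \<tau> * k \<tau> = k \<tau>"
    proof (subst AE_restrict_space_iff)
      have "AE \<tau> in lebesgue. \<tau> \<notin> {s}" by (rule AE_not_in) simp
      then show "AE \<tau> in lebesgue. \<tau> \<in> {s..t} \<longrightarrow> indicator {s<..t} \<tau> * k \<tau> = k \<tau>"
        by eventually_elim auto
    qed simp
  qed (use k in auto)
  finally show ?thesis .
qed

text \<open>Du Bois-Reymond: the test functions are differences of smooth steps at \<open>s\<close> and \<open>t\<close>.\<close>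

lemma weak_derivative_increment:
  fixes g k :: "real \<Rightarrow> real"
  assumes g: "continuous_on {0<..<T} g" and k: "integrable (lebesgue_on {0<..<T}) k"
    and weak: "\<And>\<eta>. \<eta> \<in> test_fun {0<..<T} \<Longrightarrow>
      (\<integral>\<tau>. g \<tau> * partial_deriv 1 \<eta> \<tau> \<partial>lebesgue_on {0<..<T}) = - (\<integral>\<tau>. k \<tau> * \<eta> \<tau> \<partial>lebesgue_on {0<..<T})"
    and st: "0 < s" "s \<le> t" "t < T"
  shows "g t - g s = (\<integral>\<tau>. k \<tau> \<partial>lebesgue_on {s..t})"
proof -
  let ?L = "lebesgue_on {0<..<T}"
  define \<theta> where "\<theta> r n \<tau> = smooth_step (real (Suc n) * (\<tau> - r))" for r n \<tau>
  define \<rho> where "\<rho> r n \<tau> = real (Suc n) * step_deriv (real (Suc n) * (\<tau> - r))" for r n \<tau>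
  define \<eta> where "\<eta> n \<tau> = \<theta> s n \<tau> - \<theta> t n \<tau>" for n \<tau>
  have sm: "smooth (\<eta> n)" for n
    unfolding \<eta>_def[abs_def] \<theta>_def by (intro smooth_diff smooth_scaled_step)
  have d\<eta>: "partial_deriv 1 (\<eta> n) \<tau> = \<rho> s n \<tau> - \<rho> t n \<tau>" for n \<tau>
    unfolding \<eta>_def[abs_def] \<theta>_def \<rho>_def by (intro partial_deriv_real DERIV_diff DERIV_scaled_step)
  \<comment> \<open>Each step is completed within \<open>1 / Suc n\<close> to the right of its base
    point. From \<open>N\<close> on this happens before \<open>T\<close>, so the difference of steps
    has compact support in the open interval.\<close>
  obtain N where N: "inverse (real (Suc N)) < T - t" using reals_Archimedean[of "T - t"] st by auto
  have test: "\<eta> n \<in> test_fun {0<..<T}" if n: "n \<ge> N" for n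
  proof (rule test_funI[OF sm])
    let ?C = "{s..t + inverse (real (Suc n))}"
    have "inverse (real (Suc n)) \<le> inverse (real (Suc N))" using n by simp
    then have "t + inverse (real (Suc n)) < T" using N by linarith
    then show "?C \<subseteq> {0<..<T}" using st by (auto simp del: of_nat_Suc)
    fix \<tau> assume \<tau>: "\<tau> \<notin> ?C"
    show "\<eta> n \<tau> = 0"
    proof (cases "\<tau> < s")
      case True
      then show ?thesis unfolding \<eta>_def \<theta>_def using st
        by (subst (1 2) smooth_step_eq_0) (auto intro!: mult_nonneg_nonpos)
    next
      case False
      then have a: "inverse (real (Suc n)) \<le> \<tau> - t" using \<tau> by auto
      have "1 \<le> real (Suc n) * (\<tau> - r)" if "r \<le> t" for r
      proof -
        have "inverse (real (Suc n)) \<le> \<tau> - r" using a that by linarith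
        then have "real (Suc n) * inverse (real (Suc n)) \<le> real (Suc n) * (\<tau> - r)"
          by (intro mult_left_mono) auto
        then show ?thesis by simp
      qed
      then show ?thesis unfolding \<eta>_def \<theta>_def using st by (subst (1 2) smooth_step_eq_1) auto
    qed
  qed simp
  have gi: "integrable ?L (\<lambda>\<tau>. g \<tau> * \<rho> r n \<tau>)" if n: "n \<ge> N" and r: "0 < r" "r \<le> t" for n r
  proof -
    let ?I = "{r..r + inverse (real (Suc n))}"
    have "inverse (real (Suc n)) \<le> inverse (real (Suc N))" using n by simp
    then have "r + inverse (real (Suc n)) < T" using N r by linarith
    then have sub: "?I \<subseteq> {0<..<T}" using r by (auto simp del: of_nat_Suc)
    have off: "\<rho> r n \<tau> = 0" if "\<tau> \<notin> ?I" for \<tau>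
    proof -
      have "real (Suc n) * (\<tau> - r) \<notin> {0..1}"
        using that by (auto simp: field_simps zero_le_mult_iff simp del: of_nat_Suc)
      then show ?thesis using step_deriv_zero by (simp add: \<rho>_def)
    qed
    have "continuous_on ?I (\<lambda>\<tau>. g \<tau> * \<rho> r n \<tau>)"
      unfolding \<rho>_def
      by (intro continuous_intros continuous_on_compose2[OF continuous_step_deriv[of UNIV]] continuous_on_subset[OF g sub]) auto
    then have "integrable (lebesgue_on ?I) (\<lambda>\<tau>. g \<tau> * \<rho> r n \<tau>)" by (rule continuous_imp_integrable_real)
    then have i: "integrable lebesgue (\<lambda>\<tau>. indicator ?I \<tau> *\<^sub>R (g \<tau> * \<rho> r n \<tau>))"
      by (subst (asm) integrable_restrict_space) auto
    have "(\<lambda>\<tau>. indicator {0<..<T} \<tau> *\<^sub>R (g \<tau> * \<rho> r n \<tau>)) = (\<lambda>\<tau>. indicator ?I \<tau> *\<^sub>R (g \<tau> * \<rho> r n \<tau>))"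
    proof
      fix \<tau> show "indicator {0<..<T} \<tau> *\<^sub>R (g \<tau> * \<rho> r n \<tau>) = indicator ?I \<tau> *\<^sub>R (g \<tau> * \<rho> r n \<tau>)"
      proof (cases "\<tau> \<in> ?I")
        case True
        moreover from this have "\<tau> \<in> {0<..<T}" using sub by blast
        ultimately show ?thesis by (simp only: indicator_simps)
      qed (simp add: off)
    qed
    then show ?thesis using i by (subst integrable_restrict_space) auto
  qed
  have "(\<lambda>n. (\<integral>\<tau>. g \<tau> * \<rho> s n \<tau> \<partial>?L) - (\<integral>\<tau>. g \<tau> * \<rho> t n \<tau> \<partial>?L)) \<longlonglongrightarrow> g s - g t"
    unfolding \<rho>_def by (intro tendsto_diff mollifier_limit g) (use st in auto)
  moreover have "\<forall>\<^sub>F n in sequentially. (\<integral>\<tau>. g \<tau> * \<rho> s n \<tau> \<partial>?L) - (\<integral>\<tau>. g \<tau> * \<rho> t n \<tau> \<partial>?L) = - (\<integral>\<tau>. k \<tau> * \<eta> n \<tau> \<partial>?L)"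
  proof (rule eventually_sequentiallyI[of N])
    fix n assume n: "N \<le> n"
    show "(\<integral>\<tau>. g \<tau> * \<rho> s n \<tau> \<partial>?L) - (\<integral>\<tau>. g \<tau> * \<rho> t n \<tau> \<partial>?L) = - (\<integral>\<tau>. k \<tau> * \<eta> n \<tau> \<partial>?L)"
      using weak[OF test[OF n]] gi[OF n, of s] gi[OF n, of t] st by (simp add: d\<eta> right_diff_distrib)
  qed
  ultimately have "(\<lambda>n. - (\<integral>\<tau>. k \<tau> * \<eta> n \<tau> \<partial>?L)) \<longlonglongrightarrow> g s - g t"
    by (rule Lim_transform_eventually)
  moreover have "(\<lambda>n. \<integral>\<tau>. k \<tau> * \<eta> n \<tau> \<partial>?L) \<longlonglongrightarrow> (\<integral>\<tau>. k \<tau> * indicator {s<..t} \<tau> \<partial>?L)"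
  proof (rule integral_dominated_convergence[where w="\<lambda>\<tau>. norm (k \<tau>)"])
    have m: "(f :: real \<Rightarrow> real) \<in> borel_measurable ?L" if "f \<in> borel_measurable borel" for f
      using that by (intro measurable_restrict_space1) (simp add: measurable_completion)
    show "(\<lambda>\<tau>. k \<tau> * indicator {s<..t} \<tau>) \<in> borel_measurable ?L"
      using k by (intro borel_measurable_times borel_measurable_integrable[OF k] m) auto
    show "(\<lambda>\<tau>. k \<tau> * \<eta> n \<tau>) \<in> borel_measurable ?L" for n
      by (intro borel_measurable_times borel_measurable_integrable[OF k] m borel_measurable_continuous_onI smooth_continuous_on sm)
    show "AE \<tau> in ?L. (\<lambda>n. k \<tau> * \<eta> n \<tau>) \<longlonglongrightarrow> k \<tau> * indicator {s<..t} \<tau>"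
      unfolding \<eta>_def \<theta>_def by (intro AE_I2 tendsto_intros step_difference_limit st)
    show "AE \<tau> in ?L. norm (k \<tau> * \<eta> n \<tau>) \<le> norm (k \<tau>)" for n
    proof (intro AE_I2)
      fix \<tau>
      have "\<bar>\<eta> n \<tau>\<bar> \<le> 1"
        using smooth_step_bounds[of "real (Suc n) * (\<tau> - s)"] smooth_step_bounds[of "real (Suc n) * (\<tau> - t)"]
        unfolding \<eta>_def \<theta>_def by linarith
      then show "norm (k \<tau> * \<eta> n \<tau>) \<le> norm (k \<tau>)" by (simp add: abs_mult mult_left_le)
    qed
  qed (use k in simp)
  ultimately have "g s - g t = - (\<integral>\<tau>. k \<tau> * indicator {s<..t} \<tau> \<partial>?L)"
    using LIMSEQ_unique tendsto_minus by blast
  also have "(\<integral>\<tau>. k \<tau> * indicator {s<..t} \<tau> \<partial>?L) = (\<integral>\<tau>. k \<tau> \<partial>lebesgue_on {s..t})"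
    using integral_half_open[OF st borel_measurable_integrable[OF k]] by (simp add: mult.commute)
  finally show ?thesis by simp
qed

lemma product_test_fun:
  fixes \<eta> :: "real \<Rightarrow> real" and \<psi> :: "'a::euclidean_space \<Rightarrow> real"
  assumes \<eta>: "\<eta> \<in> test_fun I" and \<psi>: "\<psi> \<in> test_fun U"
  shows "(\<lambda>z. \<eta> (fst z) * \<psi> (snd z)) \<in> test_fun (I \<times> U)"
    and "partial_deriv (1, 0) (\<lambda>z. \<eta> (fst z) * \<psi> (snd z)) (t, x) = partial_deriv 1 \<eta> t * \<psi> x"
proof -
  note s = test_fun_smooth[OF \<eta>] test_fun_smooth[OF \<psi>]
  have s1: "smooth (\<lambda>z::real \<times> 'a. \<eta> (fst z))" and s2: "smooth (\<lambda>z::real \<times> 'a. \<psi> (snd z))"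
    using smooth_compose_linear[OF bounded_linear_fst s(1)] smooth_compose_linear[OF bounded_linear_snd s(2)] by auto
  obtain C D where "compact C" "C \<subseteq> I" "\<forall>x. x \<notin> C \<longrightarrow> \<eta> x = 0" "compact D" "D \<subseteq> U" "\<forall>x. x \<notin> D \<longrightarrow> \<psi> x = 0"
    using \<eta> \<psi> by (auto simp: test_fun_def)
  then show "(\<lambda>z. \<eta> (fst z) * \<psi> (snd z)) \<in> test_fun (I \<times> U)"
    by (intro test_funI[of _ "C \<times> D"] smooth_mult s1 s2) (auto intro: compact_Times)
  have "partial_deriv (1, 0) (\<lambda>z::real \<times> 'a. \<eta> (fst z)) (t, x) = partial_deriv 1 \<eta> t"
    using partial_deriv_compose_linear[OF bounded_linear_fst, of \<eta> "(t, x)" "(1, 0::'a)"] smooth_differentiable[OF s(1)] by simp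
  moreover have "partial_deriv (1, 0) (\<lambda>z::real \<times> 'a. \<psi> (snd z)) (t, x) = 0"
    using partial_deriv_compose_linear[OF bounded_linear_snd, of \<psi> "(t, x)" "(1::real, 0)"] smooth_differentiable[OF s(2)] by simp
  ultimately show "partial_deriv (1, 0) (\<lambda>z. \<eta> (fst z) * \<psi> (snd z)) (t, x) = partial_deriv 1 \<eta> t * \<psi> x"
    using partial_deriv_mult[OF smooth_differentiable[OF s1] smooth_differentiable[OF s2], of "(1, 0)" "(t, x)"] by simp
qed

text \<open>Products of a test function in time and one in space reduce the distributional
  derivative in space-time to the weak derivative of a scalar function of time. The measure
  \<open>M\<close> is general in order to cover both the domain and its boundary.\<close>

lemma time_deriv_increment:
  assumes td: "time_deriv T U M u v" and \<psi>: "\<psi> \<in> test_fun U"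
    and g: "continuous_on {0<..<T} (\<lambda>t. \<integral>x. u t x * \<psi> x \<partial>M)"
    and k: "integrable (lebesgue_on {0<..<T}) (\<lambda>t. \<integral>x. v t x * \<psi> x \<partial>M)"
    and st: "0 < s" "s \<le> t" "t < T"
  shows "(\<integral>x. u t x * \<psi> x \<partial>M) - (\<integral>x. u s x * \<psi> x \<partial>M) = (\<integral>\<tau>. (\<integral>x. v \<tau> x * \<psi> x \<partial>M) \<partial>lebesgue_on {s..t})"
proof (rule weak_derivative_increment[OF g k _ st])
  fix \<eta> :: "real \<Rightarrow> real" assume \<eta>: "\<eta> \<in> test_fun {0<..<T}"
  note p = product_test_fun[OF \<eta> \<psi>]
  have "(\<integral>t. (\<integral>x. u t x * partial_deriv (1, 0) (\<lambda>z. \<eta> (fst z) * \<psi> (snd z)) (t, x) \<partial>M) \<partial>lebesgue_on {0<..<T}) =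
        - (\<integral>t. (\<integral>x. v t x * (\<eta> (fst (t, x)) * \<psi> (snd (t, x))) \<partial>M) \<partial>lebesgue_on {0<..<T})"
    using td p(1) unfolding time_deriv_def by blast
  moreover have "(\<integral>x. u t x * (partial_deriv 1 \<eta> t * \<psi> x) \<partial>M) = (\<integral>x. u t x * \<psi> x \<partial>M) * partial_deriv 1 \<eta> t"
    "(\<integral>x. v t x * (\<eta> t * \<psi> x) \<partial>M) = (\<integral>x. v t x * \<psi> x \<partial>M) * \<eta> t" for t
    by (simp_all add: ac_simps flip: integral_mult_right_zero)
  ultimately show "(\<integral>\<tau>. (\<integral>x. u \<tau> x * \<psi> x \<partial>M) * partial_deriv 1 \<eta> \<tau> \<partial>lebesgue_on {0<..<T})
      = - (\<integral>\<tau>. (\<integral>x. v \<tau> x * \<psi> x \<partial>M) * \<eta> \<tau> \<partial>lebesgue_on {0<..<T})"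
    by (simp add: p(2))
qed

section \<open>Square integrable functions on a product\<close>

lemma finite_pair_sigma_finite:
  assumes "finite_measure M1" "finite_measure M2"
  shows "pair_sigma_finite M1 M2"
  using assms by (simp add: pair_sigma_finite_def finite_measure.axioms(1))

lemma finite_pair_measure:
  assumes "finite_measure M1" "finite_measure M2"
  shows "finite_measure (M1 \<Otimes>\<^sub>M M2)"
proof (rule finite_measureI)
  interpret M2: sigma_finite_measure M2 using assms(2) by (rule finite_measure.axioms(1))
  have "emeasure (M1 \<Otimes>\<^sub>M M2) (space (M1 \<Otimes>\<^sub>M M2)) = emeasure M1 (space M1) * emeasure M2 (space M2)"
    by (simp add: space_pair_measure M2.emeasure_pair_measure_Times)
  then show "emeasure (M1 \<Otimes>\<^sub>M M2) (space (M1 \<Otimes>\<^sub>M M2)) \<noteq> \<infinity>"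
    using finite_measure.finite_emeasure_space[OF assms(1)] finite_measure.finite_emeasure_space[OF assms(2)]
    by (simp add: ennreal_mult_eq_top_iff)
qed

lemma L2_product_snd:
  fixes w :: "'b \<Rightarrow> real"
  assumes fin: "finite_measure M1" "finite_measure M2" and w: "w \<in> L2_space M2"
  shows "(\<lambda>(t, x). w x) \<in> L2_space (M1 \<Otimes>\<^sub>M M2)"
proof -
  interpret pair_sigma_finite M1 M2 using finite_pair_sigma_finite[OF fin] .
  interpret M1: finite_measure M1 by fact
  note [measurable] = L2_spaceD(1)[OF w]
  have "integrable (M1 \<Otimes>\<^sub>M M2) (\<lambda>(t, x). (norm (w x))\<^sup>2)"
    by (rule Fubini_integrable) (use L2_spaceD(2)[OF w] in auto)
  then show ?thesis by (simp add: L2_space_def case_prod_unfold)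
qed

lemma L2_product_sections:
  fixes v :: "'t \<Rightarrow> 'b \<Rightarrow> real"
  assumes fin: "finite_measure M1" "finite_measure M2"
    and v: "(\<lambda>(t, x). v t x) \<in> L2_space (M1 \<Otimes>\<^sub>M M2)"
  shows "AE t in M1. v t \<in> L2_space M2"
    and "integrable M1 (\<lambda>t. (Lq_norm 2 M2 (v t))\<^sup>2)"
    and "integrable M1 (\<lambda>t. Lq_norm 2 M2 (v t))"
    and "w \<in> L2_space M2 \<Longrightarrow> integrable (M1 \<Otimes>\<^sub>M M2) (\<lambda>(t, x). v t x * w x)"
    and "w \<in> L2_space M2 \<Longrightarrow> integrable M1 (\<lambda>t. \<integral>x. v t x * w x \<partial>M2)"
proof -
  interpret pair_sigma_finite M1 M2 using finite_pair_sigma_finite[OF fin] .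
  have i: "integrable (M1 \<Otimes>\<^sub>M M2) (\<lambda>(t, x). (norm (v t x))\<^sup>2)"
    using L2_spaceD(2)[OF v] by (simp add: case_prod_unfold)
  have vm: "(\<lambda>(t, x). v t x) \<in> borel_measurable (M1 \<Otimes>\<^sub>M M2)" using L2_spaceD(1)[OF v] .
  have m: "v t \<in> borel_measurable M2" if "t \<in> space M1" for t
    using measurable_compose[OF measurable_Pair1'[OF that] vm] by simp
  have "AE t in M1. t \<in> space M1" by (rule AE_space)
  with AE_integrable_fst'[OF i] show "AE t in M1. v t \<in> L2_space M2"
    by eventually_elim (use m in \<open>simp add: L2_space_def\<close>)
  show sq: "integrable M1 (\<lambda>t. (Lq_norm 2 M2 (v t))\<^sup>2)"
    using integrable_fst'[OF i] by (simp add: Lq_norm_2)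
  have "(\<lambda>t. sqrt ((Lq_norm 2 M2 (v t))\<^sup>2)) \<in> borel_measurable M1"
    using borel_measurable_integrable[OF sq] by measurable
  then have "(\<lambda>t. Lq_norm 2 M2 (v t)) \<in> borel_measurable M1" by (simp add: Lq_norm_nonneg)
  then have "(\<lambda>t. Lq_norm 2 M2 (v t)) \<in> L2_space M1" using sq by (simp add: L2_space_def Lq_norm_nonneg)
  then show "integrable M1 (\<lambda>t. Lq_norm 2 M2 (v t))"
    by (rule L2_space_finite_measure_integrable[OF fin(1)])
  assume w: "w \<in> L2_space M2"
  show vw: "integrable (M1 \<Otimes>\<^sub>M M2) (\<lambda>(t, x). v t x * w x)"
    using L2_mult_integrable[OF v L2_product_snd[OF fin w]] by (simp add: case_prod_unfold)
  show "integrable M1 (\<lambda>t. \<integral>x. v t x * w x \<partial>M2)"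
    using integrable_fst'[OF vw] by simp
qed

section \<open>The evolution identity\<close>

lemma integrable_lebesgue_on_subset:
  fixes f :: "'a::euclidean_space \<Rightarrow> real"
  assumes "integrable (lebesgue_on T) f" "S \<subseteq> T" "S \<in> sets lebesgue" "T \<in> sets lebesgue"
  shows "integrable (lebesgue_on S) f"
proof -
  have "integrable lebesgue (\<lambda>x. indicator T x *\<^sub>R f x)"
    using assms(1,4) by (simp add: integrable_restrict_space)
  then have "integrable lebesgue (\<lambda>x. indicator S x *\<^sub>R (indicator T x *\<^sub>R f x))"
    by (rule integrable_mult_indicator[OF assms(3)])
  moreover have "(\<lambda>x. indicator S x *\<^sub>R (indicator T x *\<^sub>R f x)) = (\<lambda>x. indicator S x *\<^sub>R f x)"
    using assms(2) by (auto simp: indicator_def fun_eq_iff)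
  ultimately show ?thesis using assms(3) by (simp add: integrable_restrict_space)
qed

text \<open>The extra point \<open>a\<close> will be the initial time: the solution is controlled on
  open intervals \<open>(0, T)\<close>, while increments are taken over closed intervals that may
  start at 0.\<close>

lemma integrable_lebesgue_on_insert:
  fixes f :: "real \<Rightarrow> real"
  assumes f: "integrable (lebesgue_on T) f" and ST: "S \<subseteq> insert a T"
    and S: "S \<in> sets lebesgue" and T: "T \<in> sets lebesgue"
  shows "integrable (lebesgue_on S) f"
proof -
  have "integrable lebesgue (\<lambda>x. indicator S x *\<^sub>R (indicator T x *\<^sub>R f x))"
    using f T by (intro integrable_mult_indicator[OF S]) (simp add: integrable_restrict_space)
  moreover have "integrable lebesgue (\<lambda>x. indicator (S \<inter> {a} - T) x *\<^sub>R f a)"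
  proof -
    have "S \<inter> {a} - T \<in> lmeasurable"
      using S T by (intro negligible_imp_measurable negligible_subset[OF negligible_sing[of a]]) auto
    then show ?thesis by (intro integrable_scaleR_left integrable_real_indicator) (auto simp: fmeasurable_def)
  qed
  ultimately have "integrable lebesgue (\<lambda>x. indicator S x *\<^sub>R (indicator T x *\<^sub>R f x) + indicator (S \<inter> {a} - T) x *\<^sub>R f a)"
    by (rule Bochner_Integration.integrable_add)
  moreover have "(\<lambda>x. indicator S x *\<^sub>R (indicator T x *\<^sub>R f x) + indicator (S \<inter> {a} - T) x *\<^sub>R f a) = (\<lambda>x. indicator S x *\<^sub>R f x)"
    using ST by (auto simp: fun_eq_iff indicator_def)
  ultimately show ?thesis using S by (simp add: integrable_restrict_space)
qed

lemma AE_lebesgue_on_subset: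
  assumes "AE x in lebesgue_on T. P x" "S \<subseteq> T" "S \<in> sets lebesgue" "T \<in> sets lebesgue"
  shows "AE x in lebesgue_on S. P x"
proof -
  have "AE x in lebesgue. x \<in> T \<longrightarrow> P x" using assms(1,4) by (simp add: AE_restrict_space_iff)
  then have "AE x in lebesgue. x \<in> S \<longrightarrow> P x" by eventually_elim (use assms(2) in auto)
  then show ?thesis using assms(3) by (simp add: AE_restrict_space_iff)
qed

lemma AE_lebesgue_on_insert:
  fixes a :: real
  assumes "AE x in lebesgue_on T. P x" "S \<subseteq> insert a T" "S \<in> sets lebesgue" "T \<in> sets lebesgue"
  shows "AE x in lebesgue_on S. P x"
proof -
  have "AE x in lebesgue. x \<in> T \<longrightarrow> P x" using assms(1,4) by (simp add: AE_restrict_space_iff)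
  moreover have "AE x in lebesgue. x \<notin> {a}" by (rule AE_not_in) simp
  ultimately have "AE x in lebesgue. x \<in> S \<longrightarrow> P x" by eventually_elim (use assms(2) in auto)
  then show ?thesis using assms(3) by (simp add: AE_restrict_space_iff)
qed

lemma Cauchy_Schwarz_two:
  fixes a b c d :: real
  shows "a * c + b * d \<le> sqrt (a\<^sup>2 + b\<^sup>2) * sqrt (c\<^sup>2 + d\<^sup>2)"
proof -
  have "(a\<^sup>2 + b\<^sup>2) * (c\<^sup>2 + d\<^sup>2) - (a * c + b * d)\<^sup>2 = (a * d - b * c)\<^sup>2"
    by (simp add: power2_eq_square algebra_simps)
  then have "(a * c + b * d)\<^sup>2 \<le> (a\<^sup>2 + b\<^sup>2) * (c\<^sup>2 + d\<^sup>2)"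
    using zero_le_power2[of "a * d - b * c"] by linarith
  then show ?thesis unfolding real_sqrt_mult[symmetric] by (rule real_le_rsqrt)
qed

lemma finite_lebesgue_on_interval:
  "finite_measure (lebesgue_on {a<..<b::real})" "finite_measure (lebesgue_on {a..b::real})"
  by (auto intro!: finite_measure_lebesgue_on)

section \<open>Increments of the solution against fixed functions\<close>

locale evolution = trace_setting \<Omega> \<Gamma>0 \<Gamma>1 for \<Omega> \<Gamma>0 \<Gamma>1 :: "'a::euclidean_space set" +
  fixes p :: real and u0 :: "'a \<Rightarrow> real" and Tmax :: ereal and u v vb :: "real \<Rightarrow> 'a \<Rightarrow> real"
  assumes p: "2 < p" and u0: "u0 \<in> H1_0 \<Omega> \<Gamma>0" and Tmax: "0 < Tmax"
    and sol: "weak_solution_upto \<Omega> \<Gamma>0 \<Gamma>1 p u0 Tmax u v vb"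
    and local: "local_properties \<Omega> \<Gamma>0 \<Gamma>1 p u0 Tmax u v vb"
begin

definition Dom :: "real set" where "Dom = {t. 0 \<le> t \<and> ereal t < Tmax}"

text \<open>The inner product of \<open>L2(\<Omega>)\<close> times \<open>L2(\<Gamma>1)\<close>,
  applied to functions paired with their traces. The problem is formally the gradient flow of
  \<open>J\<close> for it, the boundary condition supplying the second summand.\<close>

definition b :: "real \<Rightarrow> ('a \<Rightarrow> real) \<Rightarrow> real" where
  "b t w = (\<integral>x. u t x * w x \<partial>LO) + (\<integral>x. tr (u t) x * tr w x \<partial>MG)"

text \<open>The formal time derivative of \<open>b _ w\<close>.\<close>

definition r :: "real \<Rightarrow> ('a \<Rightarrow> real) \<Rightarrow> real" where
  "r \<tau> w = (\<integral>x. v \<tau> x * w x \<partial>LO) + (\<integral>x. vb \<tau> x * tr w x \<partial>MG)"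

definition D :: "real \<Rightarrow> real" where
  "D \<tau> = (norm_Om 2 \<Omega> (v \<tau>))\<^sup>2 + (Lq_norm 2 MG (vb \<tau>))\<^sup>2"

lemma Dom_mono: "t \<in> Dom \<Longrightarrow> 0 \<le> s \<Longrightarrow> s \<le> t \<Longrightarrow> s \<in> Dom"
  unfolding Dom_def using le_less_trans[of "ereal s" "ereal t" Tmax] by simp

lemma Dom_nonneg: "t \<in> Dom \<Longrightarrow> 0 \<le> t"
  by (simp add: Dom_def)

lemma Dom_later:
  assumes "t \<in> Dom"
  obtains T where "T \<in> Dom" "t < T"
proof -
  obtain T where "ereal t < ereal T" "ereal T < Tmax"
    using assms ereal_dense2[of "ereal t" Tmax] by (auto simp: Dom_def)
  then show ?thesis using that[of T] assms by (auto simp: Dom_def)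
qed

lemma zero_Dom: "0 \<in> Dom"
  using Tmax by (simp add: Dom_def zero_ereal_def)

lemma weak_sol: "0 < T \<Longrightarrow> T \<in> Dom \<Longrightarrow> weak_solution \<Omega> \<Gamma>0 \<Gamma>1 p u0 T u v vb"
  using sol by (auto simp: weak_solution_upto_def Dom_def)

lemma u_X0: "t \<in> Dom \<Longrightarrow> u t \<in> X0"
  and u_continuous: "t \<in> Dom \<Longrightarrow> ((\<lambda>\<tau>. H1_norm \<Omega> (\<lambda>x. u \<tau> x - u t x)) \<longlongrightarrow> 0) (at t within Dom)"
  using local by (auto simp: local_properties_def Dom_def)

lemma v_L2: "0 < T \<Longrightarrow> T \<in> Dom \<Longrightarrow> (\<lambda>(t, x). v t x) \<in> L2_space (lebesgue_on {0<..<T} \<Otimes>\<^sub>M LO)"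
  and vb_L2: "0 < T \<Longrightarrow> T \<in> Dom \<Longrightarrow> (\<lambda>(t, x). vb t x) \<in> L2_space (lebesgue_on {0<..<T} \<Otimes>\<^sub>M MG)"
  using local by (auto simp: local_properties_def Dom_def)

lemma J_u:
  assumes "t \<in> Dom"
  shows "J \<Omega> p (u t) = J \<Omega> p u0 - (\<integral>\<tau>. D \<tau> \<partial>lebesgue_on {0..t})"
proof -
  have "\<forall>t\<ge>0. ereal t < Tmax \<longrightarrow> J \<Omega> p (u t) - J \<Omega> p u0 = - (\<integral>\<tau>. D \<tau> \<partial>lebesgue_on {0..t})"
    using local unfolding local_properties_def D_def by (elim conjE)
  then show ?thesis using assms by (auto simp: Dom_def)
qed

lemma u_L2: "t \<in> Dom \<Longrightarrow> u t \<in> L2_space LO"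
  and tr_u_L2: "t \<in> Dom \<Longrightarrow> tr (u t) \<in> L2_space MG"
  using u_X0 H1_0_H1 H1_L2 tr_L2 by blast+

lemma u0_cong:
  "grad \<Omega> u0 = grad \<Omega> (u 0)" "tr u0 = tr (u 0)" "Lq_norm q LO u0 = Lq_norm q LO (u 0)"
proof -
  obtain T where T: "T \<in> Dom" "0 < T" using Dom_later[OF zero_Dom] .
  have ae: "AE x in LO. u 0 x = u0 x" using weak_sol[OF T(2,1)] by (simp add: weak_solution_def)
  have "u 0 \<in> H1 \<Omega>" "u0 \<in> H1 \<Omega>" using u_X0[OF zero_Dom] u0 H1_0_H1 by auto
  then show "grad \<Omega> u0 = grad \<Omega> (u 0)" "tr u0 = tr (u 0)" "Lq_norm q LO u0 = Lq_norm q LO (u 0)"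
    using H1_cong_AE[OF _ _ ae] trace_cong_AE[OF _ _ ae] Lq_norm_cong_AE[OF ae] H1_L2 L2_spaceD(1) by metis+
qed

lemma tendsto_norms:
  assumes t: "t \<in> Dom"
  shows "((\<lambda>\<tau>. Lq_norm 2 LO (\<lambda>x. u \<tau> x - u t x)) \<longlongrightarrow> 0) (at t within Dom)"
    and "((\<lambda>\<tau>. Lq_norm 2 LO (\<lambda>x. grad \<Omega> (u \<tau>) x - grad \<Omega> (u t) x)) \<longlongrightarrow> 0) (at t within Dom)"
    and "((\<lambda>\<tau>. Lq_norm 2 MG (\<lambda>x. tr (u \<tau>) x - tr (u t) x)) \<longlongrightarrow> 0) (at t within Dom)"
proof -
  note c = u_continuous[OF t]
  have ev: "\<forall>\<^sub>F \<tau> in at t within Dom. \<tau> \<in> Dom" by (simp add: eventually_at_filter)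
  show "((\<lambda>\<tau>. Lq_norm 2 LO (\<lambda>x. u \<tau> x - u t x)) \<longlongrightarrow> 0) (at t within Dom)"
    by (rule Lim_null_comparison[OF _ c]) (simp add: Lq_norm_nonneg norm_Om_le_H1_norm)
  have gd: "Lq_norm 2 LO (\<lambda>x. grad \<Omega> (u \<tau>) x - grad \<Omega> (u t) x) = norm_grad \<Omega> (\<lambda>x. u \<tau> x - u t x)" if "\<tau> \<in> Dom" for \<tau>
    using norm_grad_diff[OF H1_0_H1[OF u_X0[OF that]] H1_0_H1[OF u_X0[OF t]]] by simp
  show "((\<lambda>\<tau>. Lq_norm 2 LO (\<lambda>x. grad \<Omega> (u \<tau>) x - grad \<Omega> (u t) x)) \<longlongrightarrow> 0) (at t within Dom)"
  proof (rule Lim_null_comparison[OF _ c])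
    show "\<forall>\<^sub>F \<tau> in at t within Dom. norm (Lq_norm 2 LO (\<lambda>x. grad \<Omega> (u \<tau>) x - grad \<Omega> (u t) x)) \<le> H1_norm \<Omega> (\<lambda>x. u \<tau> x - u t x)"
      using ev by eventually_elim (simp add: gd Lq_norm_nonneg norm_grad_le_H1_norm)
  qed
  show "((\<lambda>\<tau>. Lq_norm 2 MG (\<lambda>x. tr (u \<tau>) x - tr (u t) x)) \<longlongrightarrow> 0) (at t within Dom)"
  proof (rule Lim_null_comparison)
    show "\<forall>\<^sub>F \<tau> in at t within Dom. norm (Lq_norm 2 MG (\<lambda>x. tr (u \<tau>) x - tr (u t) x)) \<le> sqrt CP * H1_norm \<Omega> (\<lambda>x. u \<tau> x - u t x)"
      using ev
    proof eventually_elim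
      case (elim \<tau>)
      have "(Lq_norm 2 MG (\<lambda>x. tr (u \<tau>) x - tr (u t) x))\<^sup>2 \<le> CP * (H1_norm \<Omega> (\<lambda>x. u \<tau> x - u t x))\<^sup>2"
        by (rule order_trans[OF trace_diff_bound[OF u_X0[OF elim] u_X0[OF t]]])
          (intro mult_left_mono power_mono norm_grad_le_H1_norm CP Lq_norm_nonneg)
      then have "Lq_norm 2 MG (\<lambda>x. tr (u \<tau>) x - tr (u t) x) \<le> sqrt (CP * (H1_norm \<Omega> (\<lambda>x. u \<tau> x - u t x))\<^sup>2)"
        by (rule real_le_rsqrt)
      then show ?case by (simp add: real_sqrt_mult H1_norm_nonneg Lq_norm_nonneg)
    qed
    show "((\<lambda>\<tau>. sqrt CP * H1_norm \<Omega> (\<lambda>x. u \<tau> x - u t x)) \<longlongrightarrow> 0) (at t within Dom)"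
      by (rule tendsto_mult_right_zero[OF c])
  qed
qed

lemma continuous_pairing:
  assumes "w \<in> L2_space LO"
  shows "continuous_on Dom (\<lambda>t. \<integral>x. u t x * w x \<partial>LO)"
  unfolding continuous_on_def
proof
  fix t assume t: "t \<in> Dom"
  show "((\<lambda>t. \<integral>x. u t x * w x \<partial>LO) \<longlongrightarrow> (\<integral>x. u t x * w x \<partial>LO)) (at t within Dom)"
    using L2_tendsto_inner[of Dom u LO "u t" "\<lambda>_. w" w, OF u_L2 u_L2[OF t] assms assms _ tendsto_norms(1)[OF t]]
    by (simp add: eventually_at_filter Lq_norm_2_sqrt)
qed

lemma continuous_trace_pairing:
  assumes "w \<in> L2_space MG"
  shows "continuous_on Dom (\<lambda>t. \<integral>x. tr (u t) x * w x \<partial>MG)"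
  unfolding continuous_on_def
proof
  fix t assume t: "t \<in> Dom"
  show "((\<lambda>t. \<integral>x. tr (u t) x * w x \<partial>MG) \<longlongrightarrow> (\<integral>x. tr (u t) x * w x \<partial>MG)) (at t within Dom)"
    using L2_tendsto_inner[of Dom "\<lambda>t. tr (u t)" MG "tr (u t)" "\<lambda>_. w" w, OF tr_u_L2 tr_u_L2[OF t] assms assms _ tendsto_norms(3)[OF t]]
    by (simp add: eventually_at_filter Lq_norm_2_sqrt)
qed

text \<open>Extension by zero carries \<open>infinite_boundary\<close> over to functions given on
  \<open>\<Gamma>1\<close> only. On a boundary of infinite measure every boundary term then drops
  out.\<close>

lemma L2_MG_vanish:
  assumes inf: "\<not> finite_measure MF" and h: "h \<in> L2_space MG"
  shows "Lq_norm 2 MG h = (0::real)" "AE x in MG. h x = (0::real)"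
proof -
  let ?h = "\<lambda>x. indicator \<Gamma>1 x * h x"
  have G: "\<Gamma>1 \<inter> space MF \<in> sets MF" using Gam1_measurable by simp
  have "?h \<in> borel_measurable MF"
    using L2_spaceD(1)[OF h] unfolding MG_restrict by (simp add: borel_measurable_restrict_space_iff[OF G])
  moreover have "integrable MF (\<lambda>x. indicator \<Gamma>1 x *\<^sub>R (norm (h x))\<^sup>2)"
    using L2_spaceD(2)[OF h] unfolding MG_restrict by (simp only: integrable_restrict_space[OF G])
  moreover have "(\<lambda>x. indicator \<Gamma>1 x *\<^sub>R (norm (h x))\<^sup>2) = (\<lambda>x. (norm (?h x))\<^sup>2)"
    by (auto simp: indicator_def fun_eq_iff)
  ultimately have "?h \<in> L2_space MF" by (simp add: L2_space_def)
  then have "Lq_norm 2 MG ?h = 0" by (rule infinite_boundary[OF inf])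
  moreover have "Lq_norm 2 MG ?h = Lq_norm 2 MG h"
    unfolding Lq_norm_2_sqrt
    by (intro arg_cong[where f=sqrt] Bochner_Integration.integral_cong) (auto simp: surf_def space_restrict_space)
  ultimately show "Lq_norm 2 MG h = 0" by simp
  then show "AE x in MG. h x = 0" using L2_norm_eq_0_iff[OF h] by simp
qed

lemma finite_MG: "finite_measure MF \<Longrightarrow> finite_measure MG"
  unfolding MG_restrict using Gam1_measurable by (intro finite_measure_restrict_space) auto

text \<open>Instead of approximating \<open>w\<close> by test functions, Fubini moves the time
  integral of \<open>v\<close> inside. The resulting function \<open>V\<close> equals
  \<open>u t - u s\<close> almost everywhere, because both have the same integrals against test
  functions, and the identity can then be paired with any square integrable
  \<open>w\<close>.\<close>

lemma interior_increment:
  assumes st: "0 < s" "s \<le> t" "t < T" and T: "T \<in> Dom" and w: "w \<in> L2_space LO"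
  shows "(\<integral>x. u t x * w x \<partial>LO) - (\<integral>x. u s x * w x \<partial>LO) = (\<integral>\<tau>. (\<integral>x. v \<tau> x * w x \<partial>LO) \<partial>lebesgue_on {s..t})"
proof -
  let ?L = "lebesgue_on {0<..<T}"
  have T0: "0 < T" using st by simp
  note finL = finite_lebesgue_on_interval(1)[of 0 T]
  interpret P: pair_sigma_finite ?L LO using finite_pair_sigma_finite[OF finL finite_LO] .
  note vL = v_L2[OF T0 T]
  \<comment> \<open>Cutting \<open>v\<close> off in time keeps Fubini on the fixed product over
    \<open>(0, T)\<close>.\<close>
  define v' where "v' \<tau> x = indicator {s<..t} \<tau> * v \<tau> x" for \<tau> x
  have ind: "(indicator {s<..t} :: real \<Rightarrow> real) \<in> borel_measurable ?L"
    by (rule measurable_restrict_space1) (simp add: measurable_completion)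
  have v'L: "(\<lambda>(\<tau>, x). v' \<tau> x) \<in> L2_space (?L \<Otimes>\<^sub>M LO)"
  proof -
    have m: "(\<lambda>(\<tau>, x). v' \<tau> x) \<in> borel_measurable (?L \<Otimes>\<^sub>M LO)"
      unfolding v'_def case_prod_unfold using L2_spaceD(1)[OF vL] ind by (simp add: case_prod_unfold)
    have "integrable (?L \<Otimes>\<^sub>M LO) (\<lambda>z. (norm (case z of (\<tau>, x) \<Rightarrow> v' \<tau> x))\<^sup>2)"
      by (rule Bochner_Integration.integrable_bound[OF L2_spaceD(2)[OF vL]])
        (use m in \<open>auto simp: v'_def indicator_def\<close>)
    then show ?thesis using m by (simp add: L2_space_def)
  qed
  define V where "V x = (\<integral>\<tau>. v' \<tau> x \<partial>?L)" for x
  have swap: "(\<integral>\<tau>. (\<integral>x. v \<tau> x * z x \<partial>LO) \<partial>lebesgue_on {s..t}) = (\<integral>x. V x * z x \<partial>LO)" if z: "z \<in> L2_space LO" for z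
  proof -
    have "(\<integral>\<tau>. (\<integral>x. v \<tau> x * z x \<partial>LO) \<partial>lebesgue_on {s..t}) = (\<integral>\<tau>. indicator {s<..t} \<tau> * (\<integral>x. v \<tau> x * z x \<partial>LO) \<partial>?L)"
      by (rule integral_half_open[OF st, symmetric]) (use L2_product_sections(5)[OF finL finite_LO vL z] in simp)
    also have "\<dots> = (\<integral>\<tau>. (\<integral>x. v' \<tau> x * z x \<partial>LO) \<partial>?L)"
      by (simp add: v'_def mult.assoc)
    also have "\<dots> = (\<integral>x. (\<integral>\<tau>. v' \<tau> x * z x \<partial>?L) \<partial>LO)"
      by (rule P.Fubini_integral[symmetric, OF L2_product_sections(4)[OF finL finite_LO v'L z]])
    also have "\<dots> = (\<integral>x. V x * z x \<partial>LO)" by (simp add: V_def)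
    finally show ?thesis .
  qed
  have "integrable (?L \<Otimes>\<^sub>M LO) (\<lambda>(\<tau>, x). v' \<tau> x)"
    by (rule L2_space_finite_measure_integrable[OF finite_pair_measure[OF finL finite_LO] v'L])
  then have iV: "integrable LO V" unfolding V_def[abs_def] by (rule P.integrable_snd)
  have sD: "s \<in> Dom" "t \<in> Dom" using st T Dom_mono by auto
  note uL = u_L2[OF sD(1)] u_L2[OF sD(2)]
  have sub: "{0<..<T} \<subseteq> Dom" using Dom_mono[OF T] by auto
  have "AE x in LO. (u t x - u s x) - V x = 0"
  proof (rule AE_zero_if_test_integrals_zero)
    note i = L2_LO_integrable[OF uL(2)] L2_LO_integrable[OF uL(1)] iV
    show "integrable LO (\<lambda>x. (u t x - u s x) - V x)" using i by simp
    fix \<phi> assume \<phi>: "\<phi> \<in> test_fun \<Omega>"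
    have \<phi>L: "\<phi> \<in> L2_space LO" by (intro L2_smooth smooth_continuous_on test_fun_smooth[OF \<phi>])
    have "time_deriv T \<Omega> LO u v" using weak_sol[OF T0 T] by (simp add: weak_solution_def)
    then have "(\<integral>x. u t x * \<phi> x \<partial>LO) - (\<integral>x. u s x * \<phi> x \<partial>LO) = (\<integral>\<tau>. (\<integral>x. v \<tau> x * \<phi> x \<partial>LO) \<partial>lebesgue_on {s..t})"
      by (rule time_deriv_increment[OF _ \<phi> continuous_on_subset[OF continuous_pairing[OF \<phi>L] sub]
            L2_product_sections(5)[OF finL finite_LO vL \<phi>L] st])
    also have "\<dots> = (\<integral>x. V x * \<phi> x \<partial>LO)" by (rule swap[OF \<phi>L])
    finally show "(\<integral>x. ((u t x - u s x) - V x) * \<phi> x \<partial>LO) = 0"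
      using i[THEN integrable_mult_test_fun[OF _ \<phi>]] by (simp add: left_diff_distrib)
  qed
  then have "(\<integral>x. (u t x - u s x) * w x \<partial>LO) = (\<integral>x. V x * w x \<partial>LO)"
    by (intro integral_cong_AE)
      (use L2_spaceD(1)[OF uL(1)] L2_spaceD(1)[OF uL(2)] L2_spaceD(1)[OF w] iV in \<open>auto elim: eventually_mono\<close>)
  then show ?thesis
    using L2_mult_integrable[OF uL(1) w] L2_mult_integrable[OF uL(2) w] swap[OF w] by (simp add: left_diff_distrib)
qed

text \<open>A cutoff equal to 1 on \<open>\<Gamma>1\<close> and 0 on \<open>\<Gamma>0\<close> turns
  integrals over the whole boundary into integrals over \<open>\<Gamma>1\<close>, the part that
  enters \<open>b\<close> and \<open>r\<close>.\<close>

lemma boundary_increment_smooth: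
  assumes st: "0 < s" "s \<le> t" "t < T" and T: "T \<in> Dom" and \<phi>: "smooth \<phi>" and fin: "finite_measure MF"
  shows "(\<integral>x. tr (u t) x * \<phi> x \<partial>MG) - (\<integral>x. tr (u s) x * \<phi> x \<partial>MG)
    = (\<integral>\<tau>. (\<integral>x. vb \<tau> x * \<phi> x \<partial>MG) \<partial>lebesgue_on {s..t})"
proof -
  have T0: "0 < T" using st by simp
  note finL = finite_lebesgue_on_interval(1)[of 0 T]
  obtain \<theta> where \<theta>: "\<theta> \<in> test_fun (UNIV :: 'a set)" "\<And>x. x \<in> \<Gamma>1 \<Longrightarrow> \<theta> x = 1" "\<And>x. x \<in> \<Gamma>0 \<Longrightarrow> \<theta> x = 0"
    using smooth_cutoff[OF compact_Gam1 closed_Gam0] boundary_parts(2) by (metis Int_commute)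
  have test: "(\<lambda>x. \<theta> x * \<phi> x) \<in> test_fun UNIV"
  proof -
    obtain C where C: "compact C" "\<forall>x. x \<notin> C \<longrightarrow> \<theta> x = 0" using \<theta>(1) by (auto simp: test_fun_def)
    show ?thesis
      by (rule test_funI[OF smooth_mult[OF test_fun_smooth[OF \<theta>(1)] \<phi>] C(1)]) (use C in auto)
  qed
  have loc: "(\<integral>x. h x * (\<theta> x * \<phi> x) \<partial>MF) = (\<integral>x. h x * \<phi> x \<partial>MG)" for h
    unfolding integral_MG
  proof (rule Bochner_Integration.integral_cong[OF refl])
    fix x assume "x \<in> space MF"
    then have "x \<in> \<Gamma>0 \<union> \<Gamma>1" using boundary_parts(1) by (auto simp: surf_def space_restrict_space)
    then show "h x * (\<theta> x * \<phi> x) = indicator \<Gamma>1 x * (h x * \<phi> x)"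
      using \<theta>(2,3) boundary_parts(2) by (auto simp: indicator_def)
  qed
  have \<phi>L: "\<phi> \<in> L2_space MG" by (rule L2_MG[OF smooth_L2_MF[OF fin \<phi>]])
  have sub: "{0<..<T} \<subseteq> Dom" using Dom_mono[OF T] by auto
  have td: "time_deriv T UNIV MF (\<lambda>t. tr (u t)) vb" using weak_sol[OF T0 T] by (simp add: weak_solution_def)
  have "(\<integral>x. tr (u t) x * (\<theta> x * \<phi> x) \<partial>MF) - (\<integral>x. tr (u s) x * (\<theta> x * \<phi> x) \<partial>MF)
    = (\<integral>\<tau>. (\<integral>x. vb \<tau> x * (\<theta> x * \<phi> x) \<partial>MF) \<partial>lebesgue_on {s..t})"
    by (rule time_deriv_increment[OF td test _ _ st])
      (simp_all only: loc continuous_on_subset[OF continuous_trace_pairing[OF \<phi>L] sub]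
        L2_product_sections(5)[OF finL finite_MG[OF fin] vb_L2[OF T0 T] \<phi>L])
  then show ?thesis by (simp only: loc)
qed

text \<open>By definition \<open>tr w\<close> is an L2 limit of smooth functions. The error in the
  time integral is at most \<open>e k\<close> times the integral of the norm of
  \<open>vb\<close>.\<close>

lemma boundary_increment:
  assumes st: "0 < s" "s \<le> t" "t < T" and T: "T \<in> Dom" and w: "w \<in> X0" and fin: "finite_measure MF"
  shows "(\<integral>x. tr (u t) x * tr w x \<partial>MG) - (\<integral>x. tr (u s) x * tr w x \<partial>MG)
    = (\<integral>\<tau>. (\<integral>x. vb \<tau> x * tr w x \<partial>MG) \<partial>lebesgue_on {s..t})"
proof -
  have T0: "0 < T" using st by simp
  note finL = finite_lebesgue_on_interval(1)[of 0 T] and finG = finite_MG[OF fin]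
  note vL = L2_product_sections[OF finL finG vb_L2[OF T0 T]]
  have sD: "s \<in> Dom" "t \<in> Dom" using st T Dom_mono by auto
  have sub: "{s..t} \<subseteq> {0<..<T}" using st by auto
  note isub = integrable_lebesgue_on_subset[OF _ sub]
  obtain \<phi> where \<phi>: "\<And>k. smooth (\<phi> k)" and lim: "(\<lambda>k. Lq_norm 2 MF (\<lambda>x. \<phi> k x - tr w x)) \<longlonglongrightarrow> 0"
    using bd_trace_is_trace[OF w] by (auto simp: is_trace_def)
  have trF: "tr w \<in> L2_space MF" using is_traceD(2)[OF bd_trace_is_trace[OF w]] .
  have \<phi>F: "\<phi> k \<in> L2_space MF" for k by (rule smooth_L2_MF[OF fin \<phi>])
  define e where "e k = Lq_norm 2 MG (\<lambda>x. \<phi> k x - tr w x)" for k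
  have e: "e \<longlonglongrightarrow> 0"
    by (rule Lim_null_comparison[OF _ lim])
      (simp add: e_def Lq_norm_nonneg norm_MG_le L2_space_diff \<phi>F trF)
  note \<phi>G = L2_MG[OF \<phi>F] and wG = tr_L2[OF w]
  have l: "(\<lambda>k. \<integral>x. tr (u t) x * \<phi> k x \<partial>MG) \<longlonglongrightarrow> (\<integral>x. tr (u t) x * tr w x \<partial>MG)" if "t \<in> Dom" for t
  proof -
    have "(\<lambda>k. \<integral>x. tr (u t) x \<bullet> \<phi> k x \<partial>MG) \<longlonglongrightarrow> (\<integral>x. tr (u t) x \<bullet> tr w x \<partial>MG)"
      by (rule L2_tendsto_inner[of UNIV]) (use tr_u_L2[OF that] \<phi>G wG e[unfolded e_def] in \<open>auto simp: Lq_norm_2_sqrt\<close>)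
    then show ?thesis by simp
  qed
  have "(\<lambda>k. \<integral>\<tau>. (\<integral>x. vb \<tau> x * \<phi> k x \<partial>MG) \<partial>lebesgue_on {s..t})
    \<longlonglongrightarrow> (\<integral>\<tau>. (\<integral>x. vb \<tau> x * tr w x \<partial>MG) \<partial>lebesgue_on {s..t})"
  proof (rule LIM_zero_cancel, rule Lim_null_comparison)
    have ae: "AE \<tau> in lebesgue_on {s..t}. vb \<tau> \<in> L2_space MG"
      by (rule AE_lebesgue_on_subset[OF vL(1) sub]) auto
    have i1: "integrable (lebesgue_on {s..t}) (\<lambda>\<tau>. \<integral>x. vb \<tau> x * \<phi> k x \<partial>MG)" for k by (rule isub[OF vL(5)[OF \<phi>G]]) auto
    have i2: "integrable (lebesgue_on {s..t}) (\<lambda>\<tau>. \<integral>x. vb \<tau> x * tr w x \<partial>MG)" by (rule isub[OF vL(5)[OF wG]]) auto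
    have i3: "integrable (lebesgue_on {s..t}) (\<lambda>\<tau>. Lq_norm 2 MG (vb \<tau>))" by (rule isub[OF vL(3)]) auto
    show "\<forall>\<^sub>F k in sequentially. norm ((\<integral>\<tau>. (\<integral>x. vb \<tau> x * \<phi> k x \<partial>MG) \<partial>lebesgue_on {s..t})
        - (\<integral>\<tau>. (\<integral>x. vb \<tau> x * tr w x \<partial>MG) \<partial>lebesgue_on {s..t}))
        \<le> (\<integral>\<tau>. Lq_norm 2 MG (vb \<tau>) \<partial>lebesgue_on {s..t}) * e k"
    proof (intro always_eventually allI)
      fix k
      have "norm ((\<integral>\<tau>. (\<integral>x. vb \<tau> x * \<phi> k x \<partial>MG) \<partial>lebesgue_on {s..t}) - (\<integral>\<tau>. (\<integral>x. vb \<tau> x * tr w x \<partial>MG) \<partial>lebesgue_on {s..t}))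
        = norm (\<integral>\<tau>. (\<integral>x. vb \<tau> x * \<phi> k x \<partial>MG) - (\<integral>x. vb \<tau> x * tr w x \<partial>MG) \<partial>lebesgue_on {s..t})"
        using i1 i2 by simp
      also have "\<dots> \<le> (\<integral>\<tau>. norm ((\<integral>x. vb \<tau> x * \<phi> k x \<partial>MG) - (\<integral>x. vb \<tau> x * tr w x \<partial>MG)) \<partial>lebesgue_on {s..t})"
        by (rule integral_norm_bound)
      also have "\<dots> \<le> (\<integral>\<tau>. Lq_norm 2 MG (vb \<tau>) * e k \<partial>lebesgue_on {s..t})"
      proof (rule integral_mono_AE)
        show "AE \<tau> in lebesgue_on {s..t}. norm ((\<integral>x. vb \<tau> x * \<phi> k x \<partial>MG) - (\<integral>x. vb \<tau> x * tr w x \<partial>MG)) \<le> Lq_norm 2 MG (vb \<tau>) * e k"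
          using ae
        proof eventually_elim
          case (elim \<tau>)
          have "(\<integral>x. vb \<tau> x * \<phi> k x \<partial>MG) - (\<integral>x. vb \<tau> x * tr w x \<partial>MG) = (\<integral>x. vb \<tau> x \<bullet> (\<phi> k x - tr w x) \<partial>MG)"
            using L2_mult_integrable[OF elim \<phi>G] L2_mult_integrable[OF elim wG] by (simp add: right_diff_distrib)
          then show ?case using L2_Cauchy_Schwarz[OF elim L2_space_diff[OF \<phi>G[of k] wG]] by (simp add: e_def)
        qed
      qed (use i1 i2 i3 in auto)
      finally show "norm ((\<integral>\<tau>. (\<integral>x. vb \<tau> x * \<phi> k x \<partial>MG) \<partial>lebesgue_on {s..t}) - (\<integral>\<tau>. (\<integral>x. vb \<tau> x * tr w x \<partial>MG) \<partial>lebesgue_on {s..t}))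
        \<le> (\<integral>\<tau>. Lq_norm 2 MG (vb \<tau>) \<partial>lebesgue_on {s..t}) * e k" using i3 by simp
    qed
    show "(\<lambda>k. (\<integral>\<tau>. Lq_norm 2 MG (vb \<tau>) \<partial>lebesgue_on {s..t}) * e k) \<longlonglongrightarrow> 0"
      by (rule tendsto_mult_right_zero[OF e])
  qed
  moreover have "(\<lambda>k. (\<integral>x. tr (u t) x * \<phi> k x \<partial>MG) - (\<integral>x. tr (u s) x * \<phi> k x \<partial>MG))
    \<longlonglongrightarrow> (\<integral>x. tr (u t) x * tr w x \<partial>MG) - (\<integral>x. tr (u s) x * tr w x \<partial>MG)"
    by (intro tendsto_diff l sD)
  ultimately show ?thesis
    unfolding boundary_increment_smooth[OF st T \<phi> fin] by (rule LIMSEQ_unique[rotated])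
qed

lemma boundary_zero:
  assumes "\<not> finite_measure MF" "w \<in> X0"
  shows "(\<integral>x. h x * tr w x \<partial>MG) = 0"
  by (rule integral_eq_zero_AE) (use L2_MG_vanish(2)[OF assms(1) tr_L2[OF assms(2)]] in \<open>auto elim: eventually_mono\<close>)

lemma r_integrable_open:
  assumes T: "0 < T" "T \<in> Dom" and w: "w \<in> X0"
  shows "integrable (lebesgue_on {0<..<T}) (\<lambda>\<tau>. r \<tau> w)"
proof -
  note finL = finite_lebesgue_on_interval(1)[of 0 T]
  have 1: "integrable (lebesgue_on {0<..<T}) (\<lambda>\<tau>. \<integral>x. v \<tau> x * w x \<partial>LO)"
    by (rule L2_product_sections(5)[OF finL finite_LO v_L2[OF T] H1_L2[OF H1_0_H1[OF w]]])
  have 2: "integrable (lebesgue_on {0<..<T}) (\<lambda>\<tau>. \<integral>x. vb \<tau> x * tr w x \<partial>MG)"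
  proof (cases "finite_measure MF")
    case True
    show ?thesis by (rule L2_product_sections(5)[OF finL finite_MG[OF True] vb_L2[OF T] tr_L2[OF w]])
  qed (simp add: boundary_zero w)
  show ?thesis unfolding r_def using 1 2 by simp
qed

lemma D_integrable_open:
  assumes T: "0 < T" "T \<in> Dom"
  shows "integrable (lebesgue_on {0<..<T}) D"
proof -
  note finL = finite_lebesgue_on_interval(1)[of 0 T]
  have 1: "integrable (lebesgue_on {0<..<T}) (\<lambda>\<tau>. (norm_Om 2 \<Omega> (v \<tau>))\<^sup>2)"
    by (rule L2_product_sections(2)[OF finL finite_LO v_L2[OF T]])
  have 2: "integrable (lebesgue_on {0<..<T}) (\<lambda>\<tau>. (Lq_norm 2 MG (vb \<tau>))\<^sup>2)"
  proof (cases "finite_measure MF")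
    case True
    show ?thesis by (rule L2_product_sections(2)[OF finL finite_MG[OF True] vb_L2[OF T]])
  next
    case False
    \<comment> \<open>For an infinite boundary measure Fubini is bypassed: a section is either
      square integrable, hence zero by \<open>L2_MG_vanish\<close>, or its integral has the default
      value 0.\<close>
    have "(Lq_norm 2 MG (vb \<tau>))\<^sup>2 = 0" if "\<tau> \<in> space (lebesgue_on {0<..<T})" for \<tau>
    proof (cases "integrable MG (\<lambda>x. (norm (vb \<tau> x))\<^sup>2)")
      case True
      have "vb \<tau> \<in> borel_measurable MG"
        using measurable_compose[OF measurable_Pair1'[OF that] L2_spaceD(1)[OF vb_L2[OF T]]] by simp
      then show ?thesis using True L2_MG_vanish(1)[OF False] by (simp add: L2_space_def)
    qed (simp add: Lq_norm_2 not_integrable_integral_eq)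
    then show ?thesis by (subst Bochner_Integration.integrable_cong[OF refl, of _ _ "\<lambda>_. 0"]) auto
  qed
  have "integrable (lebesgue_on {0<..<T}) (\<lambda>\<tau>. (norm_Om 2 \<Omega> (v \<tau>))\<^sup>2 + (Lq_norm 2 MG (vb \<tau>))\<^sup>2)"
    using 1 2 by simp
  then show ?thesis by (simp add: D_def[abs_def])
qed

lemma integrable_closed:
  assumes "\<And>T. 0 < T \<Longrightarrow> T \<in> Dom \<Longrightarrow> integrable (lebesgue_on {0<..<T}) (f :: real \<Rightarrow> real)" and t: "t \<in> Dom" and s: "0 \<le> s"
  shows "integrable (lebesgue_on {s..t}) f"
proof -
  obtain T where T: "T \<in> Dom" "t < T" using Dom_later[OF t] .
  have T0: "0 < T" using Dom_nonneg[OF t] T by simp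
  have "{s..t} - {0<..<T} \<subseteq> {0}" using T s by auto
  then show ?thesis by (intro integrable_lebesgue_on_insert[OF assms(1)[OF T0 T(1)], of _ 0]) auto
qed

lemma r_integrable: "w \<in> X0 \<Longrightarrow> t \<in> Dom \<Longrightarrow> 0 \<le> s \<Longrightarrow> integrable (lebesgue_on {s..t}) (\<lambda>\<tau>. r \<tau> w)"
  by (rule integrable_closed[OF r_integrable_open])

lemma D_integrable: "t \<in> Dom \<Longrightarrow> 0 \<le> s \<Longrightarrow> integrable (lebesgue_on {s..t}) D"
  by (rule integrable_closed[OF D_integrable_open])

lemma b_increment_pos:
  assumes st: "0 < s" "s \<le> t" "t \<in> Dom" and w: "w \<in> X0"
  shows "b t w - b s w = (\<integral>\<tau>. r \<tau> w \<partial>lebesgue_on {s..t})"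
proof -
  obtain T where T: "T \<in> Dom" "t < T" using Dom_later[OF st(3)] .
  have T0: "0 < T" using st T by simp
  have sub: "{s..t} \<subseteq> {0<..<T}" using st T by auto
  note finL = finite_lebesgue_on_interval(1)[of 0 T] and isub = integrable_lebesgue_on_subset[OF _ sub]
  have wL: "w \<in> L2_space LO" using w H1_0_H1 H1_L2 by blast
  have i: "integrable (lebesgue_on {s..t}) (\<lambda>\<tau>. \<integral>x. v \<tau> x * w x \<partial>LO)"
    by (rule isub[OF L2_product_sections(5)[OF finL finite_LO v_L2[OF T0 T(1)] wL]]) auto
  show ?thesis
  proof (cases "finite_measure MF")
    case True
    have "integrable (lebesgue_on {s..t}) (\<lambda>\<tau>. \<integral>x. vb \<tau> x * tr w x \<partial>MG)"
      by (rule isub[OF L2_product_sections(5)[OF finL finite_MG[OF True] vb_L2[OF T0 T(1)] tr_L2[OF w]]]) auto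
    then show ?thesis
      unfolding b_def r_def using i interior_increment[OF st(1,2) T(2,1) wL] boundary_increment[OF st(1,2) T(2,1) w True] by simp
  next
    case False
    then show ?thesis
      unfolding b_def r_def using interior_increment[OF st(1,2) T(2,1) wL] by (simp add: boundary_zero w)
  qed
qed

text \<open>Passing to the gauge integral supplies additivity over adjacent intervals and continuity
  of the antiderivative.\<close>

lemma integral_lebesgue_on_closed:
  assumes f: "\<And>T. 0 < T \<Longrightarrow> T \<in> Dom \<Longrightarrow> integrable (lebesgue_on {0<..<T}) (f :: real \<Rightarrow> real)" and t: "t \<in> Dom" and s: "0 \<le> s" "s \<le> t"
  shows "(\<integral>\<tau>. f \<tau> \<partial>lebesgue_on {s..t}) = integral {0..t} f - integral {0..s} f"
    and "continuous_on {0..t} (\<lambda>x. integral {0..x} f)"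
proof -
  have i: "f integrable_on {0..t}"
    using integrable_on_lebesgue_on[OF integrable_closed[OF f t order_refl]] by simp
  have "(\<integral>\<tau>. f \<tau> \<partial>lebesgue_on {s..t}) = integral {s..t} f"
    by (rule lebesgue_integral_eq_integral[OF integrable_closed[OF f t s(1)]]) auto
  then show "(\<integral>\<tau>. f \<tau> \<partial>lebesgue_on {s..t}) = integral {0..t} f - integral {0..s} f"
    using Henstock_Kurzweil_Integration.integral_combine[OF s i] by simp
  show "continuous_on {0..t} (\<lambda>x. integral {0..x} f)"
    by (rule indefinite_integral_continuous_1[OF i])
qed

lemma b_continuous: "w \<in> X0 \<Longrightarrow> continuous_on Dom (\<lambda>t. b t w)"
  unfolding b_def
  by (intro continuous_on_add continuous_pairing continuous_trace_pairing tr_L2 H1_L2 H1_0_H1)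

text \<open>Distributional derivatives see only positive times. The start at 0 is reached by
  continuity: \<open>b\<close> minus the antiderivative of \<open>r\<close> is constant on
  \<open>(0, t]\<close> and continuous up to 0.\<close>

lemma b_increment:
  assumes st: "0 \<le> s" "s \<le> t" "t \<in> Dom" and w: "w \<in> X0"
  shows "b t w - b s w = (\<integral>\<tau>. r \<tau> w \<partial>lebesgue_on {s..t})"
proof (cases "s = t \<or> 0 < s")
  case True
  show ?thesis
  proof (cases "0 < s")
    case True
    then show ?thesis using b_increment_pos[OF True st(2,3) w] by simp
  next
    case False
    then show ?thesis
      using True integral_lebesgue_on_closed(1)[OF r_integrable_open[OF _ _ w] st(3,1,2)] by simp
  qed
next
  case False
  then have s0: "s = 0" "0 < t" using st by auto
  define F where "F x = b x w - integral {0..x} (\<lambda>\<tau>. r \<tau> w)" for x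
  have "{0..t} \<subseteq> Dom" using Dom_mono[OF st(3)] by auto
  then have c: "continuous_on {0..t} F"
    unfolding F_def
    by (intro continuous_on_diff continuous_on_subset[OF b_continuous[OF w]]
        integral_lebesgue_on_closed(2)[OF r_integrable_open[OF _ _ w] st(3) order_refl]) (use s0 in auto)
  have "F x = F t" if "x \<in> {0<..t}" for x
  proof -
    have x: "0 < x" "0 \<le> x" "x \<le> t" using that by auto
    show ?thesis
      using b_increment_pos[OF x(1,3) st(3) w] integral_lebesgue_on_closed(1)[OF r_integrable_open[OF _ _ w] st(3) x(2,3)]
      unfolding F_def by linarith
  qed
  note F = this
  have cl: "closure {0<..<t} = {0..t}" using s0 by simp
  have "F 0 = F t"
  proof (rule continuous_constant_on_closure[where f=F and a="F t" and x=0 and S="{0<..<t}"])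
    show "continuous_on (closure {0<..<t}) F" unfolding cl by (rule c)
    show "F x = F t" if "x \<in> {0<..<t}" for x using that by (intro F) auto
    show "0 \<in> closure {0<..<t}" unfolding cl using s0 by simp
  qed
  then show ?thesis
    using integral_lebesgue_on_closed(1)[OF r_integrable_open[OF _ _ w] st(3), of 0] s0 by (simp add: F_def)
qed

text \<open>Cauchy-Schwarz twice, first in each of the two L2 spaces and then for the pairs of
  norms. The difference of the two chosen traces appears, since \<open>r\<close> is evaluated at
  \<open>w\<close> and \<open>w'\<close> separately.\<close>

lemma r_diff_bound:
  assumes T: "T \<in> Dom" and w: "w \<in> X0" "w' \<in> X0"
  shows "AE \<tau> in lebesgue_on {0<..<T}. \<bar>r \<tau> w - r \<tau> w'\<bar> \<le>
    sqrt (D \<tau>) * sqrt ((Lq_norm 2 LO (\<lambda>x. w x - w' x))\<^sup>2 + (Lq_norm 2 MG (\<lambda>x. tr w x - tr w' x))\<^sup>2)"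
proof (cases "0 < T")
  case True
  note finL = finite_lebesgue_on_interval(1)[of 0 T]
  note wL = w[THEN H1_0_H1, THEN H1_L2] and wG = w[THEN tr_L2]
  have 1: "AE \<tau> in lebesgue_on {0<..<T}. v \<tau> \<in> L2_space LO"
    by (rule L2_product_sections(1)[OF finL finite_LO v_L2[OF True T]])
  have 2: "AE \<tau> in lebesgue_on {0<..<T}. \<bar>(\<integral>x. vb \<tau> x * tr w x \<partial>MG) - (\<integral>x. vb \<tau> x * tr w' x \<partial>MG)\<bar>
      \<le> Lq_norm 2 MG (vb \<tau>) * Lq_norm 2 MG (\<lambda>x. tr w x - tr w' x)"
  proof (cases "finite_measure MF")
    case fin: True
    have "AE \<tau> in lebesgue_on {0<..<T}. vb \<tau> \<in> L2_space MG"
      by (rule L2_product_sections(1)[OF finL finite_MG[OF fin] vb_L2[OF True T]])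
    then show ?thesis
    proof eventually_elim
      case (elim \<tau>)
      have "(\<integral>x. vb \<tau> x * tr w x \<partial>MG) - (\<integral>x. vb \<tau> x * tr w' x \<partial>MG) = (\<integral>x. vb \<tau> x \<bullet> (tr w x - tr w' x) \<partial>MG)"
        using L2_mult_integrable[OF elim wG(1)] L2_mult_integrable[OF elim wG(2)] by (simp add: right_diff_distrib)
      then show ?case using L2_Cauchy_Schwarz[OF elim L2_space_diff[OF wG]] by simp
    qed
  qed (simp add: boundary_zero w Lq_norm_nonneg)
  show ?thesis
    using 1 2
  proof eventually_elim
    case (elim \<tau>)
    let ?a = "Lq_norm 2 LO (v \<tau>)" and ?b = "Lq_norm 2 MG (vb \<tau>)"
      and ?c = "Lq_norm 2 LO (\<lambda>x. w x - w' x)" and ?d = "Lq_norm 2 MG (\<lambda>x. tr w x - tr w' x)"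
    have "(\<integral>x. v \<tau> x * w x \<partial>LO) - (\<integral>x. v \<tau> x * w' x \<partial>LO) = (\<integral>x. v \<tau> x \<bullet> (w x - w' x) \<partial>LO)"
      using L2_mult_integrable[OF elim(1) wL(1)] L2_mult_integrable[OF elim(1) wL(2)] by (simp add: right_diff_distrib)
    then have "\<bar>(\<integral>x. v \<tau> x * w x \<partial>LO) - (\<integral>x. v \<tau> x * w' x \<partial>LO)\<bar> \<le> ?a * ?c"
      using L2_Cauchy_Schwarz[OF elim(1) L2_space_diff[OF wL]] by simp
    then have "\<bar>r \<tau> w - r \<tau> w'\<bar> \<le> ?a * ?c + ?b * ?d" unfolding r_def using elim(2) by linarith
    also have "\<dots> \<le> sqrt (?a\<^sup>2 + ?b\<^sup>2) * sqrt (?c\<^sup>2 + ?d\<^sup>2)" by (rule Cauchy_Schwarz_two)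
    finally show ?case by (simp add: D_def)
  qed
next
  case False
  then show ?thesis by (intro AE_I2) (simp add: space_restrict_space)
qed

lemma r_weak_form:
  assumes T: "0 < T" "T \<in> Dom" and w: "w \<in> X0"
  shows "AE \<tau> in lebesgue_on {0..T}. r \<tau> w =
     (\<integral>x. \<bar>u \<tau> x\<bar> powr (p - 2) * u \<tau> x * w x \<partial>LO) - (\<integral>x. grad \<Omega> (u \<tau>) x \<bullet> grad \<Omega> w x \<partial>LO)"
proof -
  have "AE t in lebesgue_on {0..T}.
        (\<integral>x. v t x * w x \<partial>LO) + (\<integral>x. grad \<Omega> (u t) x \<bullet> grad \<Omega> w x \<partial>LO) + (\<integral>x. vb t x * tr w x \<partial>MG) =
        (\<integral>x. \<bar>u t x\<bar> powr (p - 2) * u t x * w x \<partial>LO)"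
    using weak_sol[OF T] w by (simp add: weak_solution_def)
  then show ?thesis by eventually_elim (simp add: r_def)
qed

end

section \<open>The time derivative of the \<open>L\<^sup>2\<close> energy\<close>

text \<open>Convergence in L2 gives convergence almost everywhere only along a subsequence; this
  criterion returns to the full sequence.\<close>

lemma LIMSEQ_if_subsubsequences:
  fixes X :: "nat \<Rightarrow> 'a::metric_space"
  assumes "\<And>f. strict_mono f \<Longrightarrow> \<exists>g::nat \<Rightarrow> nat. strict_mono g \<and> (\<lambda>n. X (f (g n))) \<longlonglongrightarrow> L"
  shows "X \<longlonglongrightarrow> L"
proof (rule ccontr)
  assume "\<not> X \<longlonglongrightarrow> L"
  then obtain e where e: "e > 0" "\<And>N. \<exists>n\<ge>N. e \<le> dist (X n) L"
    unfolding lim_sequentially by (meson linorder_not_le)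
  then have "infinite {n. e \<le> dist (X n) L}"
    unfolding infinite_nat_iff_unbounded_le by auto
  then obtain f :: "nat \<Rightarrow> nat" where f: "strict_mono f" "\<And>n. e \<le> dist (X (f n)) L"
    using infinite_enumerate[of "{n. e \<le> dist (X n) L}"] by auto
  obtain g where "(\<lambda>n. X (f (g n))) \<longlonglongrightarrow> L" using assms[OF f(1)] by blast
  then obtain n where "dist (X (f (g n))) L < e"
    using e(1) unfolding lim_sequentially by blast
  then show False using f(2)[of "g n"] by simp
qed

text \<open>A Young inequality with crude constants: both factors are replaced by the larger one,
  whose power is one of the two summands.\<close>

lemma abs_power_pairing_le:
  fixes a c :: real
  assumes p: "2 < p"
  shows "\<bar>\<bar>a\<bar> powr (p - 2) * a * c\<bar> \<le> \<bar>a\<bar> powr p + \<bar>c\<bar> powr p"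
proof -
  define m where "m = max \<bar>a\<bar> \<bar>c\<bar>"
  have "\<bar>\<bar>a\<bar> powr (p - 2) * a * c\<bar> = \<bar>a\<bar> powr (p - 2) * \<bar>a\<bar> * \<bar>c\<bar>" by (simp add: abs_mult)
  also have "\<dots> \<le> m powr (p - 2) * m * m"
    using p by (intro mult_mono powr_mono2 mult_nonneg_nonneg) (auto simp: m_def)
  also have "\<dots> = m powr p"
  proof (cases "m = 0")
    case False
    then have "m > 0" by (simp add: m_def max_def split: if_splits)
    then show ?thesis using powr_add[of m "p - 2" 2] by (simp add: powr_numeral power2_eq_square)
  qed simp
  also have "\<dots> \<le> \<bar>a\<bar> powr p + \<bar>c\<bar> powr p" by (simp add: m_def max_def)
  finally show ?thesis .
qed

lemma abs_power_pairing_self: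
  fixes a :: real
  shows "\<bar>a\<bar> powr (p - 2) * a * a = \<bar>a\<bar> powr p"
proof (cases "a = 0")
  case False
  have "\<bar>a\<bar> powr 2 = a * a" using norm_powr_2[of a] by (simp only: real_norm_def power2_abs power2_eq_square[symmetric])
  then have "\<bar>a\<bar> powr (p - 2) * a * a = \<bar>a\<bar> powr (p - 2) * \<bar>a\<bar> powr 2" by (simp only: mult.assoc)
  also have "\<dots> = \<bar>a\<bar> powr p" by (simp only: powr_add[symmetric]) simp
  finally show ?thesis .
qed simp

text \<open>
  A Radon-Riesz argument: \<open>\<bar>y\<bar> = y + 2 max 0 (- y)\<close> turns convergence of the integrals of
  \<open>h n\<close> into convergence in \<open>L\<^sup>1\<close>, and \<open>g n\<close> is controlled by \<open>h n\<close>.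
\<close>

lemma generalized_dominated_convergence:
  fixes g h :: "nat \<Rightarrow> 'b \<Rightarrow> real"
  assumes g [measurable]: "\<And>n. g n \<in> borel_measurable M" "g0 \<in> borel_measurable M"
    and h: "\<And>n. integrable M (h n)" "integrable M h0"
    and ae: "AE x in M. (\<lambda>n. g n x) \<longlonglongrightarrow> g0 x" "AE x in M. (\<lambda>n. h n x) \<longlonglongrightarrow> h0 x"
    and bd: "\<And>n x. \<bar>g n x\<bar> \<le> h n x" "\<And>x. \<bar>g0 x\<bar> \<le> h0 x"
    and lim: "(\<lambda>n. \<integral>x. h n x \<partial>M) \<longlonglongrightarrow> (\<integral>x. h0 x \<partial>M)"
  shows "(\<lambda>n. \<integral>x. g n x \<partial>M) \<longlonglongrightarrow> (\<integral>x. g0 x \<partial>M)"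
proof -
  have [measurable]: "h n \<in> borel_measurable M" "h0 \<in> borel_measurable M" for n using h by auto
  have gi: "integrable M (g n)" "integrable M g0" for n
    by (rule Bochner_Integration.integrable_bound[OF h(1)[of n]], use order_trans[OF bd(1) abs_ge_self] in auto)
      (rule Bochner_Integration.integrable_bound[OF h(2)], use order_trans[OF bd(2) abs_ge_self] in auto)
  have h0n: "0 \<le> h0 x" for x using bd(2)[of x] by linarith
  have hn: "0 \<le> h n x" for n x using bd(1)[of n x] by linarith
  \<comment> \<open>Only the negative part of \<open>h n - h0\<close> has a majorant independent of
    \<open>n\<close>, namely \<open>h0\<close>.\<close>
  have A: "(\<lambda>n. \<integral>x. max 0 (h0 x - h n x) \<partial>M) \<longlonglongrightarrow> (\<integral>x. 0 \<partial>M)"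
  proof (rule integral_dominated_convergence[where w=h0])
    show "AE x in M. (\<lambda>n. max 0 (h0 x - h n x)) \<longlonglongrightarrow> 0"
      using ae(2)
    proof eventually_elim
      case (elim x)
      have "(\<lambda>n. max 0 (h0 x - h n x)) \<longlonglongrightarrow> max 0 (h0 x - h0 x)" by (intro tendsto_intros elim)
      then show ?case by simp
    qed
  qed (use h h0n hn in auto)
  have B: "(\<lambda>n. \<integral>x. min \<bar>g n x - g0 x\<bar> (2 * h0 x) \<partial>M) \<longlonglongrightarrow> (\<integral>x. 0 \<partial>M)"
  proof (rule integral_dominated_convergence[where w="\<lambda>x. 2 * h0 x"])
    show "AE x in M. (\<lambda>n. min \<bar>g n x - g0 x\<bar> (2 * h0 x)) \<longlonglongrightarrow> 0"
      using ae(1)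
    proof eventually_elim
      case (elim x)
      have "(\<lambda>n. min \<bar>g n x - g0 x\<bar> (2 * h0 x)) \<longlonglongrightarrow> min \<bar>g0 x - g0 x\<bar> (2 * h0 x)" by (intro tendsto_intros elim)
      then show ?case using h0n[of x] by simp
    qed
    show "AE x in M. norm (min \<bar>g n x - g0 x\<bar> (2 * h0 x)) \<le> 2 * h0 x" for n
      using h0n by (intro AE_I2) (auto simp: min_def)
  qed (use h in auto)
  have iB: "integrable M (\<lambda>x. min \<bar>g n x - g0 x\<bar> (2 * h0 x))" for n
    by (rule Bochner_Integration.integrable_bound[of M "\<lambda>x. 2 * h0 x"]) (use h h0n in \<open>auto simp: min_def\<close>)
  have iA: "integrable M (\<lambda>x. max 0 (h0 x - h n x))" for n
    using h by simp
  let ?e = "\<lambda>n. (\<integral>x. min \<bar>g n x - g0 x\<bar> (2 * h0 x) \<partial>M) + (((\<integral>x. h n x \<partial>M) - (\<integral>x. h0 x \<partial>M)) + 2 * (\<integral>x. max 0 (h0 x - h n x) \<partial>M))"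
  have "(\<lambda>n. (\<integral>x. g n x \<partial>M) - (\<integral>x. g0 x \<partial>M)) \<longlonglongrightarrow> 0"
  proof (rule Lim_null_comparison)
    show "\<forall>\<^sub>F n in sequentially. norm ((\<integral>x. g n x \<partial>M) - (\<integral>x. g0 x \<partial>M)) \<le> ?e n"
    proof (intro always_eventually allI)
      fix n
      have "norm ((\<integral>x. g n x \<partial>M) - (\<integral>x. g0 x \<partial>M)) = norm (\<integral>x. g n x - g0 x \<partial>M)" using gi by simp
      also have "\<dots> \<le> (\<integral>x. norm (g n x - g0 x) \<partial>M)" by (rule integral_norm_bound)
      \<comment> \<open>Since \<open>\<bar>g n - g0\<bar> \<le> 2 h0 + (h n - h0)\<close>, whatever
        exceeds the truncation at \<open>2 h0\<close> is at most
        \<open>\<bar>h n - h0\<bar>\<close>, written here through its negative part.\<close>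
      also have "\<dots> \<le> (\<integral>x. min \<bar>g n x - g0 x\<bar> (2 * h0 x) + ((h n x - h0 x) + 2 * max 0 (h0 x - h n x)) \<partial>M)"
      proof (rule integral_mono)
        fix x
        have "\<bar>g n x - g0 x\<bar> \<le> h n x + h0 x" using bd(1)[of n x] bd(2)[of x] by linarith
        then show "norm (g n x - g0 x) \<le> min \<bar>g n x - g0 x\<bar> (2 * h0 x) + ((h n x - h0 x) + 2 * max 0 (h0 x - h n x))"
          by (simp add: min_def max_def)
      qed (use gi iA iB h in auto)
      also have "\<dots> = ?e n" using iA iB h by simp
      finally show "norm ((\<integral>x. g n x \<partial>M) - (\<integral>x. g0 x \<partial>M)) \<le> ?e n" .
    qed
    have "?e \<longlonglongrightarrow> (\<integral>x. 0 \<partial>M) + (((\<integral>x. h0 x \<partial>M) - (\<integral>x. h0 x \<partial>M)) + 2 * (\<integral>x. 0 \<partial>M))"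
      by (intro tendsto_intros A B lim)
    then show "?e \<longlonglongrightarrow> 0" by simp
  qed
  then show ?thesis by (simp add: LIM_zero_iff)
qed

lemma L2_convergent_AE_subsequence:
  assumes a: "\<And>n. a n \<in> L2_space M" "a0 \<in> L2_space M"
    and lim: "(\<lambda>n. Lq_norm 2 M (\<lambda>x. a n x - a0 x)) \<longlonglongrightarrow> 0"
  shows "\<exists>f::nat \<Rightarrow> nat. strict_mono f \<and> (AE x in M. (\<lambda>n. a (f n) x) \<longlonglongrightarrow> (a0 x :: real))"
proof -
  have "(\<lambda>n. (Lq_norm 2 M (\<lambda>x. a n x - a0 x))\<^sup>2) \<longlonglongrightarrow> 0"
    using tendsto_power[OF lim, of 2] by simp
  then have "(\<lambda>n. \<integral>x. norm ((a n x - a0 x)\<^sup>2) \<partial>M) \<longlonglongrightarrow> 0" by (simp add: Lq_norm_2)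
  then obtain f where f: "strict_mono f" "AE x in M. (\<lambda>n. (a (f n) x - a0 x)\<^sup>2) \<longlonglongrightarrow> 0"
    using tendsto_L1_AE_subseq[of M "\<lambda>n x. (a n x - a0 x)\<^sup>2"] L2_spaceD(2)[OF L2_space_diff[OF a]] by auto
  have "AE x in M. (\<lambda>n. a (f n) x) \<longlonglongrightarrow> a0 x"
    using f(2)
  proof eventually_elim
    case (elim x)
    have "(\<lambda>n. sqrt ((a (f n) x - a0 x)\<^sup>2)) \<longlonglongrightarrow> sqrt 0" by (intro tendsto_real_sqrt elim)
    then have "(\<lambda>n. a (f n) x - a0 x) \<longlonglongrightarrow> 0" by (simp add: tendsto_rabs_zero_iff)
    then show ?case by (simp add: LIM_zero_iff)
  qed
  then show ?thesis using f(1) by blast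
qed

text \<open>The two factors converge separately, since they will be \<open>u\<close> at two
  different times. Along a common almost everywhere convergent subsequence the products are
  dominated by \<open>\<bar>a n\<bar> powr p + \<bar>c n\<bar> powr p\<close>, whose integrals
  converge.\<close>

lemma power_pairing_limit:
  fixes a c :: "nat \<Rightarrow> 'b \<Rightarrow> real"
  assumes p: "2 < p" and a: "\<And>n. a n \<in> L2_space M" "a0 \<in> L2_space M" and c: "\<And>n. c n \<in> L2_space M"
    and la: "(\<lambda>n. Lq_norm 2 M (\<lambda>x. a n x - a0 x)) \<longlonglongrightarrow> 0"
    and lc: "(\<lambda>n. Lq_norm 2 M (\<lambda>x. c n x - a0 x)) \<longlonglongrightarrow> 0"
    and ia: "\<And>n. integrable M (\<lambda>x. \<bar>a n x\<bar> powr p)" "integrable M (\<lambda>x. \<bar>a0 x\<bar> powr p)"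
    and ic: "\<And>n. integrable M (\<lambda>x. \<bar>c n x\<bar> powr p)"
    and lpa: "(\<lambda>n. \<integral>x. \<bar>a n x\<bar> powr p \<partial>M) \<longlonglongrightarrow> (\<integral>x. \<bar>a0 x\<bar> powr p \<partial>M)"
    and lpc: "(\<lambda>n. \<integral>x. \<bar>c n x\<bar> powr p \<partial>M) \<longlonglongrightarrow> (\<integral>x. \<bar>a0 x\<bar> powr p \<partial>M)"
  shows "(\<lambda>n. \<integral>x. \<bar>a n x\<bar> powr (p - 2) * a n x * c n x \<partial>M) \<longlonglongrightarrow> (\<integral>x. \<bar>a0 x\<bar> powr p \<partial>M)"
proof (rule LIMSEQ_if_subsubsequences)
  fix f :: "nat \<Rightarrow> nat" assume f: "strict_mono f"
  obtain g where g: "strict_mono g" "AE x in M. (\<lambda>n. a (f (g n)) x) \<longlonglongrightarrow> a0 x"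
    using L2_convergent_AE_subsequence[of "\<lambda>n. a (f n)" M a0] a LIMSEQ_subseq_LIMSEQ[OF la f] by (auto simp: o_def)
  have fg: "strict_mono (\<lambda>n. f (g n))" using f g(1) by (simp add: strict_mono_def)
  obtain k where k: "strict_mono k" "AE x in M. (\<lambda>n. c (f (g (k n))) x) \<longlonglongrightarrow> a0 x"
    using L2_convergent_AE_subsequence[of "\<lambda>n. c (f (g n))" M a0] a c LIMSEQ_subseq_LIMSEQ[OF lc fg] by (auto simp: o_def)
  have fgk: "strict_mono (\<lambda>n. f (g (k n)))" using fg k(1) by (simp add: strict_mono_def)
  have ak: "AE x in M. (\<lambda>n. a (f (g (k n))) x) \<longlonglongrightarrow> a0 x"
    using g(2) by eventually_elim (use LIMSEQ_subseq_LIMSEQ[OF _ k(1)] in \<open>auto simp: o_def\<close>)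
  note [measurable] = a[THEN L2_spaceD(1)] c[THEN L2_spaceD(1)]
  let ?h = "\<lambda>n x. \<bar>a (f (g (k n))) x\<bar> powr p + \<bar>c (f (g (k n))) x\<bar> powr p"
  have "(\<lambda>n. \<integral>x. \<bar>a (f (g (k n))) x\<bar> powr (p - 2) * a (f (g (k n))) x * c (f (g (k n))) x \<partial>M)
    \<longlonglongrightarrow> (\<integral>x. \<bar>a0 x\<bar> powr (p - 2) * a0 x * a0 x \<partial>M)"
  proof (rule generalized_dominated_convergence[where h="?h" and ?h0.0="\<lambda>x. \<bar>a0 x\<bar> powr p + \<bar>a0 x\<bar> powr p"])
    show "AE x in M. (\<lambda>n. \<bar>a (f (g (k n))) x\<bar> powr (p - 2) * a (f (g (k n))) x * c (f (g (k n))) x)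
        \<longlonglongrightarrow> \<bar>a0 x\<bar> powr (p - 2) * a0 x * a0 x"
      using ak k(2) by eventually_elim (use p in \<open>intro tendsto_mult tendsto_powr' tendsto_rabs tendsto_const, auto\<close>)
    show "AE x in M. (\<lambda>n. ?h n x) \<longlonglongrightarrow> \<bar>a0 x\<bar> powr p + \<bar>a0 x\<bar> powr p"
      using ak k(2) by eventually_elim (use p in \<open>intro tendsto_add tendsto_powr' tendsto_rabs tendsto_const, auto\<close>)
    have "(\<lambda>n. (\<integral>x. \<bar>a (f (g (k n))) x\<bar> powr p \<partial>M) + (\<integral>x. \<bar>c (f (g (k n))) x\<bar> powr p \<partial>M))
        \<longlonglongrightarrow> (\<integral>x. \<bar>a0 x\<bar> powr p \<partial>M) + (\<integral>x. \<bar>a0 x\<bar> powr p \<partial>M)"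
      using LIMSEQ_subseq_LIMSEQ[OF lpa fgk] LIMSEQ_subseq_LIMSEQ[OF lpc fgk] by (intro tendsto_add) (auto simp: o_def)
    then show "(\<lambda>n. \<integral>x. ?h n x \<partial>M) \<longlonglongrightarrow> (\<integral>x. \<bar>a0 x\<bar> powr p + \<bar>a0 x\<bar> powr p \<partial>M)"
      using ia ic by simp
  qed (use ia ic abs_power_pairing_le[OF p] in \<open>auto simp: abs_power_pairing_self\<close>)
  then show "\<exists>g. strict_mono g \<and> (\<lambda>n. \<integral>x. \<bar>a (f (g n)) x\<bar> powr (p - 2) * a (f (g n)) x * c (f (g n)) x \<partial>M)
     \<longlonglongrightarrow> (\<integral>x. \<bar>a0 x\<bar> powr p \<partial>M)"
    using fgk g(1) k(1) by (intro exI[of _ "\<lambda>n. g (k n)"]) (simp add: abs_power_pairing_self strict_mono_def)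
qed

lemma integral_near_const:
  fixes f :: "real \<Rightarrow> real"
  assumes f: "integrable (lebesgue_on {s..t}) f" and ae: "AE \<tau> in lebesgue_on {s..t}. \<bar>f \<tau> - c\<bar> \<le> e" and st: "s \<le> t"
  shows "\<bar>(\<integral>\<tau>. f \<tau> \<partial>lebesgue_on {s..t}) - c * (t - s)\<bar> \<le> e * (t - s :: real)"
proof -
  interpret finite_measure "lebesgue_on {s..t}" by (rule finite_lebesgue_on_interval)
  have m: "measure (lebesgue_on {s..t}) {s..t} = t - s"
    using st by (simp add: measure_restrict_space)
  have const: "(\<integral>\<tau>. k \<partial>lebesgue_on {s..t}) = k * (t - s)" for k :: real
    by (simp add: space_restrict_space) (simp add: m)
  have "\<bar>(\<integral>\<tau>. f \<tau> \<partial>lebesgue_on {s..t}) - c * (t - s)\<bar> = \<bar>\<integral>\<tau>. f \<tau> - c \<partial>lebesgue_on {s..t}\<bar>"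
    unfolding const[symmetric] using f by (subst Bochner_Integration.integral_diff) auto
  also have "\<dots> \<le> (\<integral>\<tau>. \<bar>f \<tau> - c\<bar> \<partial>lebesgue_on {s..t})" by (rule integral_abs_bound)
  also have "\<dots> \<le> (\<integral>\<tau>. e \<partial>lebesgue_on {s..t})" by (rule integral_mono_AE) (use f ae in auto)
  finally show ?thesis unfolding const .
qed

section \<open>Energies along the solution and the derivative of Q\<close>

context evolution
begin

definition Q :: "real \<Rightarrow> real" where "Q t = b t (u t)"
definition E :: "real \<Rightarrow> real" where "E t = (\<integral>\<tau>. D \<tau> \<partial>lebesgue_on {0..t})"
definition N2 :: "real \<Rightarrow> real" where "N2 t = (norm_grad \<Omega> (u t))\<^sup>2"
definition PHI :: "real \<Rightarrow> real" where "PHI t = (\<integral>x. \<bar>u t x\<bar> powr p \<partial>LO)"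

lemma Q_norms: "t \<in> Dom \<Longrightarrow> Q t = (norm_Om 2 \<Omega> (u t))\<^sup>2 + (norm_Gam \<Omega> \<Gamma>1 (u t))\<^sup>2"
  unfolding Q_def b_def Lq_norm_2 by (simp add: power2_eq_square)

lemma norm_p_PHI: "norm_Om p \<Omega> (u t) powr p = PHI t"
  using p Lq_norm_powr[of p LO "u t"] by (simp add: PHI_def)

lemma K_eq: "K \<Omega> p (u t) = N2 t - PHI t"
  by (simp add: K_def N2_def norm_p_PHI)

lemma J_eq: "J \<Omega> p (u t) = N2 t / 2 - PHI t / p"
  by (simp add: J_def N2_def norm_p_PHI)

lemma J_E: "t \<in> Dom \<Longrightarrow> J \<Omega> p (u t) = J \<Omega> p u0 - E t"
  using J_u by (simp add: E_def)

lemma PHI_eq: "t \<in> Dom \<Longrightarrow> PHI t = p * (N2 t / 2 - J \<Omega> p u0 + E t)"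
  using J_E[of t] J_eq[of t] p by (simp add: field_simps)

lemma N2_nonneg: "0 \<le> N2 t" by (simp add: N2_def)

lemma grad_u_L2: "t \<in> Dom \<Longrightarrow> grad \<Omega> (u t) \<in> L2_space LO"
  using grad_weak(1) H1_0_H1 u_X0 by blast

lemma N2_continuous: "continuous_on Dom N2"
  unfolding continuous_on_def
proof
  fix t assume t: "t \<in> Dom"
  have "((\<lambda>\<tau>. \<integral>x. grad \<Omega> (u \<tau>) x \<bullet> grad \<Omega> (u \<tau>) x \<partial>LO) \<longlongrightarrow> (\<integral>x. grad \<Omega> (u t) x \<bullet> grad \<Omega> (u t) x \<partial>LO)) (at t within Dom)"
    by (rule L2_tendsto_inner[of Dom]) (use grad_u_L2 t tendsto_norms(2) in \<open>auto simp: eventually_at_filter\<close>)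
  then show "(N2 \<longlongrightarrow> N2 t) (at t within Dom)"
    unfolding N2_def Lq_norm_2 by (simp add: power2_norm_eq_inner)
qed

lemma Q_continuous: "continuous_on Dom Q"
  unfolding continuous_on_def
proof
  fix t assume t: "t \<in> Dom"
  have "((\<lambda>\<tau>. \<integral>x. u \<tau> x \<bullet> u \<tau> x \<partial>LO) \<longlongrightarrow> (\<integral>x. u t x \<bullet> u t x \<partial>LO)) (at t within Dom)"
    by (rule L2_tendsto_inner[of Dom]) (use u_L2 t tendsto_norms(1) in \<open>auto simp: eventually_at_filter\<close>)
  moreover have "((\<lambda>\<tau>. \<integral>x. tr (u \<tau>) x \<bullet> tr (u \<tau>) x \<partial>MG) \<longlongrightarrow> (\<integral>x. tr (u t) x \<bullet> tr (u t) x \<partial>MG)) (at t within Dom)"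
    by (rule L2_tendsto_inner[of Dom]) (use tr_u_L2 t tendsto_norms(3) in \<open>auto simp: eventually_at_filter\<close>)
  ultimately show "(Q \<longlongrightarrow> Q t) (at t within Dom)"
    unfolding Q_def b_def using tendsto_add by fastforce
qed

lemma D_integral: "t \<in> Dom \<Longrightarrow> 0 \<le> s \<Longrightarrow> s \<le> t \<Longrightarrow> (\<integral>\<tau>. D \<tau> \<partial>lebesgue_on {s..t}) = integral {0..t} D - integral {0..s} D"
  by (rule integral_lebesgue_on_closed(1)[OF D_integrable_open])

lemma E_eq_integral: "t \<in> Dom \<Longrightarrow> E t = integral {0..t} D"
  using D_integral[of t 0] Dom_nonneg[of t] by (simp add: E_def)

lemma E_increment: "t \<in> Dom \<Longrightarrow> 0 \<le> s \<Longrightarrow> s \<le> t \<Longrightarrow> E t - E s = (\<integral>\<tau>. D \<tau> \<partial>lebesgue_on {s..t})"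
  using D_integral E_eq_integral Dom_mono by simp

lemma D_nonneg: "0 \<le> D \<tau>" by (simp add: D_def)

lemma E_mono: "t \<in> Dom \<Longrightarrow> 0 \<le> s \<Longrightarrow> s \<le> t \<Longrightarrow> E s \<le> E t"
proof -
  assume "t \<in> Dom" "0 \<le> s" "s \<le> t"
  moreover have "0 \<le> (\<integral>\<tau>. D \<tau> \<partial>lebesgue_on {s..t})" by (simp add: D_nonneg)
  ultimately show ?thesis using E_increment[of t s] by linarith
qed

lemma E_zero: "E 0 = 0"
  using E_eq_integral[OF zero_Dom] by simp

lemma E_continuous:
  assumes t: "t \<in> Dom"
  shows "continuous_on {0..t} E"
proof -
  have "continuous_on {0..t} (\<lambda>s. integral {0..s} D)"
    by (rule integral_lebesgue_on_closed(2)[OF D_integrable_open t order_refl Dom_nonneg[OF t]])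
  then show ?thesis
    by (rule continuous_on_eq) (use E_eq_integral Dom_mono[OF t] in auto)
qed

lemma PHI_continuous: "t \<in> Dom \<Longrightarrow> continuous_on {0..t} PHI"
proof -
  assume t: "t \<in> Dom"
  have sub: "{0..t} \<subseteq> Dom" using Dom_mono[OF t] by auto
  have "continuous_on {0..t} (\<lambda>s. p * (N2 s / 2 - J \<Omega> p u0 + E s))"
    by (intro continuous_intros E_continuous[OF t] continuous_on_subset[OF N2_continuous sub]) auto
  then show ?thesis by (rule continuous_on_eq) (use PHI_eq sub in auto)
qed

text \<open>Integrability of \<open>\<bar>u\<bar>\<^sup>p\<close> comes for free where \<open>K < 0\<close>: otherwise the integral would be the junk value \<open>0\<close>.\<close>

lemma PHI_integrable: "N2 t < PHI t \<Longrightarrow> integrable LO (\<lambda>x. \<bar>u t x\<bar> powr p)"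
  using N2_nonneg[of t] not_integrable_integral_eq unfolding PHI_def by fastforce

definition G :: "real \<Rightarrow> real \<Rightarrow> real" where
  "G \<tau> t = (\<integral>x. \<bar>u \<tau> x\<bar> powr (p - 2) * u \<tau> x * u t x \<partial>LO) - (\<integral>x. grad \<Omega> (u \<tau>) x \<bullet> grad \<Omega> (u t) x \<partial>LO)"

text \<open>Both times must vary independently, because the integration time differs from that of
  the test function. The limit theorem is sequential, so a failure is turned into two sequences of
  times.\<close>

lemma G_limit:
  assumes T: "T \<in> Dom" and s: "s \<in> {0..T}" and neg: "N2 s < PHI s" and e: "0 < e"
  shows "\<exists>d>0. \<forall>\<tau>\<in>{0..T}. \<forall>t\<in>{0..T}. \<bar>\<tau> - s\<bar> < d \<longrightarrow> \<bar>t - s\<bar> < d \<longrightarrow> \<bar>G \<tau> t - (PHI s - N2 s)\<bar> < e"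
proof (rule ccontr)
  assume contra: "\<not> ?thesis"
  have sub: "{0..T} \<subseteq> Dom" using Dom_mono[OF T] by auto
  have "\<exists>\<tau> t. \<tau> \<in> {0..T} \<and> t \<in> {0..T} \<and> \<bar>\<tau> - s\<bar> < inverse (real (Suc n)) \<and> \<bar>t - s\<bar> < inverse (real (Suc n))
      \<and> \<not> \<bar>G \<tau> t - (PHI s - N2 s)\<bar> < e" for n
  proof -
    have "0 < inverse (real (Suc n))" by simp
    then have "\<not> (\<forall>\<tau>\<in>{0..T}. \<forall>t\<in>{0..T}. \<bar>\<tau> - s\<bar> < inverse (real (Suc n)) \<longrightarrow> \<bar>t - s\<bar> < inverse (real (Suc n))
        \<longrightarrow> \<bar>G \<tau> t - (PHI s - N2 s)\<bar> < e)" using contra by blast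
    then show ?thesis by blast
  qed
  then obtain \<tau> t where \<tau>: "\<And>n. \<tau> n \<in> {0..T}" and t: "\<And>n. t n \<in> {0..T}"
    and near: "\<And>n. \<bar>\<tau> n - s\<bar> < inverse (real (Suc n))" "\<And>n. \<bar>t n - s\<bar> < inverse (real (Suc n))"
    and far: "\<And>n. \<not> \<bar>G (\<tau> n) (t n) - (PHI s - N2 s)\<bar> < e" by metis
  have conv: "\<sigma> \<longlonglongrightarrow> s" if "\<And>n. \<bar>\<sigma> n - s\<bar> < inverse (real (Suc n))" for \<sigma>
  proof (rule LIM_zero_cancel, rule Lim_null_comparison[OF _ LIMSEQ_inverse_real_of_nat])
    show "\<forall>\<^sub>F n in sequentially. norm (\<sigma> n - s) \<le> inverse (real (Suc n))"
      using that by (auto intro: always_eventually less_imp_le)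
  qed
  have sD: "s \<in> Dom" using s sub by blast
  have cPN: "continuous_on {0..T} (\<lambda>x. PHI x - N2 x)"
    by (intro continuous_intros PHI_continuous[OF T] continuous_on_subset[OF N2_continuous sub])
  have ev: "\<forall>\<^sub>F n in sequentially. N2 (\<sigma> n) < PHI (\<sigma> n)" if \<sigma>: "\<sigma> \<longlonglongrightarrow> s" "\<And>n. \<sigma> n \<in> {0..T}" for \<sigma>
  proof -
    have "(\<lambda>n. PHI (\<sigma> n) - N2 (\<sigma> n)) \<longlonglongrightarrow> PHI s - N2 s"
      using continuous_on_tendsto_compose[OF cPN \<sigma>(1) s] \<sigma>(2) by simp
    then have "\<forall>\<^sub>F n in sequentially. 0 < PHI (\<sigma> n) - N2 (\<sigma> n)" using neg by (intro order_tendstoD) auto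
    then show ?thesis by eventually_elim simp
  qed
  note c\<tau> = conv[OF near(1)] and ct = conv[OF near(2)]
  have "\<forall>\<^sub>F n in sequentially. N2 (\<tau> n) < PHI (\<tau> n) \<and> N2 (t n) < PHI (t n)"
    using ev[OF c\<tau> \<tau>] ev[OF ct t] by (rule eventually_conj)
  then obtain N where N: "\<And>n. n \<ge> N \<Longrightarrow> N2 (\<tau> n) < PHI (\<tau> n) \<and> N2 (t n) < PHI (t n)"
    by (auto simp: eventually_sequentially)
  \<comment> \<open>Dropping finitely many terms makes \<open>K < 0\<close> hold for all indices,
    and with it the integrability that \<open>power_pairing_limit\<close> asks of every
    term.\<close>
  define \<tau>' t' where "\<tau>' n = \<tau> (n + N)" and "t' n = t (n + N)" for n
  have c: "\<tau>' \<longlonglongrightarrow> s" "t' \<longlonglongrightarrow> s" unfolding \<tau>'_def t'_def using c\<tau> ct by (auto intro: LIMSEQ_ignore_initial_segment)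
  have m: "\<tau>' n \<in> {0..T}" "t' n \<in> {0..T}" for n using \<tau> t by (simp_all add: \<tau>'_def t'_def)
  have mD: "\<tau>' n \<in> Dom" "t' n \<in> Dom" for n using m sub by blast+
  have n: "N2 (\<tau>' n) < PHI (\<tau>' n)" "N2 (t' n) < PHI (t' n)" for n using N by (simp_all add: \<tau>'_def t'_def)
  have seq: "(\<lambda>n. F (\<sigma> n)) \<longlonglongrightarrow> 0"
    if F: "(F \<longlongrightarrow> 0) (at s within Dom)" "F s = (0::real)" and \<sigma>: "\<sigma> \<longlonglongrightarrow> s" "\<And>n. \<sigma> n \<in> Dom" for F \<sigma>
  proof -
    have "continuous (at s within Dom) F" using F by (simp add: continuous_within)
    then have "(\<lambda>n. F (\<sigma> n)) \<longlonglongrightarrow> F s"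
      using \<sigma> by (auto simp: continuous_within_sequentially o_def)
    then show ?thesis using F(2) by simp
  qed
  have z: "Lq_norm 2 M (\<lambda>x. f x - f x) = 0" for M :: "'c measure" and f :: "'c \<Rightarrow> 'd::real_normed_vector"
    by (simp add: Lq_norm_2_sqrt)
  note l1 = seq[OF tendsto_norms(1)[OF sD] z] and l2 = seq[OF tendsto_norms(2)[OF sD] z]
  have PH: "(\<lambda>n. PHI (\<sigma> n)) \<longlonglongrightarrow> PHI s" if "\<sigma> \<longlonglongrightarrow> s" "\<And>n. \<sigma> n \<in> {0..T}" for \<sigma>
    using continuous_on_tendsto_compose[OF PHI_continuous[OF T] that(1) s] that(2) by simp
  have "(\<lambda>n. \<integral>x. \<bar>u (\<tau>' n) x\<bar> powr (p - 2) * u (\<tau>' n) x * u (t' n) x \<partial>LO) \<longlonglongrightarrow> (\<integral>x. \<bar>u s x\<bar> powr p \<partial>LO)"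
    by (rule power_pairing_limit[OF p u_L2[OF mD(1)] u_L2[OF sD] u_L2[OF mD(2)] l1[OF c(1) mD(1)] l1[OF c(2) mD(2)]
          PHI_integrable[OF n(1)] PHI_integrable[OF neg] PHI_integrable[OF n(2)]
          PH[OF c(1) m(1), unfolded PHI_def] PH[OF c(2) m(2), unfolded PHI_def]])
  moreover have "(\<lambda>n. \<integral>x. grad \<Omega> (u (\<tau>' n)) x \<bullet> grad \<Omega> (u (t' n)) x \<partial>LO) \<longlonglongrightarrow> (\<integral>x. grad \<Omega> (u s) x \<bullet> grad \<Omega> (u s) x \<partial>LO)"
    by (rule L2_tendsto_inner[of UNIV]) (use grad_u_L2 mD sD l2[OF c(1) mD(1)] l2[OF c(2) mD(2)] in auto)
  ultimately have "(\<lambda>n. G (\<tau>' n) (t' n)) \<longlonglongrightarrow> PHI s - N2 s"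
    unfolding G_def PHI_def N2_def Lq_norm_2 by (simp add: power2_norm_eq_inner tendsto_diff)
  then have "\<forall>\<^sub>F n in sequentially. \<bar>G (\<tau>' n) (t' n) - (PHI s - N2 s)\<bar> < e"
    using e by (auto simp: tendsto_iff dist_real_def)
  then show False using far by (auto simp: eventually_sequentially \<tau>'_def t'_def)
qed

lemma b_commute: "b t (u s) = b s (u t)"
  by (simp add: b_def mult.commute)

lemma Q_increment:
  assumes T: "T \<in> Dom" and s: "s \<in> {0..T}" and neg: "N2 s < PHI s" and e: "0 < e"
  shows "\<exists>d>0. \<forall>t1\<in>{0..T}. \<forall>t2\<in>{0..T}. t1 \<le> t2 \<longrightarrow> \<bar>t1 - s\<bar> < d \<longrightarrow> \<bar>t2 - s\<bar> < d \<longrightarrow>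
    \<bar>Q t2 - Q t1 - 2 * (PHI s - N2 s) * (t2 - t1)\<bar> \<le> e * (t2 - t1)"
proof -
  obtain d where d: "d > 0" "\<And>\<tau> t. \<tau> \<in> {0..T} \<Longrightarrow> t \<in> {0..T} \<Longrightarrow> \<bar>\<tau> - s\<bar> < d \<Longrightarrow> \<bar>t - s\<bar> < d \<Longrightarrow> \<bar>G \<tau> t - (PHI s - N2 s)\<bar> < e / 2"
    using G_limit[OF T s neg, of "e / 2"] e by auto
  have "\<bar>Q t2 - Q t1 - 2 * (PHI s - N2 s) * (t2 - t1)\<bar> \<le> e * (t2 - t1)"
    if t: "t1 \<in> {0..T}" "t2 \<in> {0..T}" "t1 \<le> t2" "\<bar>t1 - s\<bar> < d" "\<bar>t2 - s\<bar> < d" for t1 t2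
  proof -
    have tD: "t1 \<in> Dom" "t2 \<in> Dom" using t Dom_mono[OF T] by auto
    have inc: "\<bar>(b t2 (u t) - b t1 (u t)) - (PHI s - N2 s) * (t2 - t1)\<bar> \<le> e / 2 * (t2 - t1)"
      if t': "t = t1 \<or> t = t2" for t
    proof -
      have t'': "t \<in> {0..T}" "\<bar>t - s\<bar> < d" "t \<in> Dom" using t' t tD by auto
      note X = u_X0[OF t''(3)]
      \<comment> \<open>The null set belongs to this one test function. For \<open>T = 0\<close> the
        interval is a single point and is itself a null set.\<close>
      have "AE \<tau> in lebesgue_on {t1..t2}. r \<tau> (u t) = G \<tau> t"
      proof (cases "0 < T")
        case True
        show ?thesis
          using AE_lebesgue_on_subset[OF r_weak_form[OF True T X], of "{t1..t2}"] t by (auto simp: G_def)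
      next
        case False
        then have "t1 = t2" using t by auto
        then have "AE \<tau> in lebesgue_on {t1..t2}. False"
          by (subst AE_restrict_space_iff) (use AE_not_in[of "{t1}" lebesgue] in auto)
        then show ?thesis by eventually_elim simp
      qed
      moreover have "AE \<tau> in lebesgue_on {t1..t2}. \<tau> \<in> {t1..t2}"
        using AE_space[of "lebesgue_on {t1..t2}"] by (simp add: space_restrict_space)
      ultimately have ae: "AE \<tau> in lebesgue_on {t1..t2}. \<bar>r \<tau> (u t) - (PHI s - N2 s)\<bar> \<le> e / 2"
      proof eventually_elim
        case (elim \<tau>)
        have "\<tau> \<in> {0..T}" "\<bar>\<tau> - s\<bar> < d" using elim(2) t by auto
        then show ?case using d(2)[OF _ t''(1) _ t''(2)] elim(1) by (simp add: less_imp_le)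
      qed
      have t10: "0 \<le> t1" using t by simp
      show ?thesis
        unfolding b_increment[OF t10 t(3) tD(2) X]
        by (rule integral_near_const[OF r_integrable[OF X tD(2) t10] ae t(3)])
    qed
    \<comment> \<open>By symmetry the mixed terms \<open>b t1 (u t2)\<close> and
      \<open>b t2 (u t1)\<close> cancel. Each bracket has a fixed test function, which produces the
      factor 2 in the derivative.\<close>
    have "Q t2 - Q t1 = (b t2 (u t2) - b t1 (u t2)) + (b t2 (u t1) - b t1 (u t1))"
      using b_commute[of t2 t1] by (simp add: Q_def)
    moreover have "2 * (PHI s - N2 s) * (t2 - t1) = (PHI s - N2 s) * (t2 - t1) + (PHI s - N2 s) * (t2 - t1)"
      "e * (t2 - t1) = e / 2 * (t2 - t1) + e / 2 * (t2 - t1)" by simp_all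
    ultimately show ?thesis using inc[of t1] inc[of t2] by linarith
  qed
  then show ?thesis using d(1) by blast
qed

lemma Q_has_derivative:
  assumes T: "T \<in> Dom" and s: "s \<in> {0..T}" and neg: "N2 s < PHI s"
  shows "(Q has_real_derivative 2 * (PHI s - N2 s)) (at s within {0..T})"
  unfolding has_field_derivative_iff Lim_within
proof (intro allI impI)
  fix e :: real assume e: "0 < e"
  obtain d where d: "d > 0" "\<And>t1 t2. t1 \<in> {0..T} \<Longrightarrow> t2 \<in> {0..T} \<Longrightarrow> t1 \<le> t2 \<Longrightarrow> \<bar>t1 - s\<bar> < d \<Longrightarrow> \<bar>t2 - s\<bar> < d \<Longrightarrow>
    \<bar>Q t2 - Q t1 - 2 * (PHI s - N2 s) * (t2 - t1)\<bar> \<le> e / 2 * (t2 - t1)"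
    using Q_increment[OF T s neg, of "e / 2"] e by auto
  show "\<exists>d>0. \<forall>x\<in>{0..T}. 0 < dist x s \<and> dist x s < d \<longrightarrow> dist ((Q x - Q s) / (x - s)) (2 * (PHI s - N2 s)) < e"
  proof (intro exI[of _ d] conjI ballI impI d(1))
    fix x assume x: "x \<in> {0..T}" "0 < dist x s \<and> dist x s < d"
    then have xs: "x \<noteq> s" "\<bar>x - s\<bar> < d" by (auto simp: dist_real_def)
    have "\<bar>Q x - Q s - 2 * (PHI s - N2 s) * (x - s)\<bar> \<le> e / 2 * \<bar>x - s\<bar>"
    proof (cases "s \<le> x")
      case True
      then show ?thesis using d(2)[OF s x(1) True] xs d(1) by simp
    next
      case False
      then have "\<bar>Q s - Q x - 2 * (PHI s - N2 s) * (s - x)\<bar> \<le> e / 2 * (s - x)" using d(2)[OF x(1) s] xs d(1) by simp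
      moreover have "Q x - Q s - 2 * (PHI s - N2 s) * (x - s) = - (Q s - Q x - 2 * (PHI s - N2 s) * (s - x))"
        by (simp add: algebra_simps)
      moreover have "\<bar>x - s\<bar> = s - x" using False by simp
      ultimately show ?thesis by (simp only: abs_minus_cancel)
    qed
    moreover have "(Q x - Q s) / (x - s) - 2 * (PHI s - N2 s) = (Q x - Q s - 2 * (PHI s - N2 s) * (x - s)) / (x - s)"
      using xs by (simp add: field_simps)
    ultimately have "\<bar>(Q x - Q s) / (x - s) - 2 * (PHI s - N2 s)\<bar> \<le> e / 2"
      using xs by (simp add: abs_divide divide_le_eq)
    then show "dist ((Q x - Q s) / (x - s)) (2 * (PHI s - N2 s)) < e" using e by (simp add: dist_real_def)
  qed
qed

text \<open>Let \<open>S\<close> be the squared distance of \<open>u t\<close> and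
  \<open>u s\<close> for the inner product behind \<open>b\<close>. Testing the increment with
  \<open>u t - u s\<close> bounds \<open>S\<close> by the integral of \<open>sqrt D\<close> times
  \<open>sqrt S\<close>; cancelling \<open>sqrt S\<close> and applying Cauchy-Schwarz in time gives
  \<open>S \<le> (t - s) (E t - E s)\<close>. The reverse triangle inequality compares
  \<open>S\<close> with the left side.\<close>

lemma sqrt_Q_increment:
  assumes s: "0 \<le> s" "s \<le> t" and t: "t \<in> Dom"
  shows "(sqrt (Q t) - sqrt (Q s))\<^sup>2 \<le> (t - s) * (E t - E s)"
proof -
  have sD: "s \<in> Dom" using Dom_mono[OF t s] .
  note X = u_X0[OF t] u_X0[OF sD]
  define S where "S = (Lq_norm 2 LO (\<lambda>x. u t x - u s x))\<^sup>2 + (Lq_norm 2 MG (\<lambda>x. tr (u t) x - tr (u s) x))\<^sup>2"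
  have S0: "0 \<le> S" by (simp add: S_def)
  have S_eq: "S = Q t - 2 * b t (u s) + Q s"
    unfolding S_def L2_norm_diff[OF u_L2[OF t] u_L2[OF sD]] L2_norm_diff[OF tr_u_L2[OF t] tr_u_L2[OF sD]]
    by (simp add: Q_norms[OF t] Q_norms[OF sD] b_def)
  have EI: "E t - E s = (\<integral>\<tau>. D \<tau> \<partial>lebesgue_on {s..t})" by (rule E_increment[OF t s])
  have iD: "integrable (lebesgue_on {s..t}) D" by (rule D_integrable[OF t s(1)])
  have sqD: "(\<lambda>\<tau>. sqrt (D \<tau>)) \<in> L2_space (lebesgue_on {s..t})"
    using iD borel_measurable_integrable[OF iD] D_nonneg by (auto simp: L2_space_def)
  have one: "(\<lambda>\<tau>. 1::real) \<in> L2_space (lebesgue_on {s..t})"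
    by (rule L2_space_bounded[OF finite_lebesgue_on_interval(2)]) auto
  have isq: "integrable (lebesgue_on {s..t}) (\<lambda>\<tau>. sqrt (D \<tau>))"
    by (rule L2_space_finite_measure_integrable[OF finite_lebesgue_on_interval(2) sqD])
  have m: "measure (lebesgue_on {s..t}) {s..t} = t - s" using s by (simp add: measure_restrict_space)
  have "(\<integral>\<tau>. sqrt (D \<tau>) \<partial>lebesgue_on {s..t}) \<le> sqrt (E t - E s) * sqrt (t - s)"
    using L2_Cauchy_Schwarz[OF sqD one] D_nonneg m unfolding EI by (simp add: Lq_norm_2_sqrt space_restrict_space)
  then have int: "(\<integral>\<tau>. sqrt (D \<tau>) \<partial>lebesgue_on {s..t}) \<le> sqrt ((t - s) * (E t - E s))"
    by (simp add: real_sqrt_mult mult.commute)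
  have "S = (b t (u t) - b s (u t)) - (b t (u s) - b s (u s))"
    using S_eq b_commute[of t s] by (simp add: Q_def)
  also have "\<dots> = (\<integral>\<tau>. r \<tau> (u t) - r \<tau> (u s) \<partial>lebesgue_on {s..t})"
    unfolding b_increment[OF s t X(1)] b_increment[OF s t X(2)]
    using r_integrable[OF X(1) t s(1)] r_integrable[OF X(2) t s(1)] by simp
  also have "\<dots> \<le> (\<integral>\<tau>. sqrt (D \<tau>) * sqrt S \<partial>lebesgue_on {s..t})"
  proof (rule integral_mono_AE)
    obtain T where T: "T \<in> Dom" "t < T" using Dom_later[OF t] .
    have "AE \<tau> in lebesgue_on {s..t}. \<bar>r \<tau> (u t) - r \<tau> (u s)\<bar> \<le> sqrt (D \<tau>) * sqrt S"
      by (rule AE_lebesgue_on_insert[OF r_diff_bound[OF T(1) X, folded S_def], of _ 0]) (use s T in auto)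
    then show "AE \<tau> in lebesgue_on {s..t}. r \<tau> (u t) - r \<tau> (u s) \<le> sqrt (D \<tau>) * sqrt S"
      by eventually_elim linarith
  qed (use isq r_integrable[OF X(1) t s(1)] r_integrable[OF X(2) t s(1)] in auto)
  also have "\<dots> = (\<integral>\<tau>. sqrt (D \<tau>) \<partial>lebesgue_on {s..t}) * sqrt S" using isq by simp
  also have "\<dots> \<le> sqrt ((t - s) * (E t - E s)) * sqrt S" using int S0 by (intro mult_right_mono) auto
  finally have le: "S \<le> sqrt ((t - s) * (E t - E s)) * sqrt S" .
  have pos: "0 \<le> (t - s) * (E t - E s)" using s E_mono[OF t s] by simp
  have SE: "S \<le> (t - s) * (E t - E s)"
  proof (cases "S = 0")
    case False
    then have "0 < sqrt S" using S0 by simp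
    moreover have "sqrt S * sqrt S \<le> sqrt ((t - s) * (E t - E s)) * sqrt S" using le S0 by simp
    ultimately have "sqrt S \<le> sqrt ((t - s) * (E t - E s))" by (simp only: mult_le_cancel_right_pos)
    then show ?thesis by simp
  qed (use pos in simp)
  have "b t (u s) \<le> sqrt (Q t) * sqrt (Q s)"
  proof -
    have "b t (u s) \<le> Lq_norm 2 LO (u t) * Lq_norm 2 LO (u s) + Lq_norm 2 MG (tr (u t)) * Lq_norm 2 MG (tr (u s))"
      using L2_Cauchy_Schwarz[OF u_L2[OF t] u_L2[OF sD]] L2_Cauchy_Schwarz[OF tr_u_L2[OF t] tr_u_L2[OF sD]]
      by (simp add: b_def abs_le_iff)
    also have "\<dots> \<le> sqrt (Q t) * sqrt (Q s)" unfolding Q_norms[OF t] Q_norms[OF sD] by (rule Cauchy_Schwarz_two)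
    finally show ?thesis .
  qed
  moreover have "0 \<le> Q t" "0 \<le> Q s" by (simp_all add: Q_norms t sD)
  ultimately have "(sqrt (Q t) - sqrt (Q s))\<^sup>2 \<le> S" unfolding S_eq by (simp add: power2_diff)
  then show ?thesis using SE by simp
qed

end

section \<open>The concavity argument\<close>

lemma MVT_within:
  fixes f :: "real \<Rightarrow> real"
  assumes "a \<le> b" "{a..b} \<subseteq> S" "\<And>x. x \<in> {a..b} \<Longrightarrow> (f has_real_derivative f' x) (at x within S)"
  shows "\<exists>x\<in>{a..b}. f b - f a = f' x * (b - a)"
proof -
  have "\<exists>x\<in>{a..b}. f b - f a = (\<lambda>h. f' x * h) (b - a)"
    using assms
    by (intro mvt_very_simple) (auto simp: has_field_derivative_def intro: has_derivative_subset)
  then show ?thesis by simp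
qed

text \<open>The scalar core shared by both data sets. The assumption \<open>inc\<close> ties
  \<open>E\<close> to \<open>Q\<close>; taken from time 0 it also shows that \<open>E\<close> is
  nonnegative.\<close>

locale concavity =
  fixes T p \<beta> :: real and Q q E :: "real \<Rightarrow> real"
  assumes T: "0 < T" and p: "2 < p" and \<beta>: "0 < \<beta>" and Q0: "0 < Q 0" and E0: "E 0 = 0"
    and dQ: "\<And>t. t \<in> {0..T} \<Longrightarrow> (Q has_real_derivative q t) (at t within {0..T})"
    and q_low: "\<And>t. t \<in> {0..T} \<Longrightarrow> 2 * p * (\<beta> + E t) \<le> q t"
    and inc: "\<And>s t. 0 \<le> s \<Longrightarrow> s \<le> t \<Longrightarrow> t \<le> T \<Longrightarrow> (sqrt (Q t) - sqrt (Q s))\<^sup>2 \<le> (t - s) * (E t - E s)"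
begin

lemma E_nonneg: assumes "t \<in> {0..T}" shows "0 \<le> E t"
proof (cases "t = 0")
  case False
  have "0 \<le> (t - 0) * (E t - E 0)" by (rule order_trans[OF zero_le_power2 inc]) (use assms in auto)
  then show ?thesis using False assms E0 by (simp add: zero_le_mult_iff)
qed (simp add: E0)

lemma q_pos: assumes "t \<in> {0..T}" shows "0 < q t"
proof -
  have "0 < 2 * p * (\<beta> + E t)" using p \<beta> E_nonneg[OF assms] by simp
  then show ?thesis using q_low[OF assms] by linarith
qed

lemma Q_ge: assumes "t \<in> {0..T}" shows "Q 0 \<le> Q t"
proof -
  obtain x where "x \<in> {0..t}" "Q t - Q 0 = q x * (t - 0)"
    using MVT_within[of 0 t "{0..T}" Q q] dQ assms by auto
  moreover from this have "0 \<le> q x * (t - 0)" using q_pos[of x] assms by (intro mult_nonneg_nonneg) auto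
  ultimately show ?thesis by linarith
qed

lemma Q_cont: "continuous_on {0..T} Q"
  by (rule DERIV_continuous_on[OF dQ])

definition A :: "real \<Rightarrow> real" where "A t = integral {0..t} Q"

lemma dA: "t \<in> {0..T} \<Longrightarrow> (A has_real_derivative Q t) (at t within {0..T})"
  unfolding A_def by (rule integral_has_real_derivative[OF Q_cont])

lemma A_nonneg: assumes "t \<in> {0..T}" shows "0 \<le> A t"
proof -
  have "Q integrable_on {0..t}"
    by (intro integrable_continuous_real continuous_on_subset[OF Q_cont]) (use assms in auto)
  then show ?thesis
    unfolding A_def using Q_ge Q0 assms
    by (intro Henstock_Kurzweil_Integration.integral_nonneg) (auto intro: order_trans[OF less_imp_le[OF Q0]])
qed

text \<open>
  This is \<open>\<integral>Q' \<le> \<mu> \<integral>Q + \<mu>\<^sup>-\<^sup>1 \<integral>(Q'/(2 \<surd>Q))\<^sup>2\<close>; it is obtained by subdivision, since \<open>E\<close> is not known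
  to be differentiable.
\<close>

lemma Q_increase:
  assumes \<mu>: "0 < \<mu>" and t: "t \<in> {0..T}"
  shows "Q t - Q 0 \<le> \<mu> * A t + E t / \<mu>"
proof (rule field_le_epsilon)
  fix e' :: real assume e': "0 < e'"
  define e where "e = e' / T"
  have e: "0 < e" using e' T by (simp add: e_def)
  \<comment> \<open>Every term is additive over adjacent intervals, so Bolzano's lemma reduces the
    estimate to short ones. The slack \<open>e * (b - a)\<close> pays for the oscillation of
    \<open>Q\<close> there.\<close>
  define P where "P a b \<longleftrightarrow> (0 \<le> a \<and> b \<le> T \<longrightarrow> Q b - Q a \<le> \<mu> * (A b - A a) + (E b - E a) / \<mu> + e * (b - a))" for a b
  have "P 0 t"
  proof (rule Bolzano)
    show "0 \<le> t" using t by simp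
    show "P a c" if "P a b" "P b c" "a \<le> b" "b \<le> c" for a b c
    proof (unfold P_def, intro impI)
      assume *: "0 \<le> a \<and> c \<le> T"
      then have "Q b - Q a \<le> \<mu> * (A b - A a) + (E b - E a) / \<mu> + e * (b - a)"
        "Q c - Q b \<le> \<mu> * (A c - A b) + (E c - E b) / \<mu> + e * (c - b)"
        using that by (auto simp: P_def)
      moreover have "\<mu> * (A c - A a) + (E c - E a) / \<mu> + e * (c - a) =
          (\<mu> * (A b - A a) + (E b - E a) / \<mu> + e * (b - a)) + (\<mu> * (A c - A b) + (E c - E b) / \<mu> + e * (c - b))"
        by (simp add: algebra_simps diff_divide_distrib)
      ultimately show "Q c - Q a \<le> \<mu> * (A c - A a) + (E c - E a) / \<mu> + e * (c - a)" by linarith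
    qed
    fix x assume x: "0 \<le> x" "x \<le> t"
    then have xT: "x \<in> {0..T}" using t by auto
    obtain d where d: "d > 0" "\<And>z. z \<in> {0..T} \<Longrightarrow> \<bar>z - x\<bar> < d \<Longrightarrow> \<bar>Q z - Q x\<bar> < e / (2 * \<mu>)"
      using Q_cont xT e \<mu> unfolding continuous_on_iff dist_real_def
      by (metis divide_pos_pos mult_pos_pos zero_less_numeral)
    show "\<exists>d>0. \<forall>a b. a \<le> x \<and> x \<le> b \<and> b - a < d \<longrightarrow> P a b"
    proof (intro exI[of _ d] conjI d(1) allI impI, unfold P_def, intro impI)
      fix a b assume ab: "a \<le> x \<and> x \<le> b \<and> b - a < d" and r: "0 \<le> a \<and> b \<le> T"
      show "Q b - Q a \<le> \<mu> * (A b - A a) + (E b - E a) / \<mu> + e * (b - a)"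
      proof (cases "a = b")
        case False
        define h where "h = b - a"
        have h: "h > 0" using ab False by (simp add: h_def)
        have near: "\<bar>Q z - Q x\<bar> < e / (2 * \<mu>)" if "z \<in> {a..b}" for z
          using d(2)[of z] that ab r by auto
        obtain z where z: "z \<in> {a..b}" "A b - A a = Q z * h"
          using MVT_within[of a b "{0..T}" A Q] dA ab r by (auto simp: h_def)
        have nn: "0 \<le> Q a" "0 \<le> Q b" using Q_ge[of a] Q_ge[of b] Q0 ab r by auto
        \<comment> \<open>The increment of \<open>Q\<close> is \<open>X * Y\<close>:
          \<open>inc\<close> controls \<open>X\<close>, while the square of \<open>Y\<close> is at
          most \<open>2 * (Q a + Q b)\<close>, hence close to \<open>4 * Q z\<close> or below.
          Young's inequality with weight \<open>\<mu> * h\<close> joins the two.\<close>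
        define X Y where "X = sqrt (Q b) - sqrt (Q a)" and "Y = sqrt (Q b) + sqrt (Q a)"
        have XY: "Q b - Q a = X * Y" using nn by (simp add: X_def Y_def algebra_simps)
        have "X\<^sup>2 \<le> h * (E b - E a)" using inc[of a b] ab r by (simp add: X_def h_def)
        then have X2: "X\<^sup>2 / (\<mu> * h) \<le> (E b - E a) / \<mu>" using h \<mu> by (simp add: field_simps)
        have "Y\<^sup>2 = 2 * (Q a + Q b) - X\<^sup>2" using nn by (simp add: X_def Y_def power2_eq_square algebra_simps)
        then have "Y\<^sup>2 \<le> 2 * (Q a + Q b)" using zero_le_power2[of X] by linarith
        moreover have "2 * (Q a + Q b) \<le> 4 * (Q z + e / \<mu>)"
        proof -
          define \<delta> where "\<delta> = e / (2 * \<mu>)"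
          have "Q a \<le> Q x + \<delta>" "Q b \<le> Q x + \<delta>" "Q x \<le> Q z + \<delta>"
            using near[of a] near[of b] near[OF z(1)] ab unfolding \<delta>_def[symmetric] by auto
          then have "2 * (Q a + Q b) \<le> 4 * (Q z + 2 * \<delta>)" by (simp add: distrib_left)
          moreover have "e / \<mu> = 2 * \<delta>" by (simp add: \<delta>_def)
          ultimately show ?thesis by (simp only:)
        qed
        ultimately have "Y\<^sup>2 \<le> 4 * (Q z + e / \<mu>)" by linarith
        then have "\<mu> * h / 4 * Y\<^sup>2 \<le> \<mu> * h / 4 * (4 * (Q z + e / \<mu>))" using h \<mu> by (intro mult_left_mono) auto
        also have "\<dots> = \<mu> * (A b - A a) + e * h" using \<mu> by (simp add: z(2) distrib_left)
        finally have Y2: "\<mu> * h * Y\<^sup>2 / 4 \<le> \<mu> * (A b - A a) + e * h" by simp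
        have "X\<^sup>2 / (\<mu> * h) + \<mu> * h * Y\<^sup>2 / 4 - X * Y = (X - \<mu> * h * Y / 2)\<^sup>2 / (\<mu> * h)"
          using h \<mu> by (simp add: power2_eq_square field_simps)
        moreover have "0 \<le> (X - \<mu> * h * Y / 2)\<^sup>2 / (\<mu> * h)" using h \<mu> by simp
        ultimately show ?thesis using X2 Y2 unfolding XY h_def by linarith
      qed simp
    qed
  qed
  then have "Q t - Q 0 \<le> \<mu> * (A t - A 0) + (E t - E 0) / \<mu> + e * (t - 0)" using t by (simp add: P_def)
  moreover have "e * t \<le> e'"
  proof -
    have "e * t \<le> e * T" using t e by (intro mult_left_mono) auto
    then show ?thesis using T by (simp add: e_def)
  qed
  ultimately show "Q t - Q 0 \<le> \<mu> * A t + E t / \<mu> + e'" by (simp add: A_def E0)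
qed

text \<open>The largest \<open>B\<close> with \<open>p * \<beta> + B \<ge> p * B\<close>, so that
  \<open>Q' + 2 * B \<ge> 2 * p * (E + B)\<close>. The final bound is inversely proportional to
  \<open>B\<close>.\<close>

definition B :: real where "B = p * \<beta> / (p - 1)"
text \<open>A general shift gives \<open>T * ((p - 2) * B * \<tau>0 - Q 0) < B * \<tau>0^2\<close>
  for a positive bracket; this value minimises the resulting bound on \<open>T\<close>.\<close>

definition \<tau>0 :: real where "\<tau>0 = 2 * Q 0 / ((p - 2) * B)"
text \<open>Levine's auxiliary function. The linear term removes \<open>Q 0\<close> from the
  derivative, which leaves the increment that \<open>Q_increase\<close> controls, and it is
  nonnegative up to time \<open>T\<close>.\<close>

definition F :: "real \<Rightarrow> real" where "F t = A t + (T - t) * Q 0 + B * (t + \<tau>0)\<^sup>2"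
definition F' :: "real \<Rightarrow> real" where "F' t = Q t - Q 0 + 2 * B * (t + \<tau>0)"

lemma B_pos: "0 < B" and \<tau>0_pos: "0 < \<tau>0"
  using p \<beta> Q0 by (simp_all add: B_def \<tau>0_def)

lemma F'_pos: assumes "t \<in> {0..T}" shows "0 < F' t"
proof -
  have "0 < 2 * B * (t + \<tau>0)" using B_pos \<tau>0_pos assms by simp
  then show ?thesis using Q_ge[OF assms] by (simp add: F'_def)
qed

lemma F'_square:
  assumes t: "t \<in> {0..T}"
  shows "(F' t)\<^sup>2 \<le> 4 * F t * (E t + B)"
proof -
  define X Y where "X = A t + B * (t + \<tau>0)\<^sup>2" and "Y = E t + B"
  have Bs: "0 < B * (t + \<tau>0)\<^sup>2" using B_pos \<tau>0_pos t by simp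
  have X: "0 < X" using A_nonneg[OF t] Bs by (simp add: X_def)
  have Y: "0 < Y" using E_nonneg[OF t] B_pos by (simp add: Y_def)
  \<comment> \<open>The minimiser of \<open>\<mu> * X + Y / \<mu>\<close>, whose minimum is
    \<open>2 * sqrt (X * Y)\<close>.\<close>
  define \<mu> where "\<mu> = sqrt (Y / X)"
  have \<mu>: "0 < \<mu>" using X Y by (simp add: \<mu>_def)
  have \<mu>2: "\<mu>\<^sup>2 * X = Y" using X Y by (simp add: \<mu>_def)
  have "\<mu> * (B * (t + \<tau>0)\<^sup>2) + B / \<mu> - 2 * B * (t + \<tau>0) = B * (\<mu> * (t + \<tau>0) - 1)\<^sup>2 / \<mu>"
    using \<mu> by (simp add: power2_eq_square field_simps)
  moreover have "0 \<le> B * (\<mu> * (t + \<tau>0) - 1)\<^sup>2 / \<mu>" using B_pos \<mu> by simp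
  ultimately have "2 * B * (t + \<tau>0) \<le> \<mu> * (B * (t + \<tau>0)\<^sup>2) + B / \<mu>" by linarith
  then have "F' t \<le> \<mu> * X + Y / \<mu>"
    using Q_increase[OF \<mu> t] by (simp add: F'_def X_def Y_def distrib_left add_divide_distrib)
  also have "\<dots> = 2 * \<mu> * X" using \<mu> by (simp add: \<mu>2[symmetric] power2_eq_square)
  finally have "(F' t)\<^sup>2 \<le> (2 * \<mu> * X)\<^sup>2" using F'_pos[OF t] by (intro power_mono) auto
  also have "\<dots> = 4 * X * (\<mu>\<^sup>2 * X)" by (simp add: power2_eq_square)
  also have "\<dots> = 4 * X * Y" by (simp only: \<mu>2)
  also have "\<dots> \<le> 4 * F t * Y"
    using Y t Q0 by (intro mult_right_mono) (auto simp: F_def X_def)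
  finally show ?thesis by (simp add: Y_def)
qed

lemma time_bound: "T \<le> 4 * (p - 1) / (p * (p - 2)\<^sup>2) * (Q 0 / \<beta>)"
proof -
  have dF: "(F has_real_derivative F' t) (at t within {0..T})" if "t \<in> {0..T}" for t
    unfolding F_def[abs_def] F'_def by (auto intro!: derivative_eq_intros dA that)
  have dF': "(F' has_real_derivative q t + 2 * B) (at t within {0..T})" if "t \<in> {0..T}" for t
    unfolding F'_def[abs_def] by (auto intro!: derivative_eq_intros dQ that)
  define g where "g t = F t / F' t" for t
  define g' where "g' t = (F' t * F' t - F t * (q t + 2 * B)) / (F' t * F' t)" for t
  have dg: "(g has_real_derivative g' t) (at t within {0..T})" if "t \<in> {0..T}" for t
    unfolding g_def[abs_def] g'_def using F'_pos[OF that] by (intro DERIV_divide dF dF' that) simp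
  have Fpos: "0 < F t" if "t \<in> {0..T}" for t
  proof -
    have "0 < B * (t + \<tau>0)\<^sup>2" using B_pos \<tau>0_pos that by simp
    moreover have "0 \<le> (T - t) * Q 0" using that Q0 by simp
    ultimately show ?thesis using A_nonneg[OF that] by (simp add: F_def)
  qed
  have g'_le: "g' t \<le> 1 - p / 2" if t: "t \<in> {0..T}" for t
  proof -
    have "2 * p * (\<beta> + E t) + 2 * B = 2 * p * (E t + B)"
      using p by (simp add: B_def field_simps)
    then have "2 * p * (E t + B) \<le> q t + 2 * B" using q_low[OF t] by linarith
    then have "F t * (2 * p * (E t + B)) \<le> F t * (q t + 2 * B)" using Fpos[OF t] by (intro mult_left_mono) auto
    moreover have "p / 2 * (F' t)\<^sup>2 \<le> p / 2 * (4 * F t * (E t + B))"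
      using F'_square[OF t] p by (intro mult_left_mono) auto
    ultimately have "F' t * F' t - F t * (q t + 2 * B) \<le> (1 - p / 2) * (F' t * F' t)"
      by (simp add: power2_eq_square algebra_simps)
    then show ?thesis using F'_pos[OF t] by (simp add: g'_def divide_le_eq)
  qed
  \<comment> \<open>A positive function whose slope is at most \<open>1 - p / 2\<close> must start
    above \<open>(p / 2 - 1) * T\<close>.\<close>
  obtain x where x: "x \<in> {0..T}" "g T - g 0 = g' x * (T - 0)"
    using MVT_within[of 0 T "{0..T}" g g'] dg T by auto
  have "g' x * T \<le> (1 - p / 2) * T" using g'_le[OF x(1)] T by (intro mult_right_mono) auto
  moreover have "0 < g T" using Fpos[of T] F'_pos[of T] T by (simp add: g_def)
  ultimately have "(p / 2 - 1) * T < g 0" using x(2) by (simp add: algebra_simps)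
  also have "g 0 = (T * Q 0 + B * \<tau>0\<^sup>2) / (2 * B * \<tau>0)" by (simp add: g_def F_def F'_def A_def)
  finally have "(p / 2 - 1) * T * (2 * B * \<tau>0) < T * Q 0 + B * \<tau>0\<^sup>2"
    using B_pos \<tau>0_pos by (simp add: less_divide_eq)
  \<comment> \<open>The chosen \<open>\<tau>0\<close> makes the left side twice the term
    \<open>T * Q 0\<close> on the right, so one copy can be absorbed.\<close>
  moreover have "(p / 2 - 1) * T * (2 * B * \<tau>0) = 2 * Q 0 * T"
    using p B_pos by (simp add: \<tau>0_def field_simps)
  ultimately have "Q 0 * T < B * \<tau>0\<^sup>2" by (simp add: algebra_simps)
  also have "\<dots> = Q 0 * (4 * (p - 1) / (p * (p - 2)\<^sup>2) * (Q 0 / \<beta>))"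
  proof -
    have "B * \<tau>0\<^sup>2 = 4 * (Q 0)\<^sup>2 / ((p - 2)\<^sup>2 * B)"
      using B_pos p by (simp add: \<tau>0_def power_divide power_mult_distrib) (simp add: power2_eq_square)
    also have "\<dots> = Q 0 * (4 * (p - 1) / (p * (p - 2)\<^sup>2) * (Q 0 / \<beta>))"
      using p \<beta> by (simp add: B_def power2_eq_square field_simps)
    finally show ?thesis .
  qed
  finally have "T < 4 * (p - 1) / (p * (p - 2)\<^sup>2) * (Q 0 / \<beta>)"
    using Q0 by (simp only: mult_less_cancel_left_pos)
  then show ?thesis by simp
qed

end

section \<open>The potential well\<close>

lemma first_nonpositive:
  fixes h :: "real \<Rightarrow> real"
  assumes c: "continuous_on {0..t} h" and t: "0 \<le> t" "h t \<le> 0"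
  obtains t0 where "t0 \<in> {0..t}" "h t0 \<le> 0" "\<And>s. s \<in> {0..<t0} \<Longrightarrow> 0 < h s"
proof -
  let ?Z = "{s \<in> {0..t}. h s \<le> 0}"
  have "closed ?Z" by (intro continuous_on_closed_Collect_le c continuous_on_const) simp
  then have "compact ?Z" by (auto simp: compact_eq_bounded_closed intro: bounded_subset[of "{0..t}"])
  moreover have "?Z \<noteq> {}" using t by auto
  ultimately obtain t0 where t0: "t0 \<in> ?Z" "\<And>s. s \<in> ?Z \<Longrightarrow> t0 \<le> s"
    using compact_attains_inf[of ?Z] by blast
  show ?thesis
  proof (rule that)
    show "0 < h s" if "s \<in> {0..<t0}" for s using t0(1) t0(2)[of s] that by (cases "h s \<le> 0") auto
  qed (use t0(1) in auto)
qed

section \<open>The Nehari manifold and the constants S1 and S2\<close>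

context trace_setting
begin

lemma K_J_values:
  assumes "0 < p"
  shows "K \<Omega> p w = (norm_grad \<Omega> w)\<^sup>2 - (\<integral>x. \<bar>w x\<bar> powr p \<partial>LO)"
    and "J \<Omega> p w = (norm_grad \<Omega> w)\<^sup>2 / 2 - (\<integral>x. \<bar>w x\<bar> powr p \<partial>LO) / p"
  using Lq_norm_powr[OF assms, of LO w] by (simp_all add: K_def J_def)

text \<open>The infimum is a genuine lower bound because \<open>J\<close> is a positive multiple of
  the squared gradient norm on the Nehari manifold, hence bounded below there.\<close>

lemma well_depth_le:
  assumes p: "2 < p" and w: "w \<in> X0" "K \<Omega> p w = 0" "\<not> ae_zero \<Omega> w"
  shows "well_depth \<Omega> \<Gamma>0 p \<le> J \<Omega> p w"
  unfolding well_depth_def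
proof (rule cINF_lower)
  show "w \<in> Nehari \<Omega> \<Gamma>0 p" using w by (simp add: Nehari_def)
  have "0 \<le> J \<Omega> p z" if "z \<in> Nehari \<Omega> \<Gamma>0 p" for z
  proof -
    have "J \<Omega> p z = (norm_grad \<Omega> z)\<^sup>2 * (1 / 2 - 1 / p)"
      using that p K_J_values[of p z] by (simp add: Nehari_def right_diff_distrib)
    then show ?thesis using p by simp
  qed
  then show "bdd_below (J \<Omega> p ` Nehari \<Omega> \<Gamma>0 p)" by (rule bdd_belowI2)
qed

text \<open>If \<open>K w < 0\<close>, then a multiple \<open>c w\<close> with \<open>0 < c < 1\<close> lies on the Nehari manifold.\<close>

lemma well_depth_le_grad:
  assumes p: "2 < p" and w: "w \<in> X0" "K \<Omega> p w < 0"
  shows "well_depth \<Omega> \<Gamma>0 p \<le> (p - 2) / (2 * p) * (norm_grad \<Omega> w)\<^sup>2"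
proof -
  define a where "a = (norm_grad \<Omega> w)\<^sup>2"
  define I where "I = (\<integral>x. \<bar>w x\<bar> powr p \<partial>LO)"
  have p0: "0 < p" using p by simp
  have aI: "a < I" using w(2) K_J_values(1)[OF p0, of w] by (simp add: a_def I_def)
  have nz: "\<not> ae_zero \<Omega> w"
  proof
    assume "ae_zero \<Omega> w"
    then have "I = 0" unfolding I_def ae_zero_def by (intro integral_eq_zero_AE) (auto elim: eventually_mono)
    then show False using aI by (simp add: a_def)
  qed
  then have "norm_grad \<Omega> w \<noteq> 0" using norm_grad_eq_0_ae_zero[OF w(1)] by blast
  then have a: "0 < a" by (simp add: a_def)
  \<comment> \<open>The solution of \<open>c powr p * I = c^2 * a\<close>, that is of
    \<open>K (c w) = 0\<close>; it is at most 1 because \<open>a < I\<close>.\<close>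
  define c where "c = (a / I) powr (1 / (p - 2))"
  have c: "0 < c" "c \<le> 1" using a aI p by (auto simp: c_def intro!: powr_le1)
  have "c powr (p - 2) = a / I" using a aI p by (simp add: c_def powr_powr)
  then have cp: "c powr p * I = c\<^sup>2 * a"
    using powr_add[of c "p - 2" 2] norm_powr_2[of c] c a aI by simp
  let ?w = "\<lambda>x. c * w x"
  have g: "(norm_grad \<Omega> ?w)\<^sup>2 = c\<^sup>2 * a"
    using norm_grad_scale[OF H1_0_H1[OF w(1)], of c] by (simp add: a_def power_mult_distrib)
  have "(\<integral>x. \<bar>?w x\<bar> powr p \<partial>LO) = c powr p * I"
    using c by (simp add: I_def abs_mult powr_mult)
  then have i: "(\<integral>x. \<bar>?w x\<bar> powr p \<partial>LO) = c\<^sup>2 * a" by (simp add: cp)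
  have nzw: "\<not> ae_zero \<Omega> ?w" using nz c by (simp add: ae_zero_def)
  have "K \<Omega> p ?w = 0" by (simp only: K_J_values(1)[OF p0] g i diff_self)
  then have "well_depth \<Omega> \<Gamma>0 p \<le> J \<Omega> p ?w"
    by (rule well_depth_le[OF p H1_0_scale[OF w(1)] _ nzw])
  also have "\<dots> = (p - 2) / (2 * p) * (c\<^sup>2 * a)"
    unfolding K_J_values(2)[OF p0] g i using p by (simp add: field_simps)
  also have "\<dots> \<le> (p - 2) / (2 * p) * a"
    using p a c by (intro mult_left_mono mult_left_le_one_le) (auto simp: power_le_one)
  finally show ?thesis by (simp add: a_def)
qed

lemma ae_zero_norms:
  assumes w: "w \<in> X0" "ae_zero \<Omega> w"
  shows "norm_grad \<Omega> w = 0" "norm_Om 2 \<Omega> w = 0" "norm_Gam \<Omega> \<Gamma>1 w = 0"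
proof -
  have "grad \<Omega> w = grad \<Omega> (\<lambda>x. 0)"
    by (rule H1_cong_AE) (use w H1_0_H1 zero_H1_0 in \<open>auto simp: ae_zero_def\<close>)
  then show g: "norm_grad \<Omega> w = 0" using norm_grad_zero by simp
  show "norm_Om 2 \<Omega> w = 0" "norm_Gam \<Omega> \<Gamma>1 w = 0"
    using CP(2)[OF w(1)] CP(3)[OF w(1) bd_trace_is_trace[OF w(1)]] g by simp_all
qed

text \<open>The Poincare constant bounds both families of quotients, so the suprema are attained as
  upper bounds in the reals. The nonzero element \<open>z\<close> keeps the index set nonempty and
  makes \<open>S2\<close> positive.\<close>

lemma S1_S2_bound:
  assumes z: "z \<in> X0" "\<not> ae_zero \<Omega> z"
  shows "0 < S1 \<Omega> \<Gamma>0 \<Gamma>1 + S2 \<Omega> \<Gamma>0"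
    and "w \<in> X0 \<Longrightarrow> (norm_Om 2 \<Omega> w)\<^sup>2 + (norm_Gam \<Omega> \<Gamma>1 w)\<^sup>2 \<le> (S1 \<Omega> \<Gamma>0 \<Gamma>1 + S2 \<Omega> \<Gamma>0) * (norm_grad \<Omega> w)\<^sup>2"
proof -
  let ?W = "{w \<in> X0. \<not> ae_zero \<Omega> w}"
  let ?f1 = "\<lambda>w. (norm_Gam \<Omega> \<Gamma>1 w)\<^sup>2 / (norm_grad \<Omega> w)\<^sup>2" and ?f2 = "\<lambda>w. (norm_Om 2 \<Omega> w)\<^sup>2 / (norm_grad \<Omega> w)\<^sup>2"
  have g: "0 < (norm_grad \<Omega> w)\<^sup>2" if "w \<in> ?W" for w
    using that norm_grad_eq_0_ae_zero[of w] by auto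
  have "?f1 w \<le> CP" "?f2 w \<le> CP" if "w \<in> ?W" for w
    using that g[OF that] CP(2)[of w] CP(3)[of w, OF _ bd_trace_is_trace] by (auto simp: divide_le_eq)
  then have bdd: "bdd_above (?f1 ` ?W)" "bdd_above (?f2 ` ?W)" by (auto intro!: bdd_aboveI2)
  have up: "?f1 w \<le> S1 \<Omega> \<Gamma>0 \<Gamma>1" "?f2 w \<le> S2 \<Omega> \<Gamma>0" if "w \<in> ?W" for w
    unfolding S1_def S2_def by (rule cSUP_upper[OF that]; fact bdd)+
  have zW: "z \<in> ?W" using z by simp
  have "0 \<le> ?f1 z" by simp
  moreover have "norm_Om 2 \<Omega> z \<noteq> 0"
    using z L2_norm_eq_0_iff[OF H1_L2[OF H1_0_H1[OF z(1)]]] by (simp add: ae_zero_def)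
  then have "0 < ?f2 z" using g[OF zW] by simp
  ultimately show "0 < S1 \<Omega> \<Gamma>0 \<Gamma>1 + S2 \<Omega> \<Gamma>0" using up[OF zW] by linarith
  show "(norm_Om 2 \<Omega> w)\<^sup>2 + (norm_Gam \<Omega> \<Gamma>1 w)\<^sup>2 \<le> (S1 \<Omega> \<Gamma>0 \<Gamma>1 + S2 \<Omega> \<Gamma>0) * (norm_grad \<Omega> w)\<^sup>2" if w: "w \<in> X0"
  proof (cases "ae_zero \<Omega> w")
    case True
    then show ?thesis using ae_zero_norms[OF w] by simp
  next
    case False
    then have W: "w \<in> ?W" using w by simp
    show ?thesis using up[OF W] g[OF W] by (simp add: divide_le_eq distrib_right)
  qed
qed

end

section \<open>Invariance of the two data sets and the bound on the existence time\<close>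

context evolution
begin

text \<open>Negativity of \<open>K\<close> is required only before \<open>T\<close>, since
  \<open>T\<close> will be a first time at which it might fail. Continuity of \<open>Q\<close>
  includes the endpoint.\<close>

lemma Q_mono:
  assumes T: "T \<in> Dom" and h: "\<And>s. s \<in> {0..<T} \<Longrightarrow> N2 s < PHI s"
  shows "Q 0 \<le> Q T"
proof (cases "T = 0")
  case False
  then have T0: "0 < T" using Dom_nonneg[OF T] by simp
  have sub: "{0..T} \<subseteq> Dom" using Dom_mono[OF T] by auto
  have ge: "Q 0 \<le> Q s" if s: "s \<in> {0..<T}" for s
  proof -
    have "s \<in> Dom" using s sub by auto
    then obtain x where x: "x \<in> {0..s}" "Q s - Q 0 = 2 * (PHI x - N2 x) * (s - 0)"
      using MVT_within[of 0 s "{0..s}" Q "\<lambda>x. 2 * (PHI x - N2 x)"] Q_has_derivative[of s] h s by auto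
    have "N2 x < PHI x" using h[of x] x(1) s by auto
    then have "0 \<le> 2 * (PHI x - N2 x) * (s - 0)" using s by simp
    then show ?thesis using x(2) by linarith
  qed
  show ?thesis
  proof (rule continuous_ge_on_closure[where S="{0..<T}" and f=Q and x=T and a="Q 0"])
    have cl: "closure {0..<T} = {0..T}" using T0 by simp
    show "continuous_on (closure {0..<T}) Q" unfolding cl by (rule continuous_on_subset[OF Q_continuous sub])
    show "T \<in> closure {0..<T}" unfolding cl using T0 by simp
  qed (rule ge)
qed simp

text \<open>Splits \<open>- K\<close> into a gradient term and an energy term. The energy decays by
  exactly \<open>E\<close>, so each data set only has to bound the gradient term from below.\<close>

lemma PHI_minus_N2: "PHI t - N2 t = (p - 2) / 2 * N2 t - p * J \<Omega> p (u t)"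
  using p by (simp add: J_eq field_simps)

lemma Q_zero: "Q 0 = (norm_Om 2 \<Omega> u0)\<^sup>2 + (norm_Gam \<Omega> \<Gamma>1 u0)\<^sup>2"
  using Q_norms[OF zero_Dom] u0_cong(2) u0_cong(3)[of 2] by simp

lemma K_u0: "K \<Omega> p u0 = N2 0 - PHI 0"
  using K_eq[of 0] u0_cong(1) u0_cong(3)[of p] by (simp add: K_def)

lemma u0_Q_pos: "\<not> ae_zero \<Omega> u0 \<Longrightarrow> 0 < Q 0"
  using L2_norm_eq_0_iff[OF H1_L2[OF H1_0_H1[OF u0]]] unfolding Q_zero ae_zero_def
  by (simp add: add_pos_nonneg)

text \<open>If \<open>Tmax\<close> exceeded the bound, the solution would exist on some
  \<open>[0, T]\<close> with \<open>T\<close> above the bound, contrary to the concavity argument on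
  that interval.\<close>

lemma Tmax_bound:
  assumes \<beta>: "0 < \<beta>" and Q0: "0 < Q 0" and low: "\<And>t. t \<in> Dom \<Longrightarrow> p * (\<beta> + E t) \<le> PHI t - N2 t"
  shows "Tmax \<le> ereal (4 * (p - 1) / (p * (p - 2)\<^sup>2) * (Q 0 / \<beta>))"
proof (rule ccontr)
  define c where "c = 4 * (p - 1) / (p * (p - 2)\<^sup>2) * (Q 0 / \<beta>)"
  have c: "0 < c" using p \<beta> Q0 by (simp add: c_def)
  assume "\<not> Tmax \<le> ereal (4 * (p - 1) / (p * (p - 2)\<^sup>2) * (Q 0 / \<beta>))"
  then have "ereal c < Tmax" by (simp add: c_def)
  then obtain T where cT: "ereal c < ereal T" "ereal T < Tmax" using ereal_dense2 by blast
  then have TD: "T \<in> Dom" "0 < T" using c by (auto simp: Dom_def)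
  have sub: "t \<in> Dom" if "t \<in> {0..T}" for t using Dom_mono[OF TD(1)] that by auto
  have neg: "N2 t < PHI t" if "t \<in> {0..T}" for t
  proof -
    have "0 \<le> E t" using E_mono[of t 0] E_zero sub[OF that] Dom_nonneg by simp
    then have "0 < p * (\<beta> + E t)" using p \<beta> by simp
    then show ?thesis using low[OF sub[OF that]] by linarith
  qed
  interpret concavity T p \<beta> Q "\<lambda>t. 2 * (PHI t - N2 t)" E
  proof
    show "(Q has_real_derivative 2 * (PHI t - N2 t)) (at t within {0..T})" if "t \<in> {0..T}" for t
      by (rule Q_has_derivative[OF TD(1) that neg[OF that]])
    show "2 * p * (\<beta> + E t) \<le> 2 * (PHI t - N2 t)" if "t \<in> {0..T}" for t
      using low[OF sub[OF that]] by simp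
    show "(sqrt (Q t) - sqrt (Q s))\<^sup>2 \<le> (t - s) * (E t - E s)" if "0 \<le> s" "s \<le> t" "t \<le> T" for s t
      using sqrt_Q_increment that sub by simp
  qed (use TD p \<beta> Q0 E_zero in auto)
  have "T \<le> c" unfolding c_def by (rule time_bound)
  then show False using cT(1) by simp
qed

lemma B1_bound:
  assumes "u0 \<in> B1 \<Omega> \<Gamma>0 p"
  shows "Tmax \<le> ereal (4 * (p - 1) / (p * (p - 2)\<^sup>2) * (Q 0 / (well_depth \<Omega> \<Gamma>0 p - J \<Omega> p u0)))"
proof -
  let ?d = "well_depth \<Omega> \<Gamma>0 p"
  have Jd: "J \<Omega> p u0 < ?d" and K0: "K \<Omega> p u0 < 0" using assms by (auto simp: B1_def)
  have "\<not> ae_zero \<Omega> u0"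
  proof
    assume z: "ae_zero \<Omega> u0"
    then have "(\<integral>x. \<bar>u0 x\<bar> powr p \<partial>LO) = 0"
      unfolding ae_zero_def by (intro integral_eq_zero_AE) (auto elim: eventually_mono)
    then show False using K0 K_J_values(1)[of p u0] p by simp
  qed
  then have Q0: "0 < Q 0" by (rule u0_Q_pos)
  have neg: "N2 t < PHI t" if t: "t \<in> Dom" for t
  proof (rule ccontr)
    assume "\<not> N2 t < PHI t"
    then have ht: "PHI t - N2 t \<le> 0" by simp
    have c: "continuous_on {0..t} (\<lambda>s. PHI s - N2 s)"
      by (intro continuous_intros PHI_continuous[OF t] continuous_on_subset[OF N2_continuous]) (use Dom_mono[OF t] in auto)
    obtain t0 where t0: "t0 \<in> {0..t}" "PHI t0 - N2 t0 \<le> 0" "\<And>s. s \<in> {0..<t0} \<Longrightarrow> 0 < PHI s - N2 s"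
      using first_nonpositive[OF c Dom_nonneg[OF t] ht] by blast
    have t0D: "t0 \<in> Dom" using t0(1) Dom_mono[OF t] by auto
    \<comment> \<open>A sign change passes through a zero, and no zero occurs before the first
      nonpositive time.\<close>
    have zero: "PHI t0 - N2 t0 = 0"
    proof -
      have "\<exists>x\<ge>0. x \<le> t0 \<and> PHI x - N2 x = 0"
        by (rule IVT2') (use t0 K0 K_u0 in \<open>auto intro: continuous_on_subset[OF c]\<close>)
      then obtain x where x: "0 \<le> x" "x \<le> t0" "PHI x - N2 x = 0" by blast
      then have "x = t0" using t0(3)[of x] by force
      then show ?thesis using x by simp
    qed
    \<comment> \<open>Growth of \<open>Q\<close> excludes that \<open>u t0\<close> vanishes, so
      \<open>u t0\<close> lies on the Nehari manifold and \<open>J (u t0)\<close> is at least the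
      well depth, although \<open>J\<close> has not increased from a value below it.\<close>
    have "Q 0 \<le> Q t0" by (rule Q_mono[OF t0D]) (use t0(3) in auto)
    then have "\<not> ae_zero \<Omega> (u t0)"
      using Q0 ae_zero_norms[OF u_X0[OF t0D]] Q_norms[OF t0D] by auto
    then have "?d \<le> J \<Omega> p (u t0)"
      by (intro well_depth_le[OF p u_X0[OF t0D]]) (use zero K_eq in auto)
    then show False using J_E[OF t0D] E_mono[OF t0D order_refl Dom_nonneg[OF t0D]] E_zero Jd by simp
  qed
  show ?thesis
  proof (rule Tmax_bound[OF _ Q0])
    show "0 < ?d - J \<Omega> p u0" using Jd by simp
    fix t assume t: "t \<in> Dom"
    \<comment> \<open>Here the well depth enters the rate: the gradient part of \<open>- K\<close>
      is at least \<open>p * ?d\<close>.\<close>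
    have "?d \<le> (p - 2) / (2 * p) * N2 t"
      using well_depth_le_grad[OF p u_X0[OF t]] neg[OF t] K_eq[of t] by (simp add: N2_def)
    then have "p * ?d \<le> p * ((p - 2) / (2 * p) * N2 t)" using p by (intro mult_left_mono) auto
    also have "\<dots> = (p - 2) / 2 * N2 t" using p by simp
    finally show "p * (?d - J \<Omega> p u0 + E t) \<le> PHI t - N2 t"
      unfolding PHI_minus_N2 J_E[OF t] by (simp add: algebra_simps)
  qed
qed

text \<open>A bootstrap for \<open>\<alpha> * Q - J\<close>. While it is positive,
  \<open>K < 0\<close>, so \<open>Q\<close> does not decrease; \<open>J\<close> never increases,
  hence the difference stays above its positive initial value and cannot reach 0.\<close>

lemma B2_bound:
  assumes "u0 \<in> B2 \<Omega> \<Gamma>0 \<Gamma>1 p"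
  shows "Tmax \<le> ereal (4 * (p - 1) / (p * (p - 2)\<^sup>2) *
    (Q 0 / ((p - 2) / (2 * p * (S1 \<Omega> \<Gamma>0 \<Gamma>1 + S2 \<Omega> \<Gamma>0)) * Q 0 - J \<Omega> p u0)))"
proof -
  define S where "S = S1 \<Omega> \<Gamma>0 \<Gamma>1 + S2 \<Omega> \<Gamma>0"
  define \<alpha> where "\<alpha> = (p - 2) / (2 * p * S)"
  have J0: "J \<Omega> p u0 < \<alpha> * Q 0" using assms unfolding B2_def \<alpha>_def Q_zero S_def by blast
  \<comment> \<open>For a null datum both sides of the strict inequality that defines
    \<open>B2\<close> are 0.\<close>
  have nz: "\<not> ae_zero \<Omega> u0"
  proof
    assume z: "ae_zero \<Omega> u0"
    then have "(\<integral>x. \<bar>u0 x\<bar> powr p \<partial>LO) = 0"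
      unfolding ae_zero_def by (intro integral_eq_zero_AE) (auto elim: eventually_mono)
    then show False using J0 K_J_values(2)[of p u0] p ae_zero_norms[OF u0 z] by (simp add: Q_zero)
  qed
  then have Q0: "0 < Q 0" by (rule u0_Q_pos)
  note S = S1_S2_bound[OF u0 nz, folded S_def]
  have \<alpha>: "0 < \<alpha>" using S(1) p by (simp add: \<alpha>_def)
  have low: "p * (\<alpha> * Q t - J \<Omega> p (u t)) \<le> PHI t - N2 t" if t: "t \<in> Dom" for t
  proof -
    have "Q t \<le> S * N2 t" using S(2)[OF u_X0[OF t]] by (simp add: Q_norms[OF t] N2_def)
    then have "p * \<alpha> * Q t \<le> p * \<alpha> * (S * N2 t)" using p \<alpha> by (intro mult_left_mono) auto
    also have "\<dots> = (p - 2) / 2 * N2 t" using p S(1) by (simp add: \<alpha>_def)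
    finally show ?thesis unfolding PHI_minus_N2 by (simp add: algebra_simps)
  qed
  have mono: "\<alpha> * Q 0 - J \<Omega> p u0 + E t \<le> \<alpha> * Q t - J \<Omega> p (u t)"
    if t: "t \<in> Dom" and h: "\<And>s. s \<in> {0..<t} \<Longrightarrow> 0 < \<alpha> * Q s - J \<Omega> p (u s)" for t
  proof -
    have "Q 0 \<le> Q t"
    proof (rule Q_mono[OF t])
      fix s assume s: "s \<in> {0..<t}"
      then have "0 < p * (\<alpha> * Q s - J \<Omega> p (u s))" using h[OF s] p by simp
      moreover have "s \<in> Dom" using s Dom_mono[OF t] by auto
      ultimately show "N2 s < PHI s" using low[of s] by linarith
    qed
    then have "\<alpha> * Q 0 \<le> \<alpha> * Q t" using \<alpha> by simp
    then show ?thesis using J_E[OF t] by simp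
  qed
  have E_nonneg: "0 \<le> E t" if "t \<in> Dom" for t
    using E_mono[OF that order_refl Dom_nonneg[OF that]] E_zero by simp
  have pos: "0 < \<alpha> * Q t - J \<Omega> p (u t)" if t: "t \<in> Dom" for t
  proof (rule ccontr)
    assume "\<not> 0 < \<alpha> * Q t - J \<Omega> p (u t)"
    then have ht: "\<alpha> * Q t - (J \<Omega> p u0 - E t) \<le> 0" using J_E[OF t] by simp
    have sub: "{0..t} \<subseteq> Dom" using Dom_mono[OF t] by auto
    have c: "continuous_on {0..t} (\<lambda>s. \<alpha> * Q s - (J \<Omega> p u0 - E s))"
      by (intro continuous_intros E_continuous[OF t] continuous_on_subset[OF Q_continuous sub])
    obtain t0 where t0: "t0 \<in> {0..t}" "\<alpha> * Q t0 - (J \<Omega> p u0 - E t0) \<le> 0"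
      "\<And>s. s \<in> {0..<t0} \<Longrightarrow> 0 < \<alpha> * Q s - (J \<Omega> p u0 - E s)"
      using first_nonpositive[OF c Dom_nonneg[OF t] ht] by blast
    have t0D: "t0 \<in> Dom" using t0(1) sub by auto
    have "\<alpha> * Q 0 - J \<Omega> p u0 + E t0 \<le> \<alpha> * Q t0 - J \<Omega> p (u t0)"
    proof (rule mono[OF t0D])
      fix s assume s: "s \<in> {0..<t0}"
      then have "s \<in> Dom" using Dom_mono[OF t0D] by auto
      then show "0 < \<alpha> * Q s - J \<Omega> p (u s)" using t0(3)[OF s] J_E by simp
    qed
    then show False using t0(2) J_E[OF t0D] J0 E_nonneg[OF t0D] by simp
  qed
  have "Tmax \<le> ereal (4 * (p - 1) / (p * (p - 2)\<^sup>2) * (Q 0 / (\<alpha> * Q 0 - J \<Omega> p u0)))"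
  proof (rule Tmax_bound[OF _ Q0])
    show "0 < \<alpha> * Q 0 - J \<Omega> p u0" using J0 by simp
    fix t assume t: "t \<in> Dom"
    have "\<alpha> * Q 0 - J \<Omega> p u0 + E t \<le> \<alpha> * Q t - J \<Omega> p (u t)"
      by (rule mono[OF t]) (use pos Dom_mono[OF t] in auto)
    then have "p * (\<alpha> * Q 0 - J \<Omega> p u0 + E t) \<le> p * (\<alpha> * Q t - J \<Omega> p (u t))"
      using p by (intro mult_left_mono) auto
    then show "p * (\<alpha> * Q 0 - J \<Omega> p u0 + E t) \<le> PHI t - N2 t" using low[OF t] by linarith
  qed
  then show ?thesis unfolding \<alpha>_def S_def .
qed

lemma finite_Tmax_blows_up: "Tmax \<le> ereal c \<Longrightarrow> blows_up \<Omega> Tmax u"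
  using local by (auto simp: local_properties_def)

end

theorem theorem3p4:
  fixes \<Omega> \<Gamma>0 \<Gamma>1 :: "'a::euclidean_space set" and p :: real and u0 :: "'a \<Rightarrow> real"
    and Tmax :: ereal and u v vb :: "real \<Rightarrow> 'a \<Rightarrow> real"
  assumes "C1_domain \<Omega>"
    and "boundary_partition \<Omega> \<Gamma>0 \<Gamma>1"
    and "emeasure (surf (frontier \<Omega>)) \<Gamma>0 > 0"
    and "poincare_trace_ineq \<Omega> \<Gamma>0 \<Gamma>1"
    and "2 < p" and "ereal p \<le> 1 + two_star DIM('a) / 2"
    and "local_theory \<Omega> \<Gamma>0 \<Gamma>1 p"
    and "u0 \<in> B1 \<Omega> \<Gamma>0 p \<union> B2 \<Omega> \<Gamma>0 \<Gamma>1 p"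
    and "maximal_weak_solution \<Omega> \<Gamma>0 \<Gamma>1 p u0 Tmax u v vb"
  shows "blows_up \<Omega> Tmax u \<and>
    (u0 \<in> B1 \<Omega> \<Gamma>0 p \<longrightarrow>
      Tmax \<le> ereal (4 * (p - 1) / (p * (p - 2)\<^sup>2) *
        (((norm_Om 2 \<Omega> u0)\<^sup>2 + (norm_Gam \<Omega> \<Gamma>1 u0)\<^sup>2) / (well_depth \<Omega> \<Gamma>0 p - J \<Omega> p u0)))) \<and>
    (u0 \<in> B2 \<Omega> \<Gamma>0 \<Gamma>1 p \<longrightarrow>
      Tmax \<le> ereal (4 * (p - 1) / (p * (p - 2)\<^sup>2) *
        (((norm_Om 2 \<Omega> u0)\<^sup>2 + (norm_Gam \<Omega> \<Gamma>1 u0)\<^sup>2) /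
          ((p - 2) / (2 * p * (S1 \<Omega> \<Gamma>0 \<Gamma>1 + S2 \<Omega> \<Gamma>0)) *
             ((norm_Om 2 \<Omega> u0)\<^sup>2 + (norm_Gam \<Omega> \<Gamma>1 u0)\<^sup>2) - J \<Omega> p u0))))"
proof -
  have u0: "u0 \<in> H1_0 \<Omega> \<Gamma>0" using assms(8) by (auto simp: B1_def B2_def)
  interpret evolution \<Omega> \<Gamma>0 \<Gamma>1 p u0 Tmax u v vb
  proof
    show "open \<Omega>" "bounded \<Omega>" using assms(1) by (auto simp: C1_domain_def)
    show "0 < Tmax" "weak_solution_upto \<Omega> \<Gamma>0 \<Gamma>1 p u0 Tmax u v vb"
      using assms(9) by (auto simp: maximal_weak_solution_def)
    show "local_properties \<Omega> \<Gamma>0 \<Gamma>1 p u0 Tmax u v vb"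
      using assms(7,9) u0 unfolding local_theory_def by blast
  qed fact+
  show ?thesis
    using B1_bound B2_bound finite_Tmax_blows_up assms(8) unfolding Q_zero by blast
qed

end
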